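(* Consider the model $y=G(u)+\frac1{\sqrt n}\eta$ with priors $\mu_n$ on $\mathcal H_1$, noise $\eta\sim\mathcal N(0,\zeta)$ and posteriors $\mu_n^y$ as described in the context, and let $u_0\in\mathcal H_1$. Assume $G$ admits a singular value decomposition: $\mathcal H_1$ has an orthonormal basis $\{e_k\}$ with $G^TGe_k=\rho_k^2e_k$, $\rho_k>0$. Let $\{\varphi_k\}_{k\ge1}$ be an orthonormal basis of $\mathcal H_1$, let $P^\varphi_k$, $P^e_r$ be the orthogonal projections onto $\mathrm{span}\{\varphi_1,\dots,\varphi_k\}$ and $\mathrm{span}\{e_1,\dots,e_r\}$, and with $S=(G^{-1})^T$ put $$g_{k,r}=\max\{\|\zeta^{1/2}SP^e_rh\|_2^2:\ h\in\mathrm{span}\{\varphi_1,\dots,\varphi_k\},\ \|h\|_1\le1\}.$$ Assume there are positive real sequences $\epsilon_n,\xi_n$, sequences of positive integers $k_n,r_n$, and constants $C,C_1,C_2,R>0$ such that: (1) $\epsilon_n\to0$, $n\epsilon_n^2\to\infty$ and $\mu_n\{u:\|G(u)-G(u_0)\|_\zeta\le\epsilon_n\}\ge e^{-Cn\epsilon_n^2}$; (2) $r_n\to\infty$, $k_n<Rn\epsilon_n^2$, $\max\{\xi_n,k_n^{-1}\}\to0$, and $\mu_n\{u:\|P^\varphi_{k_n}P^e_{r_n}u-u\|_1>C_2\xi_n\}\le e^{-(C+4)n\epsilon_n^2}$; (3) $\sqrt{g_{k_n,r_n}}\le C_1\,\xi_n/\epsilon_n$; (4) $\|P^\varphi_{k_n}P^e_{r_n}u_0-u_0\|_1=O(\xi_n)$.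 Then for some $M>0$, $$\mu_n^y(u:\|u-u_0\|_1>M\xi_n)\to0\quad\text{in }\mathbb Q_{u_0,n}\text{-probability as }n\to\infty.$$
   Context: $\mathcal H_1,\mathcal H_2$ are infinite-dimensional separable Hilbert spaces with norms $\|\cdot\|_1,\|\cdot\|_2$; $G:\mathcal H_1\to\mathcal H_2$ is a bounded injective linear operator with adjoint $G^T$. $\eta$ is a centered Gaussian noise on $\mathcal H_2$ with covariance operator $\zeta$ (bounded, self-adjoint, positive definite; if $\zeta$ is not trace class, e.g. white noise $\zeta=I$, $\eta$ lives on a larger space $\widehat{\mathcal H}_2=\prod_i\mathbb R b_i$, $\{b_i\}$ an orthonormal basis of $\mathcal H_2$, and $\langle\eta,x\rangle_2$ are centered jointly Gaussian with covariance $\langle\zeta x,x'\rangle_2$). The Cameron–Martin inner product is $\langle x,x'\rangle_\zeta=\langle\zeta^{-1/2}x,\zeta^{-1/2}x'\rangle_2$ on $\mathcal H_\zeta=\zeta^{1/2}\mathcal H_2$, with norm $\|\cdot\|_\zeta$. Standing assumption: $G(\mathcal H_1)\subset\mathcal H_\zeta$. For each $n$, $\mu_n$ is a Borel probability measure on $\mathcal H_1$ (prior, law of $u$), $u$ independent of $\eta$. $\mathbb Q_{v,n}$ is the law of $G(v)+\eta/\sqrt n$ for fixed $v\in\mathcal H_1$. The posterior is $\mu_n^y(B)=\frac{1}{Z_n^y}\int_B e^{-\Phi(y,u)}d\mu_n(u)$, $\Phi(y,u)=\frac n2\|G(u)\|_\zeta^2-n\langle y,G(u)\rangle_\zeta$,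 $Z_n^y=\int_{\mathcal H_1}e^{-\Phi(y,u)}d\mu_n(u)$, where $\langle y,\cdot\rangle_\zeta$ is the (a.s. defined) measurable linear functional. Explicitly, $SP^e_rh=\sum_{i=1}^r\rho_i^{-2}\langle h,e_i\rangle_1\,Ge_i$. *)

theory Defs
  imports "HOL-Probability.Probability" "HOL-Library.Landau_Symbols"
begin

definition orthonormal_basis :: "(nat \<Rightarrow> 'a::real_inner) \<Rightarrow> bool" where
  "orthonormal_basis b \<longleftrightarrow>
     (\<forall>i j. inner (b i) (b j) = (if i = j then 1 else 0)) \<and> closure (span (range b)) = UNIV"

definition orth_proj :: "'a::real_inner set \<Rightarrow> 'a \<Rightarrow> 'a" where
  "orth_proj U x = (THE p. p \<in> U \<and> (\<forall>u\<in>U. inner (x - p) u = 0))"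

text \<open>Basis vectors are indexed from 0, so \<open>proj_upto e k\<close> projects onto the span of
  the first \<open>k\<close> of them.\<close>

definition proj_upto :: "(nat \<Rightarrow> 'a::real_inner) \<Rightarrow> nat \<Rightarrow> 'a \<Rightarrow> 'a" where
  "proj_upto e k = orth_proj (span (e ` {..<k}))"

definition bounded_selfadjoint :: "('a::real_inner \<Rightarrow> 'a) \<Rightarrow> bool" where
  "bounded_selfadjoint A \<longleftrightarrow> bounded_linear A \<and> (\<forall>x y. inner (A x) y = inner x (A y))"

definition positive_definite :: "('a::real_inner \<Rightarrow> 'a) \<Rightarrow> bool" where
  "positive_definite A \<longleftrightarrow> (\<forall>x. x \<noteq> 0 \<longrightarrow> 0 < inner (A x) x)"

text \<open>On a Hilbert space a bounded nonnegative self-adjoint operator has exactly one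
  bounded nonnegative self-adjoint square root, so the choice below is not arbitrary.\<close>

definition op_sqrt :: "('a::real_inner \<Rightarrow> 'a) \<Rightarrow> 'a \<Rightarrow> 'a" where
  "op_sqrt A = (SOME T. bounded_selfadjoint T \<and> (\<forall>x. 0 \<le> inner (T x) x) \<and> T \<circ> T = A)"

text \<open>The Cameron--Martin space of a positive definite covariance operator \<open>\<zeta>\<close>. The square root
  is injective, and its inverse is only meaningful on the range.\<close>

definition cm_space :: "('b::real_inner \<Rightarrow> 'b) \<Rightarrow> 'b set" where
  "cm_space \<zeta> = range (op_sqrt \<zeta>)"

definition cm_inner :: "('b::real_inner \<Rightarrow> 'b) \<Rightarrow> 'b \<Rightarrow> 'b \<Rightarrow> real" where
  "cm_inner \<zeta> x x' = inner (inv (op_sqrt \<zeta>) x) (inv (op_sqrt \<zeta>) x')"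

definition cm_norm :: "('b::real_inner \<Rightarrow> 'b) \<Rightarrow> 'b \<Rightarrow> real" where
  "cm_norm \<zeta> x = sqrt (cm_inner \<zeta> x x)"

text \<open>The adjoint of the (in general unbounded) inverse of \<open>G\<close>, which is a densely defined
  operator on the Hilbert space \<open>closure (range G)\<close>. Arguments outside the domain of the adjoint
  get an unspecified value.\<close>

definition inv_adjoint :: "('a::real_inner \<Rightarrow> 'b::real_inner) \<Rightarrow> 'a \<Rightarrow> 'b" where
  "inv_adjoint G h =
     (THE w. w \<in> closure (range G) \<and> (\<forall>x\<in>range G. inner w x = inner h (inv G x)))"

lemma inv_adjoint_eqI:
  assumes "inj G" and w: "w \<in> closure (range G)" and eq: "\<And>v. inner w (G v) = inner h v"
  shows "inv_adjoint G h = w"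
  unfolding inv_adjoint_def
proof (rule the_equality)
  show "w \<in> closure (range G) \<and> (\<forall>x\<in>range G. inner w x = inner h (inv G x))"
    using assms by simp
next
  fix w' assume w': "w' \<in> closure (range G) \<and> (\<forall>x\<in>range G. inner w' x = inner h (inv G x))"
  have "inner (w' - w) x = 0" if "x \<in> range G" for x
    using that w' eq \<open>inj G\<close> by (auto simp: inner_diff_left)
  then have "closure (range G) \<subseteq> {x. inner (w' - w) x = 0}"
    by (intro closure_minimal closed_Collect_eq continuous_intros) auto
  then have "inner (w' - w) w' = 0" "inner (w' - w) w = 0"
    using w w' by blast+
  then have "inner (w' - w) (w' - w) = 0"
    by (simp add: inner_diff_right)
  then show "w' = w"
    by simp
qed

text \<open>The explicit form of the adjoint on spans of singular vectors; the assumption on \<open>G\<close> and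
  \<open>e\<close> is the weak form of \<open>adjoint G (G (e i)) = (\<rho> i)\<^sup>2 *\<^sub>R e i\<close>.\<close>

lemma inv_adjoint_explicit:
  fixes G :: "'a::real_inner \<Rightarrow> 'b::real_inner"
  assumes "bounded_linear G" and "inj G" and rho: "\<And>i. \<rho> i > (0::real)"
    and svd: "\<And>i v. inner (G (e i)) (G v) = (\<rho> i)\<^sup>2 * inner (e i) v"
  shows "inv_adjoint G (\<Sum>i<r. inner h (e i) *\<^sub>R e i) = (\<Sum>i<r. (inner h (e i) / (\<rho> i)\<^sup>2) *\<^sub>R G (e i))"
proof (rule inv_adjoint_eqI[OF \<open>inj G\<close>])
  interpret G: bounded_linear G by fact
  have "(\<Sum>i<r. (inner h (e i) / (\<rho> i)\<^sup>2) *\<^sub>R G (e i)) = G (\<Sum>i<r. (inner h (e i) / (\<rho> i)\<^sup>2) *\<^sub>R e i)"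
    by (simp add: G.sum G.scaleR)
  then show "(\<Sum>i<r. (inner h (e i) / (\<rho> i)\<^sup>2) *\<^sub>R G (e i)) \<in> closure (range G)"
    using closure_subset by fastforce
next
  fix v
  have "\<rho> i \<noteq> 0" for i using rho[of i] by simp
  then show "inner (\<Sum>i<r. (inner h (e i) / (\<rho> i)\<^sup>2) *\<^sub>R G (e i)) (G v)
      = inner (\<Sum>i<r. inner h (e i) *\<^sub>R e i) v"
    by (simp add: inner_sum_left svd)
qed

text \<open>The supremum ranges over a compact set of values, hence is a maximum.\<close>

definition g_const ::
  "('a::real_inner \<Rightarrow> 'b::real_inner) \<Rightarrow> ('b \<Rightarrow> 'b) \<Rightarrow> (nat \<Rightarrow> 'a) \<Rightarrow> (nat \<Rightarrow> 'a) \<Rightarrow> nat \<Rightarrow> nat \<Rightarrow> real"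
  where
  "g_const G \<zeta> e \<phi> k r =
     Sup {(norm (op_sqrt \<zeta> (inv_adjoint G (proj_upto e r h))))\<^sup>2 | h.
            h \<in> span (\<phi> ` {..<k}) \<and> norm h \<le> 1}"

text \<open>Observations and noise live on the sequence space: a vector \<open>x\<close> of the Hilbert space is
  identified with its coordinates \<open>inner x (b i)\<close>, and \<open>y i\<close> stands for the pairing of \<open>y\<close> with
  \<open>b i\<close>. This covers both trace class and non trace class covariances.\<close>

abbreviation seq_space :: "(nat \<Rightarrow> real) measure" where
  "seq_space \<equiv> Pi\<^sub>M UNIV (\<lambda>_. borel)"

text \<open>The pairing of \<open>y\<close> with a finite linear combination \<open>x\<close> of the \<open>b i\<close>. It is only used for
  such \<open>x\<close>, for which the sum is finite.\<close>

definition coord_pairing :: "(nat \<Rightarrow> 'b::real_inner) \<Rightarrow> (nat \<Rightarrow> real) \<Rightarrow> 'b \<Rightarrow> real" where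
  "coord_pairing b y x = (\<Sum>i | inner x (b i) \<noteq> 0. inner x (b i) * y i)"

text \<open>The law of centered jointly Gaussian coordinates with covariance
  \<open>inner (\<zeta> (b i)) (b j)\<close>: every nontrivial finite linear combination is centered normal with the
  corresponding (positive) variance.\<close>

definition gaussian_noise ::
  "(nat \<Rightarrow> 'b::real_inner) \<Rightarrow> ('b \<Rightarrow> 'b) \<Rightarrow> (nat \<Rightarrow> real) measure \<Rightarrow> bool" where
  "gaussian_noise b \<zeta> N \<longleftrightarrow>
     prob_space N \<and> sets N = sets seq_space \<and>
     (\<forall>x\<in>span (range b). x \<noteq> 0 \<longrightarrow>
        distributed N lborel (\<lambda>w. coord_pairing b w x) (normal_density 0 (sqrt (inner (\<zeta> x) x))))"

text \<open>The law of \<open>G v + \<eta> / sqrt n\<close>, where \<open>N\<close> is the law of \<open>\<eta>\<close>.\<close>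

definition data_law ::
  "(nat \<Rightarrow> 'b::real_inner) \<Rightarrow> ('a \<Rightarrow> 'b) \<Rightarrow> (nat \<Rightarrow> real) measure \<Rightarrow> 'a \<Rightarrow> nat \<Rightarrow> (nat \<Rightarrow> real) measure"
  where
  "data_law b G N v n = distr N seq_space (\<lambda>w i. inner (G v) (b i) + w i / sqrt (real n))"

text \<open>\<open>L y x\<close> is a version, under the Gaussian law \<open>Q\<close>, of the measurable linear functional
  \<open>cm_inner \<zeta> y x\<close> for \<open>x\<close> in the Cameron--Martin space. For \<open>x = \<zeta> z\<close> it is formally the pairing
  of \<open>y\<close> with \<open>z\<close>; it extends from finite linear combinations \<open>z\<close> of the \<open>b i\<close> to the whole
  Cameron--Martin space by mean square limits.\<close>

definition cm_functional ::
  "(nat \<Rightarrow> 'b::real_inner) \<Rightarrow> ('b \<Rightarrow> 'b) \<Rightarrow> (nat \<Rightarrow> real) measure \<Rightarrow> ((nat \<Rightarrow> real) \<Rightarrow> 'b \<Rightarrow> real) \<Rightarrow> bool"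
  where
  "cm_functional b \<zeta> Q L \<longleftrightarrow>
     (\<forall>x\<in>cm_space \<zeta>. (\<lambda>y. L y x) \<in> borel_measurable Q \<and>
        (\<forall>z. (\<forall>j. z j \<in> span (range b)) \<and> (\<lambda>j. cm_norm \<zeta> (\<zeta> (z j) - x)) \<longlonglongrightarrow> 0 \<longrightarrow>
          (\<lambda>j::nat. \<integral>\<^sup>+ y. ennreal ((coord_pairing b y (z j) - L y x)\<^sup>2) \<partial>Q) \<longlonglongrightarrow> 0))"

definition neg_log_lik ::
  "('a \<Rightarrow> 'b::real_inner) \<Rightarrow> ('b \<Rightarrow> 'b) \<Rightarrow> ((nat \<Rightarrow> real) \<Rightarrow> 'b \<Rightarrow> real) \<Rightarrow> nat \<Rightarrow> (nat \<Rightarrow> real) \<Rightarrow> 'a \<Rightarrow> real"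
  where
  "neg_log_lik G \<zeta> L n y u = real n / 2 * (cm_norm \<zeta> (G u))\<^sup>2 - real n * L y (G u)"

text \<open>The normalizing constant is finite and positive for almost every \<open>y\<close>; for the remaining \<open>y\<close>
  the value is junk.\<close>

definition posterior ::
  "('a \<Rightarrow> 'b::real_inner) \<Rightarrow> ('b \<Rightarrow> 'b) \<Rightarrow> ((nat \<Rightarrow> real) \<Rightarrow> 'b \<Rightarrow> real) \<Rightarrow> 'a measure \<Rightarrow> nat
     \<Rightarrow> (nat \<Rightarrow> real) \<Rightarrow> 'a set \<Rightarrow> real"
  where
  "posterior G \<zeta> L \<mu> n y B =
     (LINT u:B|\<mu>. exp (- neg_log_lik G \<zeta> L n y u)) / (LINT u|\<mu>. exp (- neg_log_lik G \<zeta> L n y u))"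

end

(* Let T be the square root of the covariance and A = T^{-1} G. Under the law of the pure noise,
   W a = n <y, T a> (Cameron-Martin pairing) is a Gaussian process with covariance n <a, a'>, and by
   the Cameron-Martin formula the data law at u has density f_u = exp (W (A u) - n |A u|^2 / 2) with
   respect to it; this is exactly the likelihood in the posterior.

   The evidence is at least exp (- (C + 2) n eps^2) f_{u0} with high probability: apply AM-GM to
   f_u / f_{u0} on the small ball of the prior and use E [f_{u0}^2 / f_u] = exp (n |A u0 - A u|^2).
   The numerator is controlled by a test based on the spectral estimator of P^phi_k P^e_r u. The
   error of the estimator is a Gaussian vector in k dimensions with covariance at most g / n, so with
   k < R n eps^2 and sqrt g <= C1 xi / eps its probability of exceeding m xi is below
   exp (- (C + 4) n eps^2) for a suitable m. On the sieve, |u - u0| > M xi separates the means of the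
   estimator under u and u0 by 2 m xi, and outside the sieve the prior mass is small. *)
theory Submission
  imports Defs
begin


text \<open>\<open>y\<close> need not lie in the Hilbert space, and its pairing with a
  Cameron--Martin vector is known only through mean square limits. Each linearity relation therefore
  has its own null set, and no path of the process is treated as a linear map: every relation
  involves finitely many vectors, and the average over the prior enters through Fubini, with the
  likelihood jointly measurable in \<open>y\<close> and \<open>u\<close>. For the same reason the
  density of the data law is identified through characteristic functions of finitely many
  coordinates, which are separated one at a time, so that the uniqueness theorem on the real line
  suffices. All exponents are multiples of x = n eps^2. With c = exp (- (C + 2) x) the evidence
  bound fails with probability at most c exp (C x) exp x = exp (- x), and errors of order exp (- (C
  + 4) x), divided by c, still leave exp (- 2 x). The 4 thus pays for the C + 2 of the evidence with
  room to spare.\<close>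

section \<open>Operators on Hilbert spaces\<close>

text \<open>The representer is the minimiser over \<open>K\<close> of |x|^2 - 2 f x. One argument
  thus serves both Riesz representation (\<open>K = UNIV\<close>) and orthogonal projection onto
  \<open>K\<close> (\<open>f = inner x\<close>).\<close>

lemma riesz_on_subspace:
  fixes f :: "'h::{real_inner,complete_space} \<Rightarrow> real"
  assumes f: "bounded_linear f" and K: "subspace K" "closed K"
  obtains p where "p \<in> K" "\<And>v. v \<in> K \<Longrightarrow> f v = inner p v"
proof -
  interpret f: bounded_linear f by fact
  define J where "J x = (norm x)\<^sup>2 - 2 * f x" for x
  obtain B where B: "\<And>x. norm (f x) \<le> norm x * B" using f.bounded by auto
  have J_ge: "- B\<^sup>2 \<le> J x" for x
  proof -
    have "f x \<le> norm x * B" using B[of x] by simp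
    moreover have "0 \<le> (norm x - B)\<^sup>2" by simp
    ultimately show ?thesis by (simp add: J_def power2_diff)
  qed
  define m where "m = Inf (J ` K)"
  have bdd: "bdd_below (J ` K)" using J_ge by (auto intro!: bdd_belowI)
  have ne: "J ` K \<noteq> {}" using K(1) subspace_0 by blast
  have m_le: "m \<le> J x" if "x \<in> K" for x
    using that bdd by (auto simp: m_def intro: cInf_lower)
  have "\<exists>x\<in>K. J x < m + 1 / Suc n" for n
    using cInf_lessD[OF ne, of "m + 1 / Suc n"] by (auto simp: m_def)
  then obtain x where xK: "\<And>n. x n \<in> K" and xJ: "\<And>n. J (x n) < m + 1 / Suc n" by metis
  \<comment> \<open>Parallelogram law: the midpoint lies in \<open>K\<close>, so its value is at
    least \<open>m\<close>, and this makes the minimising sequence Cauchy.\<close>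
  have par: "(norm (x i - x j))\<^sup>2 \<le> 2 / Suc i + 2 / Suc j" for i j
  proof -
    have "(1/2) *\<^sub>R (x i + x j) \<in> K" by (intro subspace_scale[OF K(1)] subspace_add[OF K(1)] xK)
    then have "m \<le> J ((1/2) *\<^sub>R (x i + x j))" by (rule m_le)
    moreover have "(norm (x i - x j))\<^sup>2 = 2 * J (x i) + 2 * J (x j) - 4 * J ((1/2) *\<^sub>R (x i + x j))"
      by (simp add: J_def power2_norm_eq_inner inner_diff inner_add f.add f.scaleR inner_commute
            algebra_simps power_mult_distrib)
    ultimately show ?thesis using xJ[of i] xJ[of j] by simp
  qed
  have "Cauchy x"
  proof (rule CauchyI)
    fix e :: real assume "e > 0"
    then obtain n where n: "inverse (real (Suc n)) < e\<^sup>2 / 4" using reals_Archimedean[of "e\<^sup>2/4"] by auto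
    have "norm (x i - x j) < e" if "i \<ge> n" "j \<ge> n" for i j
    proof -
      have "1 / Suc i \<le> 1 / Suc n" "1 / Suc j \<le> 1 / Suc n"
        using that by (simp_all add: field_simps)
      then have "(norm (x i - x j))\<^sup>2 < e\<^sup>2"
        using par[of i j] n by (simp add: inverse_eq_divide)
      then show ?thesis using \<open>e > 0\<close> power_less_imp_less_base by force
    qed
    then show "\<exists>M. \<forall>m\<ge>M. \<forall>n\<ge>M. norm (x m - x n) < e" by blast
  qed
  then obtain p where p: "x \<longlonglongrightarrow> p" using Cauchy_convergent convergent_def by blast
  have pK: "p \<in> K" using closed_sequentially[OF K(2)] xK p by blast
  have "(\<lambda>n. J (x n)) \<longlonglongrightarrow> J p"
    unfolding J_def by (intro tendsto_intros f.tendsto p)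
  moreover have "(\<lambda>n. m + 1 / Suc n) \<longlonglongrightarrow> m + 0"
    by (intro tendsto_intros LIMSEQ_Suc[OF lim_1_over_n])
  ultimately have Jp: "J p \<le> m"
    using xJ by (intro LIMSEQ_le[of _ "J p" _ m]) (auto intro: less_imp_le)
  have "f v = inner p v" if v: "v \<in> K" for v
  proof (cases "v = 0")
    case False
    define c where "c = inner p v - f v"
    \<comment> \<open>The minimiser of the quadratic polynomial s -> J (p + s v); the decrease it
      would give is c^2 / |v|^2, so minimality of \<open>p\<close> forces
      \<open>c = 0\<close>.\<close>
    define t where "t = - c / (norm v)\<^sup>2"
    have nv: "(norm v)\<^sup>2 > 0" using False by simp
    have "p + t *\<^sub>R v \<in> K" by (intro subspace_scale[OF K(1)] subspace_add[OF K(1)] pK v)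
    then have "J p \<le> J (p + t *\<^sub>R v)" using m_le Jp by force
    also have "J (p + t *\<^sub>R v) = J p + t\<^sup>2 * (norm v)\<^sup>2 + 2 * t * c"
      by (simp add: J_def c_def power2_norm_eq_inner inner_add_left inner_add_right f.add f.scaleR
            inner_commute algebra_simps) (simp add: power2_norm_eq_inner power2_eq_square)
    also have "\<dots> = J p - c\<^sup>2 / (norm v)\<^sup>2"
      using nv by (simp add: t_def power2_eq_square field_simps)
    finally have "c\<^sup>2 / (norm v)\<^sup>2 \<le> 0" by simp
    then have "c = 0" using nv by (simp add: divide_le_0_iff)
    then show ?thesis by (simp add: c_def)
  qed simp
  with pK show thesis using that by blast
qed

text \<open>\<open>adjoint\<close> is a choice, so its characteristic identity holds as soon as some
  adjoint exists; the Riesz lemma on the whole space provides one.\<close>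

lemma adjoint_inner:
  fixes G :: "'h::{real_inner,complete_space} \<Rightarrow> 'k::real_inner"
  assumes "bounded_linear G"
  shows "inner (G x) y = inner x (adjoint G y)"
proof -
  have "\<exists>p. \<forall>x. inner (G x) y = inner x p" for y
  proof -
    have "bounded_linear (\<lambda>x. inner (G x) y)"
      using bounded_linear_compose[OF bounded_linear_inner_left assms] .
    from riesz_on_subspace[OF this subspace_UNIV closed_UNIV]
    show ?thesis by (metis UNIV_I inner_commute)
  qed
  then obtain h where "\<And>x y. inner (G x) y = inner x (h y)" by metis
  then show ?thesis
    unfolding adjoint_def by (rule someI2[where P="\<lambda>f'. \<forall>x y. inner (G x) y = inner x (f' y)", OF allI[OF allI]]) auto
qed

lemma closure_subspace:
  fixes K :: "'h::real_normed_vector set"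
  assumes "subspace K"
  shows "subspace (closure K)"
proof (rule subspaceI)
  show "0 \<in> closure K" using assms subspace_0 closure_subset by blast
next
  fix x y assume "x \<in> closure K" "y \<in> closure K"
  then obtain f g where f: "\<And>n. f n \<in> K" "f \<longlonglongrightarrow> x" and g: "\<And>n. g n \<in> K" "g \<longlonglongrightarrow> y"
    unfolding closure_sequential by metis
  have "(\<lambda>n. f n + g n) \<longlonglongrightarrow> x + y" using f g by (intro tendsto_add)
  then show "x + y \<in> closure K"
    unfolding closure_sequential
    by (intro exI[of _ "\<lambda>n. f n + g n"] conjI allI subspace_add[OF assms] f g)
next
  fix c x assume "x \<in> closure K"
  then obtain f where f: "\<And>n. f n \<in> K" "f \<longlonglongrightarrow> x" unfolding closure_sequential by metis
  have "(\<lambda>n. c *\<^sub>R f n) \<longlonglongrightarrow> c *\<^sub>R x" using f by (intro tendsto_intros)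
  then show "c *\<^sub>R x \<in> closure K"
    unfolding closure_sequential
    by (intro exI[of _ "\<lambda>n. c *\<^sub>R f n"] conjI allI subspace_scale[OF assms] f)
qed

text \<open>The Riesz lemma for \<open>inner x\<close> on the closed subspace
  \<open>closure K\<close> yields the projection \<open>p\<close> of \<open>x\<close>; the
  difference \<open>x - p\<close> is orthogonal to \<open>K\<close>, hence zero.\<close>

lemma dense_subspaceI:
  fixes K :: "'h::{real_inner,complete_space} set"
  assumes K: "subspace K" and orth: "\<And>x. (\<And>v. v \<in> K \<Longrightarrow> inner x v = 0) \<Longrightarrow> x = 0"
  shows "closure K = UNIV"
proof -
  have "x \<in> closure K" for x
  proof -
    have "bounded_linear (inner x)" by (rule bounded_linear_inner_right)
    from riesz_on_subspace[OF this closure_subspace[OF K] closed_closure]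
    obtain p where p: "p \<in> closure K" "\<And>v. v \<in> closure K \<Longrightarrow> inner x v = inner p v" by blast
    have "x - p = 0"
      using p closure_subset by (intro orth) (auto simp: inner_diff_left)
    then show ?thesis using p(1) by simp
  qed
  then show ?thesis by auto
qed

lemma proj_upto_orthonormal:
  fixes e :: "nat \<Rightarrow> 'h::real_inner"
  assumes on: "\<And>i j. inner (e i) (e j) = (if i = j then 1 else 0)"
  shows "proj_upto e k x = (\<Sum>i<k. inner x (e i) *\<^sub>R e i)"
  unfolding proj_upto_def orth_proj_def
proof (rule the_equality)
  let ?p = "\<Sum>i<k. inner x (e i) *\<^sub>R e i"
  have mem: "?p \<in> span (e ` {..<k})"
    by (intro span_sum span_scale span_base) auto
  have orth: "inner (x - ?p) u = 0" if "u \<in> span (e ` {..<k})" for u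
    using that
  proof (induction rule: span_induct)
    case base
    show ?case by (rule subspace_hyperplane)
  next
    case (step u)
    then show ?case
      by (auto simp: inner_diff_left inner_sum_left on if_distrib[of "(*) _"] cong: if_cong)
  qed
  show "?p \<in> span (e ` {..<k}) \<and> (\<forall>u\<in>span (e ` {..<k}). inner (x - ?p) u = 0)"
    using mem orth by blast
  fix q assume q: "q \<in> span (e ` {..<k}) \<and> (\<forall>u\<in>span (e ` {..<k}). inner (x - q) u = 0)"
  then have "q - ?p \<in> span (e ` {..<k})" using mem span_diff by blast
  with q orth have "inner (x - q) (q - ?p) = 0" "inner (x - ?p) (q - ?p) = 0" by blast+
  then have "inner (q - ?p) (q - ?p) = 0" by (simp add: inner_diff_left)
  then show "q = ?p" by simp
qed

lemma continuous_on_proj_upto: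
  fixes e :: "nat \<Rightarrow> 'h::real_inner"
  assumes "orthonormal_basis e"
  shows "continuous_on UNIV (proj_upto e k)"
proof -
  have "proj_upto e k = (\<lambda>x. \<Sum>i<k. inner x (e i) *\<^sub>R e i)"
    using assms proj_upto_orthonormal by (auto simp: orthonormal_basis_def)
  then show ?thesis by (auto intro!: continuous_intros)
qed

section \<open>Existence of positive square roots\<close>

lemma norm_selfadjoint_le:
  fixes B :: "'h::real_inner \<Rightarrow> 'h"
  assumes B: "bounded_selfadjoint B" and B0: "\<And>x. 0 \<le> inner (B x) x"
    and B1: "\<And>x. inner (B x) x \<le> inner x x"
  shows "norm (B x) \<le> norm x"
proof (cases "B x = 0")
  case False
  interpret B: bounded_linear B using B by (simp add: bounded_selfadjoint_def)
  have sym: "inner (B x) y = inner x (B y)" for x y using B by (simp add: bounded_selfadjoint_def)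
  define q where "q = inner (B x) (B x)"
  have q: "q > 0" using False by (simp add: q_def)
  \<comment> \<open>Positivity at \<open>x - B x\<close> bounds 2 |B x|^2 by two values of the
    quadratic form, which are at most |x|^2 and |B x|^2; no spectral theory enters.\<close>
  have "0 \<le> inner (B (x - B x)) (x - B x)" by (rule B0)
  also have "\<dots> = inner (B x) x - 2 * q + inner (B (B x)) (B x)"
    using sym[of x "B x"] by (simp add: B.diff inner_diff q_def inner_commute)
  also have "\<dots> \<le> inner x x - 2 * q + q" using B1[of x] B1[of "B x"] by (simp add: q_def)
  finally have "(norm (B x))\<^sup>2 \<le> (norm x)\<^sup>2" by (simp add: q_def power2_norm_eq_inner)
  then show ?thesis by (rule power2_le_imp_le) simp
qed simp

fun sqrt_iter :: "('h::real_inner \<Rightarrow> 'h) \<Rightarrow> nat \<Rightarrow> 'h \<Rightarrow> 'h" where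
  "sqrt_iter B 0 x = 0"
| "sqrt_iter B (Suc n) x = (1/2) *\<^sub>R (B x + sqrt_iter B n (sqrt_iter B n x))"

fun sqrt_majorant :: "nat \<Rightarrow> real" where
  "sqrt_majorant 0 = 0"
| "sqrt_majorant (Suc n) = (1 + (sqrt_majorant n)\<^sup>2) / 2"

lemma sqrt_majorant_bounds: "0 \<le> sqrt_majorant n" "sqrt_majorant n \<le> 1"
proof -
  have "0 \<le> sqrt_majorant n \<and> sqrt_majorant n \<le> 1"
    by (induction n) (auto simp: power_le_one)
  then show "0 \<le> sqrt_majorant n" "sqrt_majorant n \<le> 1" by auto
qed

lemma incseq_sqrt_majorant: "incseq sqrt_majorant"
proof (rule incseq_SucI)
  fix n
  have "0 \<le> (sqrt_majorant n - 1)\<^sup>2" by simp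
  then show "sqrt_majorant n \<le> sqrt_majorant (Suc n)" by (simp add: power2_diff)
qed

lemma convergent_sqrt_majorant: "convergent sqrt_majorant"
proof -
  have "bdd_above (range sqrt_majorant)"
    using sqrt_majorant_bounds by (auto intro!: bdd_aboveI)
  then show ?thesis
    by (rule convergentI[OF LIMSEQ_incseq_SUP[OF _ incseq_sqrt_majorant]])
qed

text \<open>The limit of the iteration \<open>S \<mapsto> (B + S\<^sup>2) / 2\<close> satisfies \<open>(1 - S)\<^sup>2 = 1 - B\<close>. Its increments
  are dominated by those of the scalar iteration started with \<open>B = 1\<close>.\<close>

lemma ex_sqrt_contraction:
  fixes B :: "'h::{real_inner,complete_space} \<Rightarrow> 'h"
  assumes B: "bounded_selfadjoint B" and B1: "\<And>x. norm (B x) \<le> norm x"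
  shows "\<exists>T. bounded_selfadjoint T \<and> (\<forall>x. 0 \<le> inner (T x) x) \<and> (\<forall>x. T (T x) = x - B x)"
proof -
  interpret B: bounded_linear B using B by (simp add: bounded_selfadjoint_def)
  have sym: "inner (B x) y = inner x (B y)" for x y using B by (simp add: bounded_selfadjoint_def)
  let ?S = "sqrt_iter B" and ?s = sqrt_majorant
  have lin: "linear (?S n)" for n
  proof (induction n)
    case 0
    have "?S 0 = (\<lambda>x. 0)" by auto
    then show ?case by (simp add: linear_iff)
  next
    case (Suc n)
    then show ?case
      by (auto simp: linear_iff B.add B.scaleR algebra_simps)
  qed
  have add: "?S n (x + y) = ?S n x + ?S n y" and scale: "?S n (c *\<^sub>R x) = c *\<^sub>R ?S n x"
    and diff: "?S n (x - y) = ?S n x - ?S n y" for n x y c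
    using linear_add[OF lin] linear_scale[OF lin] linear_diff[OF lin] by blast+
  have S_B: "?S n (B x) = B (?S n x)" for n x
    by (induction n arbitrary: x) (simp_all add: B.zero B.add B.scaleR)
  have comm: "?S n (?S m x) = ?S m (?S n x)" for n m x
  proof (induction n arbitrary: x)
    case 0
    show ?case by (simp add: linear_0[OF lin])
  next
    case (Suc n)
    then show ?case by (simp add: add scale S_B)
  qed
  have S_sym: "inner (?S n x) y = inner x (?S n y)" for n x y
    by (induction n arbitrary: x y) (simp_all add: inner_add sym)
  have bound: "norm (?S n x) \<le> ?s n * norm x" for n x
  proof (induction n arbitrary: x)
    case (Suc n)
    have "norm (?S n (?S n x)) \<le> ?s n * (?s n * norm x)"
      using Suc[of "?S n x"] Suc[of x] sqrt_majorant_bounds(1)[of n]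
      by (meson mult_left_mono order_trans)
    then have "norm (B x + ?S n (?S n x)) \<le> norm x + ?s n * (?s n * norm x)"
      using B1[of x] by (intro order_trans[OF norm_triangle_ineq] add_mono)
    then show ?case by (simp add: algebra_simps power2_eq_square flip: scaleR_add_right)
  qed simp
  have bound1: "norm (?S n x) \<le> norm x" for n x
    using bound[of n x] sqrt_majorant_bounds(2)[of n]
    by (meson mult_left_le_one_le norm_ge_zero order_trans sqrt_majorant_bounds(1))
  \<comment> \<open>The iterates commute, so the difference of two consecutive squares factors into
    sum times difference, exactly as for the scalar majorant.\<close>
  have step: "norm (?S (Suc n) x - ?S n x) \<le> (?s (Suc n) - ?s n) * norm x" for n x
  proof (induction n arbitrary: x)
    case 0
    show ?case using B1[of x] by simp
  next
    case (Suc n)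
    let ?d = "?S (Suc n) x - ?S n x"
    have "?S (Suc (Suc n)) x - ?S (Suc n) x
        = (1/2) *\<^sub>R (?S (Suc n) (?S (Suc n) x) - ?S n (?S n x))"
      by (simp add: algebra_simps)
    also have "?S (Suc n) (?S (Suc n) x) - ?S n (?S n x) = ?S (Suc n) ?d + ?S n ?d"
      unfolding diff comm[of n "Suc n"] by simp
    finally have "norm (?S (Suc (Suc n)) x - ?S (Suc n) x) \<le> (1/2) * (norm (?S (Suc n) ?d) + norm (?S n ?d))"
      by (simp del: sqrt_iter.simps add: norm_triangle_ineq)
    also have "\<dots> \<le> (1/2) * (?s (Suc n) * norm ?d + ?s n * norm ?d)"
      by (intro mult_left_mono add_mono bound) auto
    also have "\<dots> = (1/2) * (?s (Suc n) + ?s n) * norm ?d" by (simp add: algebra_simps)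
    also have "\<dots> \<le> (1/2) * (?s (Suc n) + ?s n) * ((?s (Suc n) - ?s n) * norm x)"
      by (intro mult_left_mono Suc) (simp add: sqrt_majorant_bounds del: sqrt_majorant.simps)
    also have "\<dots> = (?s (Suc (Suc n)) - ?s (Suc n)) * norm x"
    proof -
      have s2: "?s (Suc (Suc n)) = (1 + (?s (Suc n))\<^sup>2) / 2" and s1: "?s (Suc n) = (1 + (?s n)\<^sup>2) / 2"
        by simp_all
      have "?s (Suc (Suc n)) - ?s (Suc n) = (1/2) * (?s (Suc n) + ?s n) * (?s (Suc n) - ?s n)"
      proof -
        have "c - b = (1/2) * (b + a) * (b - a)" if "c = (1 + b\<^sup>2) / 2" "b = (1 + a\<^sup>2) / 2" for a b c :: real
        proof -
          have "c - b = (1 + b\<^sup>2) / 2 - (1 + a\<^sup>2) / 2" using that by metis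
          then show ?thesis by (simp add: power2_eq_square field_simps)
        qed
        from this[OF s2 s1] show ?thesis .
      qed
      then show ?thesis by (simp only: mult.assoc)
    qed
    finally show ?case .
  qed
  have tele: "norm (?S (n + m) x - ?S n x) \<le> (?s (n + m) - ?s n) * norm x" for n m x
  proof (induction m)
    case (Suc m)
    have "norm (?S (n + Suc m) x - ?S n x) \<le> norm (?S (Suc (n + m)) x - ?S (n + m) x) + norm (?S (n + m) x - ?S n x)"
      using norm_triangle_ineq[of "?S (Suc (n + m)) x - ?S (n + m) x" "?S (n + m) x - ?S n x"]
      by (simp del: sqrt_iter.simps)
    also have "\<dots> \<le> (?s (n + Suc m) - ?s n) * norm x"
      using add_mono[OF step[of "n + m" x] Suc] by (simp only: add_Suc_right) (simp add: algebra_simps del: sqrt_majorant.simps)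
    finally show ?case .
  qed simp
  have "convergent (\<lambda>n. ?S n x)" for x
  proof -
    have "Cauchy (\<lambda>n. ?S n x)"
    proof (rule CauchyI')
      fix e :: real assume e: "e > 0"
      have "Cauchy ?s" using convergent_sqrt_majorant by (rule convergent_Cauchy)
      then obtain M where M: "\<And>m n. m \<ge> M \<Longrightarrow> n \<ge> M \<Longrightarrow> norm (?s m - ?s n) < e / (norm x + 1)"
        using e unfolding Cauchy_iff by (metis add_nonneg_pos divide_pos_pos norm_ge_zero zero_less_one)
      show "\<exists>M. \<forall>m\<ge>M. \<forall>n>m. dist (?S m x) (?S n x) < e"
        unfolding dist_norm
      proof (intro exI allI impI)
        fix m n assume mn: "m \<ge> M" "n > m"

        have "norm (?S m x - ?S n x) = norm (?S (m + (n - m)) x - ?S m x)"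
          using mn by (simp add: norm_minus_commute)
        also have "\<dots> \<le> (?s n - ?s m) * norm x" using tele[of m "n - m" x] mn by simp
        also have "\<dots> \<le> (?s n - ?s m) * (norm x + 1)"
          using incseqD[OF incseq_sqrt_majorant, of m n] mn by (intro mult_left_mono) auto
        also have "\<dots> < e"
        proof -
          have "?s n - ?s m < e / (norm x + 1)" using M[of n m] mn by auto
          moreover have "norm x + 1 > 0" by (simp add: add_nonneg_pos)
          ultimately show ?thesis by (simp only: pos_less_divide_eq)
        qed
        finally show "norm (?S m x - ?S n x) < e" .
      qed
    qed
    then show ?thesis by (rule Cauchy_convergent)
  qed
  then have S: "(\<lambda>n. ?S n x) \<longlonglongrightarrow> lim (\<lambda>n. ?S n x)" for x by (simp add: convergent_LIMSEQ_iff)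
  define S where "S x = lim (\<lambda>n. ?S n x)" for x
  note S = S[folded S_def]
  have S_add: "S (x + y) = S x + S y" for x y
    using tendsto_add[OF S[of x] S[of y]] by (intro LIMSEQ_unique[OF S]) (simp add: add)
  have S_scale: "S (c *\<^sub>R x) = c *\<^sub>R S x" for c x
    using tendsto_scaleR[OF tendsto_const[of c] S[of x]] by (intro LIMSEQ_unique[OF S]) (simp add: scale)
  have S_bound: "norm (S x) \<le> norm x" for x
    using tendsto_norm[OF S[of x]] by (rule LIMSEQ_le_const2) (use bound1 in auto)
  have S_symm: "inner (S x) y = inner x (S y)" for x y
    using tendsto_inner[OF S[of x] tendsto_const[of y]] tendsto_inner[OF tendsto_const[of x] S[of y]]
    unfolding S_sym by (rule LIMSEQ_unique)
  \<comment> \<open>Pointwise convergence passes to the composition because all iterates have norm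
    at most 1.\<close>
  have SS: "(\<lambda>n. ?S n (?S n x)) \<longlonglongrightarrow> S (S x)" for x
  proof -
    have "(\<lambda>n. ?S n (?S n x - S x)) \<longlonglongrightarrow> 0"
    proof (rule Lim_null_comparison)
      show "\<forall>\<^sub>F n in sequentially. norm (?S n (?S n x - S x)) \<le> norm (?S n x - S x)"
        using bound1 by (intro always_eventually allI)
      show "(\<lambda>n. norm (?S n x - S x)) \<longlonglongrightarrow> 0"
        by (rule tendsto_norm_zero[OF LIM_zero[OF S]])
    qed
    from tendsto_add[OF this S[of "S x"]] show ?thesis by (simp add: diff)
  qed
  have fix_S: "S x = (1/2) *\<^sub>R (B x + S (S x))" for x
  proof (rule LIMSEQ_unique)
    show "(\<lambda>n. ?S (Suc n) x) \<longlonglongrightarrow> S x" using S by (rule LIMSEQ_Suc)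
    show "(\<lambda>n. ?S (Suc n) x) \<longlonglongrightarrow> (1/2) *\<^sub>R (B x + S (S x))"
      by (simp, intro tendsto_intros SS)
  qed
  define T where "T x = x - S x" for x
  have "bounded_linear T"
  proof (rule bounded_linear_intro[where K=2])
    show "T (x + y) = T x + T y" "T (c *\<^sub>R x) = c *\<^sub>R T x" for x y c
      by (simp_all add: T_def S_add S_scale algebra_simps)
    show "norm (T x) \<le> norm x * 2" for x
      using norm_triangle_ineq4[of x "S x"] S_bound[of x] by (simp add: T_def)
  qed
  moreover have "inner (T x) y = inner x (T y)" for x y
    by (simp add: T_def inner_diff S_symm)
  moreover have "0 \<le> inner (T x) x" for x
  proof -
    have "inner (S x) x \<le> norm (S x) * norm x" by (rule norm_cauchy_schwarz)
    also have "\<dots> \<le> norm x * norm x" by (intro mult_right_mono S_bound) simp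
    finally show ?thesis by (simp add: T_def inner_diff dot_square_norm power2_eq_square)
  qed
  moreover have "T (T x) = x - B x" for x
  proof -
    have "S (x - S x) = S x - S (S x)"
      unfolding eq_diff_eq by (simp only: S_add[symmetric] diff_add_cancel)
    then have "T (T x) = x - 2 *\<^sub>R S x + S (S x)" by (simp add: T_def algebra_simps scaleR_2)
    also have "2 *\<^sub>R S x = B x + S (S x)" using arg_cong[OF fix_S[of x], of "\<lambda>v. 2 *\<^sub>R v"] by simp
    finally show ?thesis by simp
  qed
  ultimately show ?thesis unfolding bounded_selfadjoint_def by blast
qed

text \<open>Since \<open>op_sqrt\<close> is a choice, existence of one root is the point. If
  \<open>c\<close> is a norm bound of \<open>A\<close>, then \<open>B\<close> = 1 - A / c lies
  between 0 and 1, and the root of 1 - B times \<open>sqrt c\<close> is a root of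
  \<open>A\<close>.\<close>

lemma op_sqrt_properties:
  fixes A :: "'h::{real_inner,complete_space} \<Rightarrow> 'h"
  assumes A: "bounded_selfadjoint A" and A0: "\<And>x. 0 \<le> inner (A x) x"
  shows "bounded_selfadjoint (op_sqrt A)" "op_sqrt A (op_sqrt A x) = A x"
proof -
  interpret A: bounded_linear A using A by (simp add: bounded_selfadjoint_def)
  have sym: "inner (A x) y = inner x (A y)" for x y using A by (simp add: bounded_selfadjoint_def)
  obtain c where c: "c > 0" "\<And>x. norm (A x) \<le> norm x * c" using A.pos_bounded by blast
  define B where "B x = x - (1/c) *\<^sub>R A x" for x
  have B: "bounded_selfadjoint B"
    unfolding bounded_selfadjoint_def
  proof (intro conjI allI)
    show "bounded_linear B" unfolding B_def
      by (intro bounded_linear_sub bounded_linear_ident bounded_linear_const_scaleR A.bounded_linear)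
    show "inner (B x) y = inner x (B y)" for x y by (simp add: B_def inner_diff sym)
  qed
  have AA: "inner (A x) x \<le> c * inner x x" for x
  proof -
    have "inner (A x) x \<le> norm (A x) * norm x" by (rule norm_cauchy_schwarz)
    also have "\<dots> \<le> norm x * c * norm x" by (intro mult_right_mono c) simp
    finally show ?thesis by (simp add: dot_square_norm power2_eq_square mult_ac)
  qed
  have "norm (B x) \<le> norm x" for x
  proof (rule norm_selfadjoint_le[OF B])
    show "0 \<le> inner (B x) x" for x using AA[of x] c(1) by (simp add: B_def inner_diff field_simps)
    show "inner (B x) x \<le> inner x x" for x using A0[of x] c(1) by (simp add: B_def inner_diff)
  qed
  from ex_sqrt_contraction[OF B this] obtain T where T: "bounded_selfadjoint T"
    "\<And>x. 0 \<le> inner (T x) x" "\<And>x. T (T x) = x - B x" by blast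
  interpret T: bounded_linear T using T by (simp add: bounded_selfadjoint_def)
  define T' where "T' x = sqrt c *\<^sub>R T x" for x
  have "bounded_selfadjoint T' \<and> (\<forall>x. 0 \<le> inner (T' x) x) \<and> T' \<circ> T' = A"
  proof (intro conjI allI ext)
    show "bounded_selfadjoint T'"
      unfolding bounded_selfadjoint_def
    proof (intro conjI allI)
      show "bounded_linear T'" unfolding T'_def
        by (intro bounded_linear_const_scaleR T.bounded_linear)
      show "inner (T' x) y = inner x (T' y)" for x y
        using T(1) by (simp add: bounded_selfadjoint_def T'_def)
    qed
    show "0 \<le> inner (T' x) x" for x using T(2)[of x] c(1) by (simp add: T'_def)
    show "(T' \<circ> T') x = A x" for x
      using c(1) by (simp add: T'_def T.scaleR T(3) B_def)
  qed
  then have *: "bounded_selfadjoint (op_sqrt A) \<and> (\<forall>x. 0 \<le> inner (op_sqrt A x) x) \<and> op_sqrt A \<circ> op_sqrt A = A"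
    unfolding op_sqrt_def
    by (rule someI[where P="\<lambda>T. bounded_selfadjoint T \<and> (\<forall>x. 0 \<le> inner (T x) x) \<and> T \<circ> T = A"])
  then show "bounded_selfadjoint (op_sqrt A)" "op_sqrt A (op_sqrt A x) = A x"
    by (auto simp: fun_eq_iff)
qed


section \<open>Measures determined by characteristic functions\<close>

text \<open>The total mass is the value of the characteristic function at 0, hence common to both
  measures. Dividing by it leads to Levy's uniqueness theorem for probability measures; mass 0 is
  treated apart.\<close>

lemma finite_measure_eqI_char:
  fixes M1 M2 :: "real measure"
  assumes "finite_measure M1" "finite_measure M2"
    and sets1: "sets M1 = sets borel" and sets2: "sets M2 = sets borel"
    and char_eq: "char M1 = char M2"
  shows "M1 = M2"
proof -
  interpret M1: finite_measure M1 by fact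
  interpret M2: finite_measure M2 by fact
  have space1: "space M1 = UNIV" and space2: "space M2 = UNIV"
    using sets_eq_imp_space_eq[OF sets1] sets_eq_imp_space_eq[OF sets2] by auto
  define m where "m = measure M1 UNIV"
  have "char M1 0 = of_real (measure M1 UNIV)" "char M2 0 = of_real (measure M2 UNIV)"
    by (simp_all add: char_def space1 space2 scaleR_conv_of_real)
  with char_eq have m2: "measure M2 UNIV = m" by (simp add: m_def)
  have em1: "emeasure M1 UNIV = ennreal m" and em2: "emeasure M2 UNIV = ennreal m"
    by (simp_all add: m_def M1.emeasure_eq_measure M2.emeasure_eq_measure m2[unfolded m_def])
  show ?thesis
  proof (cases "m = 0")
    case True
    show ?thesis
    proof (rule measure_eqI)
      show "sets M1 = sets M2" by (simp add: sets1 sets2)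
      fix A assume "A \<in> sets M1"
      have "emeasure M1 A \<le> emeasure M1 UNIV" "emeasure M2 A \<le> emeasure M2 UNIV"
        by (intro emeasure_mono; simp add: sets1 sets2)+
      then show "emeasure M1 A = emeasure M2 A" using True em1 em2 by simp
    qed
  next
    case False
    then have m0: "m > 0" by (simp add: m_def zero_less_measure_iff)
    let ?D = "\<lambda>M :: real measure. density M (\<lambda>_. ennreal (1 / m))"
    have pr: "real_distribution (?D M)" if "emeasure M UNIV = ennreal m" "sets M = sets borel" for M :: "real measure"
    proof -
      have "space M = UNIV" using sets_eq_imp_space_eq[OF that(2)] by simp
      then have "emeasure (?D M) (space (?D M)) = 1"
        using that m0 sets.top[of M] by (simp add: emeasure_density flip: ennreal_mult)
      then have "prob_space (?D M)" by (rule prob_spaceI)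
      then show ?thesis
        by (simp add: real_distribution_def real_distribution_axioms_def that(2))
    qed
    have ch: "char (?D M) = (\<lambda>t. (1 / m) *\<^sub>R char M t)" if "sets M = sets borel" for M :: "real measure"
    proof
      fix t
      have [measurable_cong]: "sets M = sets borel" by (rule that)
      show "char (?D M) t = (1 / m) *\<^sub>R char M t"
        unfolding char_def using m0 by (subst integral_density) auto
    qed
    have "?D M1 = ?D M2"
      by (rule Levy_uniqueness) (simp_all add: pr em1 em2 sets1 sets2 ch char_eq)
    then have "emeasure (?D M1) A = emeasure (?D M2) A" for A by simp
    then have *: "ennreal (1 / m) * emeasure M1 A = ennreal (1 / m) * emeasure M2 A" if "A \<in> sets borel" for A
      using that emeasure_density_const[of A M1] emeasure_density_const[of A M2] by (metis sets1 sets2)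
    show ?thesis
    proof (rule measure_eqI)
      show "sets M1 = sets M2" by (simp add: sets1 sets2)
      fix A assume "A \<in> sets M1"
      then show "emeasure M1 A = emeasure M2 A"
        using *[of A] m0 by (simp add: sets1 ennreal_mult_cancel_left)
    qed
  qed
qed

text \<open>The images under \<open>X1\<close> and \<open>X2\<close> of the measures weighted by
  \<open>w1\<close> and \<open>w2\<close> are finite measures on the line with the same
  characteristic function. The underlying spaces may differ, which later allows a comparison with a
  product space.\<close>

lemma integral_eq_of_char_eq:
  fixes g :: "real \<Rightarrow> 'c::{banach, second_countable_topology}"
  assumes w1: "integrable M1 w1" "\<And>x. 0 \<le> w1 x" and X1[measurable]: "X1 \<in> borel_measurable M1"
    and w2: "integrable M2 w2" "\<And>x. 0 \<le> w2 x" and X2[measurable]: "X2 \<in> borel_measurable M2"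
    and eq: "\<And>s. (CLINT x|M1. w1 x *\<^sub>R iexp (s * X1 x)) = (CLINT x|M2. w2 x *\<^sub>R iexp (s * X2 x))"
    and g[measurable]: "g \<in> borel_measurable borel"
  shows "(\<integral>x. w1 x *\<^sub>R g (X1 x) \<partial>M1) = (\<integral>x. w2 x *\<^sub>R g (X2 x) \<partial>M2)"
proof -
  let ?D = "\<lambda>M w X. distr (density M (\<lambda>x. ennreal (w x))) borel X"
  have ig: "integral\<^sup>L (?D M w X) h = (\<integral>x. w x *\<^sub>R h (X x) \<partial>M)"
    if "integrable M w" "\<And>x. 0 \<le> w x" and [measurable]: "X \<in> borel_measurable M" "h \<in> borel_measurable borel"
    for M :: "'d measure" and w and X :: "'d \<Rightarrow> real" and h :: "real \<Rightarrow> 'e::{banach, second_countable_topology}"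
  proof -
    have [measurable]: "w \<in> borel_measurable M" using that(1) by auto
    show ?thesis
      using that(2) by (simp add: integral_distr integral_density)
  qed
  have fin: "finite_measure (?D M w X)"
    if "integrable M w" "\<And>x. 0 \<le> w x" and [measurable]: "X \<in> borel_measurable M"
    for M :: "'d measure" and w and X :: "'d \<Rightarrow> real"
  proof (rule finite_measure.finite_measure_distr)
    have [measurable]: "w \<in> borel_measurable M" using that(1) by auto
    show "finite_measure (density M (\<lambda>x. ennreal (w x)))"
    proof
      have "emeasure (density M (\<lambda>x. ennreal (w x))) (space M) = (\<integral>\<^sup>+x. ennreal (w x) \<partial>M)"
        by (simp add: emeasure_density cong: nn_integral_cong)
      also have "\<dots> < \<infinity>" using that(1,2) by (simp add: nn_integral_eq_integral)
      finally show "emeasure (density M (\<lambda>x. ennreal (w x))) (space (density M (\<lambda>x. ennreal (w x)))) \<noteq> \<infinity>"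
        by simp
    qed
    show "X \<in> measurable (density M (\<lambda>x. ennreal (w x))) borel" by simp
  qed
  have "?D M1 w1 X1 = ?D M2 w2 X2"
  proof (rule finite_measure_eqI_char)
    show "char (?D M1 w1 X1) = char (?D M2 w2 X2)"
      using eq by (auto simp: char_def ig[OF w1 X1] ig[OF w2 X2])
  qed (simp_all add: fin w1 w2 X1 X2)
  then show ?thesis by (simp only: ig[OF w1 X1 g, symmetric] ig[OF w2 X2 g, symmetric])
qed

text \<open>\<open>1 + cos V\<close> and \<open>1 + sin V\<close> are nonnegative weights, so the uniqueness theorem for one real
  variable applies to them; this separates the variable \<open>X\<close> from the remaining ones.\<close>

lemma integral_iexp_eq_of_char_eq:
  fixes g :: "real \<Rightarrow> complex"
  assumes I1: "integrable M1 I1" "\<And>x. 0 \<le> I1 x"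
    and X1[measurable]: "X1 \<in> borel_measurable M1" and V1[measurable]: "V1 \<in> borel_measurable M1"
    and I2: "integrable M2 I2" "\<And>x. 0 \<le> I2 x"
    and X2[measurable]: "X2 \<in> borel_measurable M2" and V2[measurable]: "V2 \<in> borel_measurable M2"
    and eq: "\<And>s c. c \<in> {-1, 0, 1} \<Longrightarrow> (CLINT x|M1. I1 x *\<^sub>R iexp (s * X1 x + c * V1 x))
        = (CLINT x|M2. I2 x *\<^sub>R iexp (s * X2 x + c * V2 x))"
    and g[measurable]: "g \<in> borel_measurable borel"
    and g1: "integrable M1 (\<lambda>x. I1 x *\<^sub>R g (X1 x))" and g2: "integrable M2 (\<lambda>x. I2 x *\<^sub>R g (X2 x))"
  shows "(CLINT x|M1. I1 x *\<^sub>R (iexp (V1 x) * g (X1 x))) = (CLINT x|M2. I2 x *\<^sub>R (iexp (V2 x) * g (X2 x)))"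
proof -
  \<comment> \<open>\<open>cos V\<close> and \<open>sin V\<close> are combinations of
    \<open>iexp V\<close> and \<open>iexp (- V)\<close>, which is why the frequencies -1, 0, 1 of
    \<open>V\<close> are the ones in the hypothesis.\<close>
  have cos_split: "(CLINT x|M. (I x * (1 + cos (V x))) *\<^sub>R iexp (s * X x))
      = (CLINT x|M. I x *\<^sub>R iexp (s * X x + 0 * V x)) + (1/2) * (CLINT x|M. I x *\<^sub>R iexp (s * X x + 1 * V x))
        + (1/2) * (CLINT x|M. I x *\<^sub>R iexp (s * X x + (-1) * V x))" (is ?C)
   and sin_split: "(CLINT x|M. (I x * (1 + sin (V x))) *\<^sub>R iexp (s * X x))
      = (CLINT x|M. I x *\<^sub>R iexp (s * X x + 0 * V x)) - (\<i>/2) * (CLINT x|M. I x *\<^sub>R iexp (s * X x + 1 * V x))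
        + (\<i>/2) * (CLINT x|M. I x *\<^sub>R iexp (s * X x + (-1) * V x))" (is ?S)
    if I: "integrable M I" and [measurable]: "X \<in> borel_measurable M" "V \<in> borel_measurable M"
    for M :: "'d measure" and I X V :: "'d \<Rightarrow> real" and s
  proof -
    have [measurable]: "I \<in> borel_measurable M" using I by auto
    have int: "integrable M (\<lambda>x. I x *\<^sub>R iexp (s * X x + c * V x))" for c
      by (rule Bochner_Integration.integrable_bound[OF I]) (auto simp: norm_mult simp flip: of_real_mult of_real_add)
    have cosV: "complex_of_real (cos v) = (iexp v + iexp (-v)) / 2" for v
      by (simp add: complex_eq_iff Re_exp Im_exp)
    have sinV: "complex_of_real (sin v) = - \<i> * (iexp v - iexp (-v)) / 2" for v
      by (simp add: complex_eq_iff Re_exp Im_exp)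
    have e: "iexp (s * X x + c * V x) = iexp (s * X x) * iexp (c * V x)" for x c
      by (simp add: algebra_simps flip: exp_add)
    have "(I x * (1 + cos (V x))) *\<^sub>R iexp (s * X x)
      = I x *\<^sub>R iexp (s * X x + 0 * V x) + (1/2) * (I x *\<^sub>R iexp (s * X x + 1 * V x))
        + (1/2) * (I x *\<^sub>R iexp (s * X x + (-1) * V x))" for x
      unfolding e by (simp add: scaleR_conv_of_real cosV field_simps)
    then show ?C
      by (simp only: Bochner_Integration.integral_add Bochner_Integration.integrable_add
        Bochner_Integration.integrable_mult_right Bochner_Integration.integral_mult_right_zero int)
    have "(I x * (1 + sin (V x))) *\<^sub>R iexp (s * X x)
      = I x *\<^sub>R iexp (s * X x + 0 * V x) - (\<i>/2) * (I x *\<^sub>R iexp (s * X x + 1 * V x))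
        + (\<i>/2) * (I x *\<^sub>R iexp (s * X x + (-1) * V x))" for x
      unfolding e by (simp add: scaleR_conv_of_real sinV field_simps)
    then show ?S
      by (simp only: Bochner_Integration.integral_add Bochner_Integration.integrable_add
        Bochner_Integration.integral_diff Bochner_Integration.integrable_diff
        Bochner_Integration.integrable_mult_right Bochner_Integration.integral_mult_right_zero int)
  qed
  have int_w: "integrable M (\<lambda>x. I x * (1 + f (V x)))" "0 \<le> I x * (1 + f (V x))"
    if I: "integrable M I" and I0: "\<And>x. 0 \<le> I x" and [measurable]: "V \<in> borel_measurable M" and f: "f = cos \<or> f = sin"
    for M :: "'d measure" and I V :: "'d \<Rightarrow> real" and f :: "real \<Rightarrow> real" and x
  proof -
    have f1: "\<bar>f v\<bar> \<le> 1" for v using f by auto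
    have [measurable]: "I \<in> borel_measurable M" using I by auto
    have [measurable]: "f \<in> borel_measurable borel" using f by auto
    show "integrable M (\<lambda>x. I x * (1 + f (V x)))"
    proof (rule Bochner_Integration.integrable_bound)
      show "integrable M (\<lambda>x. I x * 2)" using I by simp
      show "AE x in M. norm (I x * (1 + f (V x))) \<le> norm (I x * 2)"
        using f1 by (auto simp: abs_mult I0 abs_le_iff intro!: mult_left_mono AE_I2) (smt (verit) f1)+
    qed simp
    show "0 \<le> I x * (1 + f (V x))" using f1[of "V x"] I0[of x] by (simp add: abs_le_iff)
  qed
  have *: "(CLINT x|M1. (I1 x * (1 + f (V1 x))) *\<^sub>R g (X1 x)) = (CLINT x|M2. (I2 x * (1 + f (V2 x))) *\<^sub>R g (X2 x))"
    if f: "f = cos \<or> f = sin" for f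
  proof (rule integral_eq_of_char_eq)
    show "(CLINT x|M1. (I1 x * (1 + f (V1 x))) *\<^sub>R iexp (s * X1 x))
        = (CLINT x|M2. (I2 x * (1 + f (V2 x))) *\<^sub>R iexp (s * X2 x))" for s
      using f eq[of 0 s] eq[of 1 s] eq[of "-1" s]
      by (elim disjE) (simp_all only: cos_split[OF I1(1) X1 V1] cos_split[OF I2(1) X2 V2]
        sin_split[OF I1(1) X1 V1] sin_split[OF I2(1) X2 V2] insert_iff simp_thms)
  qed (use f in \<open>simp_all add: int_w(1) int_w(2)[OF I1 V1] int_w(2)[OF I2 V2] I1 I2\<close>)
  have **: "(CLINT x|M1. I1 x *\<^sub>R g (X1 x)) = (CLINT x|M2. I2 x *\<^sub>R g (X2 x))"
    by (rule integral_eq_of_char_eq[OF I1 X1 I2 X2 _ g]) (use eq[of 0] in simp)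
  have split: "(CLINT x|M. I x *\<^sub>R (iexp (V x) * g (X x)))
      = (CLINT x|M. (I x * (1 + cos (V x))) *\<^sub>R g (X x)) + \<i> * (CLINT x|M. (I x * (1 + sin (V x))) *\<^sub>R g (X x))
        - (1 + \<i>) * (CLINT x|M. I x *\<^sub>R g (X x))"
    if I: "integrable M I" and [measurable]: "X \<in> borel_measurable M" "V \<in> borel_measurable M"
      and gI: "integrable M (\<lambda>x. I x *\<^sub>R g (X x))"
    for M :: "'d measure" and I X V :: "'d \<Rightarrow> real"
  proof -
    have [measurable]: "I \<in> borel_measurable M" using I by auto
    have int: "integrable M (\<lambda>x. (I x * (1 + f (V x))) *\<^sub>R g (X x))" if f: "f = cos \<or> f = sin" for f
    proof (rule Bochner_Integration.integrable_bound)
      show "integrable M (\<lambda>x. 2 *\<^sub>R (I x *\<^sub>R g (X x)))"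
        using gI by (rule integrable_scaleR_right)
      have [measurable]: "f \<in> borel_measurable borel" using f by auto
      show "(\<lambda>x. (I x * (1 + f (V x))) *\<^sub>R g (X x)) \<in> borel_measurable M" by simp
      have "\<bar>1 + f v\<bar> \<le> 2" for v using f abs_cos_le_one[of v] abs_sin_le_one[of v] by (auto simp del: abs_cos_le_one abs_sin_le_one)
      then have "\<bar>1 + f (V x)\<bar> * (\<bar>I x\<bar> * norm (g (X x))) \<le> 2 * (\<bar>I x\<bar> * norm (g (X x)))" for x
        by (intro mult_right_mono) auto
      then show "AE x in M. norm ((I x * (1 + f (V x))) *\<^sub>R g (X x)) \<le> norm (2 *\<^sub>R (I x *\<^sub>R g (X x)))"
        by (auto simp: abs_mult mult_ac intro!: AE_I2)
    qed
    \<comment> \<open>Recombination of the two nonnegative weights into the oscillating factor; the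
      constants added for positivity are removed by the unweighted identity.\<close>
    have "iexp v = complex_of_real (1 + cos v) + \<i> * complex_of_real (1 + sin v) - (1 + \<i>)" for v :: real
      by (simp add: complex_eq_iff Re_exp Im_exp)
    then have "I x *\<^sub>R (iexp (V x) * g (X x)) = (I x * (1 + cos (V x))) *\<^sub>R g (X x)
        + \<i> * ((I x * (1 + sin (V x))) *\<^sub>R g (X x)) - (1 + \<i>) * (I x *\<^sub>R g (X x))" for x
      by (simp only: scaleR_conv_of_real of_real_mult) (simp add: algebra_simps)
    then show ?thesis
      by (simp only: Bochner_Integration.integral_add Bochner_Integration.integrable_add
        Bochner_Integration.integral_diff Bochner_Integration.integrable_diff
        Bochner_Integration.integrable_mult_right Bochner_Integration.integral_mult_right_zero int gI simp_thms)
  qed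
  show ?thesis
    unfolding split[OF I1(1) X1 V1 g1] split[OF I2(1) X2 V2 g2] using *[of cos] *[of sin] ** by simp
qed

text \<open>Induction on \<open>k\<close> replaces the exponential factors of the first
  \<open>k\<close> coordinates by indicators, with the coordinate \<open>y k\<close> as the real
  variable and the remaining exponent as \<open>V\<close>. At \<open>k = m\<close> with zero
  frequencies only the measure of a cylinder is left, and cylinders determine the measure.\<close>

lemma seq_space_measure_eqI:
  assumes fin: "finite_measure M1" "finite_measure M2"
    and sets1: "sets M1 = sets seq_space" and sets2: "sets M2 = sets seq_space"
    and eq: "\<And>t m. (CLINT y|M1. iexp (\<Sum>j<m. t j * y j)) = (CLINT y|M2. iexp (\<Sum>j<m. t j * y j))"
  shows "M1 = M2"
proof -
  interpret M1: finite_measure M1 by fact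
  interpret M2: finite_measure M2 by fact
  have [measurable_cong]: "sets M1 = sets seq_space" "sets M2 = sets seq_space" by fact+
  have space: "space M1 = UNIV" "space M2 = UNIV"
    using sets_eq_imp_space_eq[OF sets1] sets_eq_imp_space_eq[OF sets2] by (auto simp: space_PiM)
  show ?thesis
  proof (rule measure_eqI_PiM_infinite[OF sets1 sets2])
    fix A and J :: "nat set" assume J: "finite J" and A: "\<And>i. i \<in> J \<Longrightarrow> A i \<in> sets (borel :: real measure)"
    obtain m where m: "J \<subseteq> {..<m}" using finite_nat_iff_bounded J by blast
    \<comment> \<open>Padding with \<open>UNIV\<close> turns a cylinder over an arbitrary finite
      \<open>J\<close> into one over an initial segment, along which the induction runs.\<close>
    define A' where "A' j = (if j \<in> J then A j else UNIV)" for j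
    have [measurable]: "A' j \<in> sets borel" for j using A by (simp add: A'_def)
    define I where "I k y = (\<Prod>j<k. indicator (A' j) (y j) :: real)" for k and y :: "nat \<Rightarrow> real"
    have I_meas: "I k \<in> borel_measurable seq_space" for k unfolding I_def by measurable
    have [measurable]: "I k \<in> borel_measurable M1" "I k \<in> borel_measurable M2" for k
      using I_meas by measurable
    have I0: "0 \<le> I k y" and I1: "I k y \<le> 1" for k y
      by (auto simp: I_def intro!: prod_nonneg prod_le_1)
    have I_int: "integrable M1 (I k)" "integrable M2 (I k)" for k
      by (intro M1.integrable_const_bound[of _ 1] M2.integrable_const_bound[of _ 1] AE_I2; simp add: I0 I1)+
    have claim: "(CLINT y|M1. I k y *\<^sub>R iexp (\<Sum>j\<in>{k..<m}. t j * y j))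
        = (CLINT y|M2. I k y *\<^sub>R iexp (\<Sum>j\<in>{k..<m}. t j * y j))" if "k \<le> m" for k t
      using that
    proof (induction k arbitrary: t)
      case 0
      show ?case using eq[of t m] by (simp add: I_def atLeast0LessThan)
    next
      case (Suc k)
      let ?V = "\<lambda>y. \<Sum>j\<in>{Suc k..<m}. t j * y j"
      let ?g = "\<lambda>v. indicator (A' k) v :: complex"
      \<comment> \<open>The induction hypothesis holds for all frequencies: scaling the later ones
        by \<open>c\<close> and inserting \<open>s\<close> at \<open>k\<close> gives the joint
        characteristic function of \<open>y k\<close> and \<open>?V\<close>.\<close>
      have sum: "(\<Sum>j\<in>{k..<m}. ((\<lambda>j. c * t j)(k := s)) j * y j) = s * y k + c * ?V y" for c s and y :: "nat \<Rightarrow> real"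
      proof -
        have "(\<Sum>j\<in>{Suc k..<m}. ((\<lambda>j. c * t j)(k := s)) j * y j) = c * ?V y"
          by (auto simp: sum_distrib_left mult.assoc intro!: sum.cong)
        then show ?thesis using Suc.prems by (simp add: sum.atLeast_Suc_lessThan)
      qed
      have bd: "norm (I k y *\<^sub>R ?g v) \<le> 1" for y v using I0[of k y] I1[of k y] by (auto simp: indicator_def)
      have "(CLINT y|M1. I k y *\<^sub>R (iexp (?V y) * ?g (y k))) = (CLINT y|M2. I k y *\<^sub>R (iexp (?V y) * ?g (y k)))"
      proof (rule integral_iexp_eq_of_char_eq[OF I_int(1) I0 _ _ I_int(2) I0])
        show "(CLINT x|M1. I k x *\<^sub>R iexp (s * x k + c * ?V x)) = (CLINT x|M2. I k x *\<^sub>R iexp (s * x k + c * ?V x))"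
          for s c
          using Suc.IH[of "(\<lambda>j. c * t j)(k := s)"] Suc.prems unfolding sum by simp
        show "integrable M1 (\<lambda>x. I k x *\<^sub>R ?g (x k))"
          by (rule M1.integrable_const_bound[of _ 1]) (use bd in auto)
        show "integrable M2 (\<lambda>x. I k x *\<^sub>R ?g (x k))"
          by (rule M2.integrable_const_bound[of _ 1]) (use bd in auto)
      qed measurable
      moreover have "I k y *\<^sub>R (iexp (?V y) * ?g (y k)) = I (Suc k) y *\<^sub>R iexp (?V y)" for y
        by (simp add: I_def scaleR_conv_of_real indicator_def)
      ultimately show ?case by simp
    qed
    let ?X = "prod_emb UNIV (\<lambda>_. borel) J (Pi\<^sub>E J A)"
    have X: "?X \<in> sets seq_space" using J A by (intro sets_PiM_I) auto
    have "I m y = indicator ?X y" for y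
    proof -
      have "y \<in> ?X \<longleftrightarrow> (\<forall>j<m. y j \<in> A' j)"
        using m by (auto simp: prod_emb_iff A'_def PiE_iff)
      then show ?thesis by (auto simp: I_def indicator_def intro!: prod.neutral)
    qed
    then have "complex_of_real (measure M1 ?X) = complex_of_real (measure M2 ?X)"
      using claim[of m "\<lambda>_. 0"] X sets1 sets2 space by (simp add: scaleR_conv_of_real)
    then show "emeasure M1 ?X = emeasure M2 ?X"
      by (simp add: M1.emeasure_eq_measure M2.emeasure_eq_measure)
  qed (fact fin)
qed


section \<open>Isonormal Gaussian processes\<close>

lemma integral_pair_mult:
  fixes f :: "'d \<Rightarrow> complex" and g :: "'e \<Rightarrow> complex"
  assumes "sigma_finite_measure M1" "sigma_finite_measure M2" and f: "integrable M1 f" and g: "integrable M2 g"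
  shows "integrable (M1 \<Otimes>\<^sub>M M2) (\<lambda>z. f (fst z) * g (snd z))"
    and "(CLINT z|M1 \<Otimes>\<^sub>M M2. f (fst z) * g (snd z)) = (CLINT x|M1. f x) * (CLINT y|M2. g y)"
proof -
  interpret M1: sigma_finite_measure M1 by fact
  interpret M2: sigma_finite_measure M2 by fact
  interpret pair_sigma_finite M1 M2 ..
  have [measurable]: "f \<in> borel_measurable M1" "g \<in> borel_measurable M2" using f g by auto
  show int: "integrable (M1 \<Otimes>\<^sub>M M2) (\<lambda>z. f (fst z) * g (snd z))"
  proof (rule Fubini_integrable)
    show "integrable M1 (\<lambda>x. \<integral>y. norm (f (fst (x, y)) * g (snd (x, y))) \<partial>M2)"
      using f by (simp add: norm_mult)
    show "AE x in M1. integrable M2 (\<lambda>y. f (fst (x, y)) * g (snd (x, y)))"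
      using g by simp
  qed measurable
  show "(CLINT z|M1 \<Otimes>\<^sub>M M2. f (fst z) * g (snd z)) = (CLINT x|M1. f x) * (CLINT y|M2. g y)"
    using integral_fst'[OF int] by simp
qed

text \<open>Completing the square: this is the one-dimensional Cameron--Martin formula.\<close>

lemma std_normal_density_tilt:
  "exp (c * x) * std_normal_density x = exp (c\<^sup>2 / 2) * std_normal_density (x - c)"
  by (simp add: std_normal_density_def power2_diff field_simps flip: exp_add)

lemma nn_integral_std_normal_exp:
  "(\<integral>\<^sup>+x. ennreal (exp (c * x)) \<partial>std_normal_distribution) = ennreal (exp (c\<^sup>2 / 2))"
proof -
  have "(\<integral>\<^sup>+x. ennreal (exp (c * x)) \<partial>std_normal_distribution)
      = (\<integral>\<^sup>+x. ennreal (exp (c * x) * std_normal_density x) \<partial>lborel)"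
    by (subst nn_integral_density) (simp_all add: mult.commute flip: ennreal_mult)
  also have "\<dots> = (\<integral>\<^sup>+x. ennreal (exp (c\<^sup>2 / 2) * normal_density c 1 x) \<partial>lborel)"
    unfolding std_normal_density_tilt by (simp add: normal_density_def)
  also have "\<dots> = ennreal (exp (c\<^sup>2 / 2) * 1)"
    by (subst nn_integral_eq_integral) simp_all
  finally show ?thesis by simp
qed

text \<open>The exponents - x^2 / 2 and x^2 / 4 add up to that of a normal density with variance 2;
  \<open>sqrt 2\<close> is the ratio of the normalising constants.\<close>

lemma nn_integral_std_normal_exp_square:
  "(\<integral>\<^sup>+x. ennreal (exp (x\<^sup>2 / 4)) \<partial>std_normal_distribution) = ennreal (sqrt 2)"
proof -
  have *: "std_normal_density x * exp (x\<^sup>2 / 4) = sqrt 2 * normal_density 0 (sqrt 2) x" for x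
    by (simp add: std_normal_density_def normal_density_def real_sqrt_mult field_simps flip: exp_add)
  have "(\<integral>\<^sup>+x. ennreal (exp (x\<^sup>2 / 4)) \<partial>std_normal_distribution)
      = (\<integral>\<^sup>+x. ennreal (sqrt 2 * normal_density 0 (sqrt 2) x) \<partial>lborel)"
    by (subst nn_integral_density) (simp_all flip: ennreal_mult * )
  also have "\<dots> = ennreal (sqrt 2 * 1)"
    by (subst nn_integral_eq_integral) simp_all
  finally show ?thesis by simp
qed

text \<open>Tilting turns the exponential weight into a translation by \<open>c\<close>, after which
  only the standard normal characteristic function remains.\<close>

lemma integral_std_normal_iexp_exp:
  "(CLINT x|std_normal_distribution. iexp (d * x) * complex_of_real (exp (c * x))) = complex_of_real (exp (c\<^sup>2 / 2)) * iexp (c * d) * complex_of_real (exp (- (d\<^sup>2) / 2))"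
proof -
  have "(CLINT x|std_normal_distribution. iexp (d * x) * complex_of_real (exp (c * x)))
      = (CLINT x|lborel. std_normal_density x *\<^sub>R (iexp (d * x) * complex_of_real (exp (c * x))))"
    by (subst integral_density) simp_all
  also have "\<dots> = (CLINT x|lborel. complex_of_real (exp (c\<^sup>2 / 2)) * (std_normal_density (x - c) *\<^sub>R iexp (d * x)))"
  proof (rule Bochner_Integration.integral_cong)
    fix x :: real
    show "std_normal_density x *\<^sub>R (iexp (d * x) * complex_of_real (exp (c * x))) = complex_of_real (exp (c\<^sup>2 / 2)) * (std_normal_density (x - c) *\<^sub>R iexp (d * x))"
      using arg_cong[OF std_normal_density_tilt[of c x], of complex_of_real]
      by (simp add: scaleR_conv_of_real mult_ac del: of_real_exp)
  qed simp
  also have "\<dots> = complex_of_real (exp (c\<^sup>2 / 2)) * (CLINT x|lborel. std_normal_density (x - c) *\<^sub>R iexp (d * x))"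
    by (rule Bochner_Integration.integral_mult_right_zero)
  also have "(CLINT x|lborel. std_normal_density (x - c) *\<^sub>R iexp (d * x))
      = (CLINT x|lborel. iexp (c * d) * (std_normal_density x *\<^sub>R iexp (d * x)))"
    by (subst lborel_integral_real_affine[where t=c and c=1])
       (auto simp: scaleR_conv_of_real algebra_simps exp_add intro!: Bochner_Integration.integral_cong)
  also have "\<dots> = iexp (c * d) * (CLINT x|lborel. std_normal_density x *\<^sub>R iexp (d * x))"
    by (rule Bochner_Integration.integral_mult_right_zero)
  also have "(CLINT x|lborel. std_normal_density x *\<^sub>R iexp (d * x)) = char std_normal_distribution d"
    unfolding char_def by (subst integral_density) simp_all
  finally show ?thesis by (simp add: char_std_normal_distribution mult_ac)
qed

text \<open>A Gaussian process indexed by a Hilbert space whose covariance is \<open>\<tau>\<close> times the inner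
  product. Each linearity relation holds almost surely only.\<close>

locale isonormal = prob_space Q for Q :: "'y measure" +
  fixes W :: "'h::real_inner \<Rightarrow> 'y \<Rightarrow> real" and \<tau> :: real
  assumes tau: "\<tau> > 0"
    and W_meas[measurable]: "\<And>a. W a \<in> borel_measurable Q"
    and W_lin: "\<And>s a t b. AE y in Q. W (s *\<^sub>R a + t *\<^sub>R b) y = s * W a y + t * W b y"
    and W_iexp: "\<And>a. (CLINT y|Q. iexp (W a y)) = complex_of_real (exp (- \<tau> * (norm a)\<^sup>2 / 2))"
begin

lemma W_scale: "AE y in Q. W (s *\<^sub>R a) y = s * W a y"
  using W_lin[of s a 0 a] by simp

lemma W_sum: "AE y in Q. W (\<Sum>j<k. c j *\<^sub>R x j) y = (\<Sum>j<(k::nat). c j * W (x j) y)"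
proof (induction k)
  case 0
  show ?case using W_scale[of 0 0] by simp
next
  case (Suc k)
  show ?case
    using Suc W_lin[of 1 "\<Sum>j<k. c j *\<^sub>R x j" "c k" "x k"] by eventually_elim simp
qed

text \<open>\<open>W_iexp\<close> gives the characteristic function at frequency 1 only;
  homogeneity, applied to \<open>t *\<^sub>R a\<close>, supplies all frequencies.\<close>

lemma distr_W: "distr Q borel (W a) = distr std_normal_distribution borel (\<lambda>x. sqrt \<tau> * norm a * x)"
proof (rule Levy_uniqueness)
  interpret std: real_distribution std_normal_distribution by (rule real_dist_normal_dist)
  show "real_distribution (distr Q borel (W a))"
    by (rule real_distribution_distr) simp
  show "real_distribution (distr std_normal_distribution borel (\<lambda>x. sqrt \<tau> * norm a * x))"
    by (rule std.real_distribution_distr) simp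
  show "char (distr Q borel (W a)) = char (distr std_normal_distribution borel (\<lambda>x. sqrt \<tau> * norm a * x))"
  proof
    fix t
    have "char (distr Q borel (W a)) t = (CLINT y|Q. iexp (t * W a y))"
      unfolding char_def by (subst integral_distr) simp_all
    also have "\<dots> = (CLINT y|Q. iexp (W (t *\<^sub>R a) y))"
      using W_scale[of t a] by (intro integral_cong_AE) auto
    also have "\<dots> = char std_normal_distribution (t * (sqrt \<tau> * norm a))"
      using tau by (simp add: W_iexp char_std_normal_distribution power_mult_distrib mult_ac)
    also have "\<dots> = char (distr std_normal_distribution borel (\<lambda>x. sqrt \<tau> * norm a * x)) t"
      unfolding char_def by (subst integral_distr) (simp_all add: mult_ac)
    finally show "char (distr Q borel (W a)) t = char (distr std_normal_distribution borel (\<lambda>x. sqrt \<tau> * norm a * x)) t" .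
  qed
qed

lemma nn_integral_exp_W: "(\<integral>\<^sup>+y. ennreal (exp (W a y)) \<partial>Q) = ennreal (exp (\<tau> * (norm a)\<^sup>2 / 2))"
proof -
  have "(\<integral>\<^sup>+y. ennreal (exp (W a y)) \<partial>Q) = (\<integral>\<^sup>+v. ennreal (exp v) \<partial>distr Q borel (W a))"
    by (subst nn_integral_distr) simp_all
  also have "\<dots> = (\<integral>\<^sup>+x. ennreal (exp (sqrt \<tau> * norm a * x)) \<partial>std_normal_distribution)"
    unfolding distr_W by (subst nn_integral_distr) simp_all
  also have "\<dots> = ennreal (exp (\<tau> * (norm a)\<^sup>2 / 2))"
    using tau by (simp only: nn_integral_std_normal_exp) (simp add: power_mult_distrib)
  finally show ?thesis .
qed

lemma integrable_exp_W: "integrable Q (\<lambda>y. exp (W a y))"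
  by (rule integrableI_nonneg) (simp_all add: nn_integral_exp_W)

text \<open>The density of a mean shift: under the measure with density \<open>tilt h\<close> the
  process keeps its covariance, and \<open>W a\<close> acquires the mean
  \<open>\<tau> * inner h a\<close>.\<close>

definition tilt :: "'h \<Rightarrow> 'y \<Rightarrow> real" where
  "tilt h y = exp (W h y - \<tau> * (norm h)\<^sup>2 / 2)"

lemma tilt_meas[measurable]: "tilt h \<in> borel_measurable Q"
  unfolding tilt_def by measurable

lemma tilt_pos: "0 < tilt h y"
  by (simp add: tilt_def)

text \<open>The exponents merge into \<open>W (h + a)\<close>, whose Laplace transform is known; the
  cross term of |h + a|^2 cancels the centring.\<close>

lemma nn_integral_tilt_exp:
  "(\<integral>\<^sup>+y. ennreal (tilt h y * exp (W a y - \<tau> * inner h a)) \<partial>Q) = ennreal (exp (\<tau> * (norm a)\<^sup>2 / 2))"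
proof -
  let ?c = "exp (- \<tau> * (norm h)\<^sup>2 / 2 - \<tau> * inner h a)"
  have "(\<integral>\<^sup>+y. ennreal (tilt h y * exp (W a y - \<tau> * inner h a)) \<partial>Q)
      = (\<integral>\<^sup>+y. ennreal ?c * ennreal (exp (W (h + a) y)) \<partial>Q)"
    using W_lin[of 1 h 1 a]
    by (intro nn_integral_cong_AE, elim AE_mp)
       (auto simp: tilt_def simp flip: exp_add ennreal_mult intro!: AE_I2)
  also have "\<dots> = ennreal ?c * ennreal (exp (\<tau> * (norm (h + a))\<^sup>2 / 2))"
    by (simp add: nn_integral_cmult nn_integral_exp_W)
  also have "\<dots> = ennreal (exp (\<tau> * (norm a)\<^sup>2 / 2))"
    by (simp add: power2_norm_eq_inner inner_add inner_commute algebra_simps add_divide_distrib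
        flip: exp_add ennreal_mult)
  finally show ?thesis .
qed

lemma nn_integral_tilt: "(\<integral>\<^sup>+y. ennreal (tilt h y) \<partial>Q) = 1"
proof -
  have "(\<integral>\<^sup>+y. ennreal (tilt h y) \<partial>Q) = (\<integral>\<^sup>+y. ennreal (tilt h y * exp (W 0 y - \<tau> * inner h 0)) \<partial>Q)"
    using W_scale[of 0 0] by (intro nn_integral_cong_AE) auto
  then show ?thesis unfolding nn_integral_tilt_exp by simp
qed

text \<open>Up to a constant the integrand is the exponential of \<open>W\<close> at 2 h - h', and
  |2 h - h'|^2 / 2 - |h|^2 + |h'|^2 / 2 = |h - h'|^2.\<close>

lemma nn_integral_tilt_ratio:
  "(\<integral>\<^sup>+y. ennreal (tilt h y * (tilt h y / tilt h' y)) \<partial>Q) = ennreal (exp (\<tau> * (norm (h - h'))\<^sup>2))"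
proof -
  let ?c = "exp (- \<tau> * (norm h)\<^sup>2 + \<tau> * (norm h')\<^sup>2 / 2)"
  have "(\<integral>\<^sup>+y. ennreal (tilt h y * (tilt h y / tilt h' y)) \<partial>Q)
      = (\<integral>\<^sup>+y. ennreal ?c * ennreal (exp (W (2 *\<^sub>R h + (-1) *\<^sub>R h') y)) \<partial>Q)"
    using W_lin[of 2 h "-1" h']
    by (intro nn_integral_cong_AE, elim AE_mp)
       (auto simp: tilt_def algebra_simps simp flip: exp_add exp_diff ennreal_mult intro!: AE_I2)
  also have "\<dots> = ennreal ?c * ennreal (exp (\<tau> * (norm (2 *\<^sub>R h + (-1) *\<^sub>R h'))\<^sup>2 / 2))"
    by (subst nn_integral_cmult) (measurable, simp only: nn_integral_exp_W)
  also have "\<dots> = ennreal (exp (\<tau> * (norm (h - h'))\<^sup>2))"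
    by (simp add: power2_norm_eq_inner inner_diff inner_commute algebra_simps add_divide_distrib
        diff_divide_distrib flip: exp_add ennreal_mult)
  finally show ?thesis .
qed

text \<open>Splitting \<open>a\<close> along \<open>h\<close> and its orthogonal complement reduces this to the independence of
  \<open>W h\<close> and \<open>W a\<close> for orthogonal \<open>h\<close> and \<open>a\<close>.\<close>

lemma integral_tilt_iexp:
  "(CLINT y|Q. tilt h y *\<^sub>R iexp (W a y)) = iexp (\<tau> * inner h a) * complex_of_real (exp (- \<tau> * (norm a)\<^sup>2 / 2))"
proof -
  define c where "c = inner a h / (norm h)\<^sup>2"
  define a' where "a' = a - c *\<^sub>R h"
  define \<sigma> where "\<sigma> = sqrt \<tau> * norm h"
  \<comment> \<open>For \<open>h = 0\<close> division by zero gives \<open>c = 0\<close> and both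
    sides vanish, so no case distinction is made below.\<close>
  have ch: "c * (norm h)\<^sup>2 = inner a h" by (simp add: c_def)
  have orth: "inner a' h = 0" "inner h a' = 0"
  proof -
    show "inner a' h = 0" using ch by (simp add: a'_def inner_diff_left power2_norm_eq_inner)
    then show "inner h a' = 0" by (simp only: inner_commute)
  qed
  have a: "a = a' + c *\<^sub>R h" by (simp add: a'_def)
  have norm_a: "(norm a)\<^sup>2 = (norm a')\<^sup>2 + c\<^sup>2 * (norm h)\<^sup>2"
    unfolding a power2_norm_eq_inner by (simp add: inner_add orth power2_eq_square)
  interpret QQ: pair_prob_space Q Q ..
  have int_iexp: "integrable Q (\<lambda>y. iexp (s * W b y))" for s b
    by (rule integrable_const_bound[of _ 1]) auto
  let ?g = "\<lambda>v. iexp (c * v) * complex_of_real (exp v)"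
  have int_g: "integrable Q (\<lambda>y. ?g (W h y))"
    by (rule Bochner_Integration.integrable_bound[OF integrable_exp_W[of h]])
       (auto simp: norm_mult)
  \<comment> \<open>Orthogonality factorises the joint characteristic function, so the pair behaves
    on \<open>Q\<close> like its two components taken from independent copies. \<open>?g\<close> is
    unbounded, but integrable under both measures.\<close>
  have "(CLINT y|Q. 1 *\<^sub>R (iexp (W a' y) * ?g (W h y)))
      = (CLINT z|Q \<Otimes>\<^sub>M Q. 1 *\<^sub>R (iexp (W a' (fst z)) * ?g (W h (snd z))))"
  proof (rule integral_iexp_eq_of_char_eq)
    fix s d :: real
    have "(CLINT y|Q. 1 *\<^sub>R iexp (s * W h y + d * W a' y)) = (CLINT y|Q. iexp (W (s *\<^sub>R h + d *\<^sub>R a') y))"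
      using W_lin[of s h d a'] by (intro integral_cong_AE) auto
    also have "\<dots> = complex_of_real (exp (- \<tau> * (norm (s *\<^sub>R h + d *\<^sub>R a'))\<^sup>2 / 2))" by (rule W_iexp)
    also have "(norm (s *\<^sub>R h + d *\<^sub>R a'))\<^sup>2 = (norm (s *\<^sub>R h))\<^sup>2 + (norm (d *\<^sub>R a'))\<^sup>2"
      unfolding power2_norm_eq_inner by (simp add: inner_add orth)
    also have "exp (- \<tau> * ((norm (s *\<^sub>R h))\<^sup>2 + (norm (d *\<^sub>R a'))\<^sup>2) / 2)
        = exp (- \<tau> * (norm (d *\<^sub>R a'))\<^sup>2 / 2) * exp (- \<tau> * (norm (s *\<^sub>R h))\<^sup>2 / 2)"
      by (simp add: algebra_simps add_divide_distrib diff_divide_distrib flip: exp_add)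
    also have "complex_of_real \<dots> = (CLINT y|Q. iexp (d * W a' y)) * (CLINT y|Q. iexp (s * W h y))"
    proof -
      have "(CLINT y|Q. iexp (s * W b y)) = (CLINT y|Q. iexp (W (s *\<^sub>R b) y))" for s b
        using W_scale[of s b] by (intro integral_cong_AE) auto
      then show ?thesis by (simp only: W_iexp of_real_mult)
    qed
    also have "\<dots> = (CLINT z|Q \<Otimes>\<^sub>M Q. iexp (d * W a' (fst z)) * iexp (s * W h (snd z)))"
      by (rule integral_pair_mult(2)[symmetric]) (unfold_locales, unfold_locales, rule int_iexp, rule int_iexp)
    finally show "(CLINT y|Q. 1 *\<^sub>R iexp (s * W h y + d * W a' y))
        = (CLINT z|Q \<Otimes>\<^sub>M Q. 1 *\<^sub>R iexp (s * W h (snd z) + d * W a' (fst z)))"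
      by (simp add: exp_add algebra_simps)
  next
    have "integrable (Q \<Otimes>\<^sub>M Q) (\<lambda>z. 1 * ?g (W h (snd z)))"
      by (rule integral_pair_mult(1)[of _ _ "\<lambda>_. 1"]) (unfold_locales, unfold_locales, simp, rule int_g)
    then show "integrable (Q \<Otimes>\<^sub>M Q) (\<lambda>z. 1 *\<^sub>R ?g (W h (snd z)))" by simp
  qed (use int_g in simp_all)
  also have "\<dots> = (CLINT y|Q. iexp (1 * W a' y)) * (CLINT y|Q. ?g (W h y))"
    by (subst integral_pair_mult(2)[symmetric]) (unfold_locales, unfold_locales, rule int_iexp, rule int_g, simp)
  also have "(CLINT y|Q. ?g (W h y)) = (CLINT v|distr Q borel (W h). ?g v)"
    by (subst integral_distr) simp_all
  also have "\<dots> = (CLINT x|std_normal_distribution. iexp ((c * \<sigma>) * x) * complex_of_real (exp (\<sigma> * x)))"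
    unfolding distr_W by (subst integral_distr) (simp_all add: \<sigma>_def mult_ac)
  also have "\<dots> = complex_of_real (exp (\<sigma>\<^sup>2 / 2)) * iexp (\<sigma> * (c * \<sigma>)) * complex_of_real (exp (- ((c * \<sigma>)\<^sup>2) / 2))"
    by (rule integral_std_normal_iexp_exp)
  also have "(CLINT y|Q. iexp (1 * W a' y)) = complex_of_real (exp (- \<tau> * (norm a')\<^sup>2 / 2))"
    using W_iexp[of a'] by simp
  finally have main: "(CLINT y|Q. iexp (W a' y) * ?g (W h y)) = complex_of_real (exp (- \<tau> * (norm a')\<^sup>2 / 2))
      * (complex_of_real (exp (\<sigma>\<^sup>2 / 2)) * iexp (\<sigma> * (c * \<sigma>)) * complex_of_real (exp (- ((c * \<sigma>)\<^sup>2) / 2)))" by simp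
  let ?C = "complex_of_real (exp (- \<tau> * (norm h)\<^sup>2 / 2))"
  have "(CLINT y|Q. tilt h y *\<^sub>R iexp (W a y)) = (CLINT y|Q. ?C * (iexp (W a' y) * ?g (W h y)))"
  proof (rule integral_cong_AE)
    show "AE y in Q. tilt h y *\<^sub>R iexp (W a y) = ?C * (iexp (W a' y) * ?g (W h y))"
      using W_lin[of 1 a' c h]
    proof eventually_elim
      fix y assume "W (1 *\<^sub>R a' + c *\<^sub>R h) y = 1 * W a' y + c * W h y"
      then have "W a y = W a' y + c * W h y" using a by simp
      then have "iexp (W a y) = iexp (W a' y) * iexp (c * W h y)" by (simp add: distrib_left exp_add)
      moreover have "tilt h y = exp (- \<tau> * (norm h)\<^sup>2 / 2) * exp (W h y)" by (simp add: tilt_def flip: exp_add)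
      ultimately show "tilt h y *\<^sub>R iexp (W a y) = ?C * (iexp (W a' y) * ?g (W h y))"
        by (simp only: scaleR_conv_of_real of_real_mult mult_ac)
    qed
  qed simp_all
  also have "\<dots> = ?C * (complex_of_real (exp (- \<tau> * (norm a')\<^sup>2 / 2))
      * (complex_of_real (exp (\<sigma>\<^sup>2 / 2)) * iexp (\<sigma> * (c * \<sigma>)) * complex_of_real (exp (- ((c * \<sigma>)\<^sup>2) / 2))))"
    by (simp only: Bochner_Integration.integral_mult_right_zero main)
  also have "\<dots> = iexp (\<sigma> * (c * \<sigma>)) * complex_of_real (exp (- \<tau> * (norm h)\<^sup>2 / 2) * exp (- \<tau> * (norm a')\<^sup>2 / 2)
      * exp (\<sigma>\<^sup>2 / 2) * exp (- ((c * \<sigma>)\<^sup>2) / 2))"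
    by (simp add: mult_ac)
  also have "exp (- \<tau> * (norm h)\<^sup>2 / 2) * exp (- \<tau> * (norm a')\<^sup>2 / 2) * exp (\<sigma>\<^sup>2 / 2) * exp (- ((c * \<sigma>)\<^sup>2) / 2)
      = exp (- \<tau> * (norm a)\<^sup>2 / 2)"
    using tau by (simp add: norm_a \<sigma>_def power_mult_distrib field_simps flip: exp_add)
  also have "\<sigma> * (c * \<sigma>) = \<tau> * inner h a"
  proof -
    have "\<sigma> * (c * \<sigma>) = \<sigma>\<^sup>2 * c" by (simp add: power2_eq_square)
    also have "\<dots> = \<tau> * (c * (norm h)\<^sup>2)" using tau by (simp add: \<sigma>_def power_mult_distrib)
    finally show ?thesis by (simp only: ch inner_commute)
  qed
  finally show ?thesis .
qed

text \<open>Writing \<open>exp (s Z\<^sup>2 / 2)\<close> as an average of \<open>exp (sqrt s g Z)\<close> over a standard normal \<open>g\<close>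
  linearises the squares, so that only one-dimensional Laplace transforms of \<open>W\<close> occur.\<close>

lemma nn_integral_tilt_exp_squares:
  fixes x :: "nat \<Rightarrow> 'h" and \<gamma> :: real
  assumes \<gamma>: "\<gamma> > 0" and x: "\<And>c. (norm (\<Sum>j<k. c j *\<^sub>R x j))\<^sup>2 \<le> \<gamma> * (\<Sum>j<k. (c j)\<^sup>2)"
  shows "(\<integral>\<^sup>+y. ennreal (tilt h y * exp ((\<Sum>j<k. (W (x j) y - \<tau> * inner h (x j))\<^sup>2) / (4 * \<tau> * \<gamma>))) \<partial>Q)
    \<le> ennreal (sqrt 2 ^ k)"
proof -
  \<comment> \<open>With \<open>\<tau> * s * \<gamma> = 1 / 2\<close> the Laplace transform
    contributes exp (g^2 / 4) per coordinate, half of the exponent g^2 / 2 at which the Gaussian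
    integral diverges.\<close>
  define s where "s = 1 / (2 * \<tau> * \<gamma>)"
  have s: "s > 0" "\<tau> * s * \<gamma> = 1 / 2" using tau \<gamma> by (simp_all add: s_def)
  define Z where "Z j y = W (x j) y - \<tau> * inner h (x j)" for j y
  have [measurable]: "Z j \<in> borel_measurable Q" for j unfolding Z_def by measurable
  interpret std: real_distribution std_normal_distribution by (rule real_dist_normal_dist)
  interpret product_sigma_finite "\<lambda>_::nat. std_normal_distribution" ..
  let ?P = "Pi\<^sub>M {..<k} (\<lambda>_. std_normal_distribution)"
  interpret P: prob_space ?P by (rule prob_space_PiM) (rule std.prob_space_axioms)
  interpret QP: pair_sigma_finite Q ?P ..
  have [measurable]: "(\<lambda>g. g j) \<in> borel_measurable ?P" if "j \<in> {..<k}" for j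
    using measurable_component_singleton[OF that, of "\<lambda>_. std_normal_distribution"] by simp
  have HS: "ennreal (exp (s * (\<Sum>j<k. (Z j y)\<^sup>2) / 2)) = (\<integral>\<^sup>+g. ennreal (exp (\<Sum>j<k. sqrt s * g j * Z j y)) \<partial>?P)" for y
  proof -
    have "(\<integral>\<^sup>+g. ennreal (exp (\<Sum>j<k. sqrt s * g j * Z j y)) \<partial>?P)
        = (\<integral>\<^sup>+g. (\<Prod>j<k. ennreal (exp ((sqrt s * Z j y) * g j))) \<partial>?P)"
      by (simp add: exp_sum prod_ennreal mult_ac)
    also have "\<dots> = (\<Prod>j<k. \<integral>\<^sup>+v. ennreal (exp ((sqrt s * Z j y) * v)) \<partial>std_normal_distribution)"
      by (rule product_nn_integral_prod) auto
    also have "\<dots> = ennreal (exp (s * (\<Sum>j<k. (Z j y)\<^sup>2) / 2))"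
      unfolding nn_integral_std_normal_exp using s
      by (simp add: prod_ennreal power_mult_distrib sum_distrib_left sum_divide_distrib flip: exp_sum)
    finally show ?thesis by simp
  qed
  have inner_bound: "(\<integral>\<^sup>+y. ennreal (tilt h y * exp (\<Sum>j<k. sqrt s * g j * Z j y)) \<partial>Q)
      \<le> (\<Prod>j<k. ennreal (exp ((g j)\<^sup>2 / 4)))" for g
  proof -
    let ?a = "\<Sum>j<k. (sqrt s * g j) *\<^sub>R x j"
    have "(\<integral>\<^sup>+y. ennreal (tilt h y * exp (\<Sum>j<k. sqrt s * g j * Z j y)) \<partial>Q)
        = (\<integral>\<^sup>+y. ennreal (tilt h y * exp (W ?a y - \<tau> * inner h ?a)) \<partial>Q)"
      using W_sum[where c="\<lambda>j. sqrt s * g j" and x=x and k=k]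
      by (intro nn_integral_cong_AE, elim AE_mp)
         (auto simp: Z_def inner_sum_right sum_distrib_left sum_subtractf algebra_simps intro!: AE_I2)
    also have "\<dots> = ennreal (exp (\<tau> * (norm ?a)\<^sup>2 / 2))" by (rule nn_integral_tilt_exp)
    also have "\<dots> \<le> ennreal (exp (\<tau> * (\<gamma> * (\<Sum>j<k. (sqrt s * g j)\<^sup>2)) / 2))"
      using tau by (intro ennreal_leI) (simp add: x)
    also have "\<tau> * (\<gamma> * (\<Sum>j<k. (sqrt s * g j)\<^sup>2)) / 2 = (\<tau> * s * \<gamma>) * (\<Sum>j<k. (g j)\<^sup>2) / 2"
      using s by (simp add: power_mult_distrib sum_distrib_left mult_ac)
    also have "\<dots> = (\<Sum>j<k. (g j)\<^sup>2 / 4)" unfolding s by (simp add: sum_divide_distrib)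
    finally show ?thesis by (simp add: exp_sum prod_ennreal)
  qed
  have "(\<integral>\<^sup>+y. ennreal (tilt h y * exp (s * (\<Sum>j<k. (Z j y)\<^sup>2) / 2)) \<partial>Q)
      = (\<integral>\<^sup>+y. (\<integral>\<^sup>+g. ennreal (tilt h y * exp (\<Sum>j<k. sqrt s * g j * Z j y)) \<partial>?P) \<partial>Q)"
    using tilt_pos[of h, THEN less_imp_le] by (simp add: ennreal_mult HS nn_integral_cmult)
  also have "\<dots> = (\<integral>\<^sup>+g. (\<integral>\<^sup>+y. ennreal (tilt h y * exp (\<Sum>j<k. sqrt s * g j * Z j y)) \<partial>Q) \<partial>?P)"
    by (rule QP.Fubini'[symmetric]) measurable
  also have "\<dots> \<le> (\<integral>\<^sup>+g. (\<Prod>j<k. ennreal (exp ((g j)\<^sup>2 / 4))) \<partial>?P)"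
    by (intro nn_integral_mono inner_bound)
  also have "\<dots> = (\<Prod>j<k. \<integral>\<^sup>+v. ennreal (exp (v\<^sup>2 / 4)) \<partial>std_normal_distribution)"
    by (rule product_nn_integral_prod) auto
  also have "\<dots> = ennreal (sqrt 2 ^ k)"
    unfolding nn_integral_std_normal_exp_square by (simp add: ennreal_power)
  finally show ?thesis by (simp add: s_def Z_def mult_ac)
qed

text \<open>Markov's inequality for the exponential moment of the sum of squares. The dimension
  \<open>k\<close> enters only through \<open>sqrt 2 ^ k\<close>.\<close>

lemma tilt_squares_tail:
  fixes x :: "nat \<Rightarrow> 'h" and \<gamma> :: real
  assumes \<gamma>: "\<gamma> > 0" and x: "\<And>c. (norm (\<Sum>j<k. c j *\<^sub>R x j))\<^sup>2 \<le> \<gamma> * (\<Sum>j<k. (c j)\<^sup>2)"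
  shows "(\<integral>\<^sup>+y. ennreal (tilt h y) * indicator {y. c \<le> (\<Sum>j<k. (W (x j) y - \<tau> * inner h (x j))\<^sup>2)} y \<partial>Q)
    \<le> ennreal (exp (- c / (4 * \<tau> * \<gamma>)) * sqrt 2 ^ k)"
proof -
  let ?S = "\<lambda>y. \<Sum>j<k. (W (x j) y - \<tau> * inner h (x j))\<^sup>2"
  have pos: "4 * \<tau> * \<gamma> > 0" using tau \<gamma> by simp
  have "(\<integral>\<^sup>+y. ennreal (tilt h y) * indicator {y. c \<le> ?S y} y \<partial>Q)
      \<le> (\<integral>\<^sup>+y. ennreal (exp (- c / (4 * \<tau> * \<gamma>))) * ennreal (tilt h y * exp (?S y / (4 * \<tau> * \<gamma>))) \<partial>Q)"
  proof (rule nn_integral_mono)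
    fix y
    have "tilt h y \<le> exp (- c / (4 * \<tau> * \<gamma>)) * (tilt h y * exp (?S y / (4 * \<tau> * \<gamma>)))" if "c \<le> ?S y"
    proof -
      have "c / (4 * \<tau> * \<gamma>) \<le> ?S y / (4 * \<tau> * \<gamma>)" using that pos by (intro divide_right_mono) auto
      then have "1 \<le> exp (- c / (4 * \<tau> * \<gamma>) + ?S y / (4 * \<tau> * \<gamma>))" by simp
      then have "tilt h y * 1 \<le> tilt h y * exp (- c / (4 * \<tau> * \<gamma>) + ?S y / (4 * \<tau> * \<gamma>))"
        using tilt_pos[of h y] by (intro mult_left_mono) auto
      then show ?thesis unfolding exp_add by (simp add: mult_ac)
    qed
    then show "ennreal (tilt h y) * indicator {y. c \<le> ?S y} y
        \<le> ennreal (exp (- c / (4 * \<tau> * \<gamma>))) * ennreal (tilt h y * exp (?S y / (4 * \<tau> * \<gamma>)))"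
      using tilt_pos[of h y] by (auto simp: indicator_def simp flip: ennreal_mult intro!: ennreal_leI)
  qed
  also have "\<dots> = ennreal (exp (- c / (4 * \<tau> * \<gamma>)))
      * (\<integral>\<^sup>+y. ennreal (tilt h y * exp (?S y / (4 * \<tau> * \<gamma>))) \<partial>Q)"
    by (rule nn_integral_cmult) measurable
  also have "\<dots> \<le> ennreal (exp (- c / (4 * \<tau> * \<gamma>))) * ennreal (sqrt 2 ^ k)"
    by (intro mult_left_mono nn_integral_tilt_exp_squares[OF \<gamma> x]) simp
  finally show ?thesis by (simp add: ennreal_mult)
qed

end


section \<open>The Cameron--Martin formula for the data laws\<close>

lemma normal_density_scale: "0 < \<sigma> \<Longrightarrow> \<sigma> * normal_density 0 \<sigma> (\<sigma> * x) = std_normal_density x"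
  by (simp add: normal_density_def real_sqrt_mult power_mult_distrib)

lemma integral_iexp_normal:
  assumes X: "distributed M lborel X (normal_density 0 \<sigma>)" and \<sigma>: "\<sigma> > 0"
  shows "(CLINT x|M. iexp (s * X x)) = complex_of_real (exp (- (s\<^sup>2 * \<sigma>\<^sup>2) / 2))"
proof -
  have [measurable]: "X \<in> borel_measurable M" using distributed_measurable[OF X] by simp
  have "(CLINT x|M. iexp (s * X x)) = (CLINT v|distr M lborel X. iexp (s * v))"
    by (subst integral_distr) simp_all
  also have "distr M lborel X = density lborel (normal_density 0 \<sigma>)"
    by (rule distributed_distr_eq_density[OF X])
  also have "(CLINT v|density lborel (normal_density 0 \<sigma>). iexp (s * v))
      = (CLINT v|lborel. normal_density 0 \<sigma> v *\<^sub>R iexp (s * v))"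
    by (subst integral_density) simp_all
  also have "\<dots> = complex_of_real \<sigma> * (CLINT v|lborel. normal_density 0 \<sigma> (\<sigma> * v) *\<^sub>R iexp (s * (\<sigma> * v)))"
    using \<sigma> by (subst lborel_integral_real_affine[where t=0 and c=\<sigma>]) (simp_all add: scaleR_conv_of_real)
  also have "\<dots> = (CLINT v|lborel. complex_of_real \<sigma> * (normal_density 0 \<sigma> (\<sigma> * v) *\<^sub>R iexp (s * (\<sigma> * v))))"
    by (rule Bochner_Integration.integral_mult_right_zero[symmetric])
  also have "\<dots> = (CLINT v|lborel. std_normal_density v *\<^sub>R iexp ((s * \<sigma>) * v))"
    unfolding normal_density_scale[OF \<sigma>, symmetric] by (simp add: scaleR_conv_of_real mult_ac)
  also have "\<dots> = char std_normal_distribution (s * \<sigma>)"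
    unfolding char_def by (subst integral_density) simp_all
  finally show ?thesis by (simp add: char_std_normal_distribution power_mult_distrib)
qed

lemma norm_iexp_diff_le: "norm (iexp u - iexp v) \<le> \<bar>u - v\<bar>"
proof -
  have "iexp u - iexp v = iexp v * (iexp (u - v) - 1)"
    by (simp add: algebra_simps flip: exp_add)
  then have "norm (iexp u - iexp v) = norm (iexp (u - v) - 1)" by (simp add: norm_mult)
  also have "\<dots> \<le> \<bar>u - v\<bar>" using iexp_approx1[of "u - v" 0] by simp
  finally show ?thesis .
qed

text \<open>\<open>iexp\<close> is 1-Lipschitz, and the mean absolute difference is controlled by
  the mean square difference. Normality thus passes from finite combinations to mean square
  limits.\<close>

lemma (in prob_space) integral_iexp_tendsto:
  assumes X[measurable]: "\<And>j. X j \<in> borel_measurable M" and Y[measurable]: "Y \<in> borel_measurable M"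
    and lim: "(\<lambda>j::nat. \<integral>\<^sup>+x. ennreal ((X j x - Y x)\<^sup>2) \<partial>M) \<longlonglongrightarrow> 0"
  shows "(\<lambda>j. CLINT x|M. iexp (s * X j x)) \<longlonglongrightarrow> (CLINT x|M. iexp (s * Y x))"
proof (rule LIM_zero_cancel, rule tendsto_norm_zero_cancel, rule tendstoI)
  fix e :: real assume e: "e > 0"
  define d where "d = e / (1 + \<bar>s\<bar>)"
  have d: "d > 0" using e by (simp add: d_def add_pos_nonneg)
  have "\<forall>\<^sub>F j in sequentially. (\<integral>\<^sup>+x. ennreal ((X j x - Y x)\<^sup>2) \<partial>M) < ennreal (d\<^sup>2)"
    using lim d by (intro order_tendstoD) auto
  then show "\<forall>\<^sub>F j in sequentially. dist (norm ((CLINT x|M. iexp (s * X j x)) - (CLINT x|M. iexp (s * Y x)))) 0 < e"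
  proof eventually_elim
    fix j assume j: "(\<integral>\<^sup>+x. ennreal ((X j x - Y x)\<^sup>2) \<partial>M) < ennreal (d\<^sup>2)"
    let ?D = "\<lambda>x. X j x - Y x"
    have int2: "integrable M (\<lambda>x. (?D x)\<^sup>2)"
      using j by (intro integrableI_nonneg) (auto simp: less_top[symmetric] elim: order.strict_trans)
    then have D2: "(\<integral>x. (?D x)\<^sup>2 \<partial>M) < d\<^sup>2"
      using j d by (simp add: nn_integral_eq_integral ennreal_less_iff)
    have int1: "integrable M ?D" by (rule square_integrable_imp_integrable[OF _ int2]) measurable
    \<comment> \<open>Jensen's inequality for the square, in the form that the variance of |D| is
      nonnegative.\<close>
    have "(\<integral>x. \<bar>?D x\<bar> \<partial>M)\<^sup>2 \<le> (\<integral>x. \<bar>?D x\<bar>\<^sup>2 \<partial>M)"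
      using variance_eq[of "\<lambda>x. \<bar>?D x\<bar>"] variance_positive[of "\<lambda>x. \<bar>?D x\<bar>"] int1 int2 by simp
    then have "(\<integral>x. \<bar>?D x\<bar> \<partial>M)\<^sup>2 < d\<^sup>2" using D2 by simp
    then have D1: "(\<integral>x. \<bar>?D x\<bar> \<partial>M) < d" by (rule power_less_imp_less_base) (use d in simp)
    have int: "integrable M (\<lambda>x. iexp (s * X j x))" "integrable M (\<lambda>x. iexp (s * Y x))"
      by (rule integrable_const_bound[of _ 1]; simp)+
    have "norm ((CLINT x|M. iexp (s * X j x)) - (CLINT x|M. iexp (s * Y x)))
        = norm (CLINT x|M. iexp (s * X j x) - iexp (s * Y x))"
      using int by simp
    also have "\<dots> \<le> (\<integral>x. norm (iexp (s * X j x) - iexp (s * Y x)) \<partial>M)" by (rule integral_norm_bound)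
    also have "\<dots> \<le> (\<integral>x. \<bar>s\<bar> * \<bar>?D x\<bar> \<partial>M)"
    proof (rule integral_mono)
      show "norm (iexp (s * X j x) - iexp (s * Y x)) \<le> \<bar>s\<bar> * \<bar>?D x\<bar>" for x
        using norm_iexp_diff_le[of "s * X j x" "s * Y x"] by (simp add: abs_mult flip: right_diff_distrib)
    qed (use int int1 in auto)
    also have "\<dots> = \<bar>s\<bar> * (\<integral>x. \<bar>?D x\<bar> \<partial>M)" by simp
    also have "\<dots> \<le> \<bar>s\<bar> * d" using D1 by (intro mult_left_mono) auto
    also have "\<dots> < e" using e by (simp add: d_def field_simps)
    finally show "dist (norm ((CLINT x|M. iexp (s * X j x)) - (CLINT x|M. iexp (s * Y x)))) 0 < e" by simp
  qed
qed

section \<open>The covariance operator, its square root, and finite coordinate pairings\<close>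

locale covariance =
  fixes \<zeta> :: "'b::{real_inner, complete_space} \<Rightarrow> 'b" and b :: "nat \<Rightarrow> 'b"
  assumes zeta: "bounded_selfadjoint \<zeta>" "positive_definite \<zeta>"
    and b: "orthonormal_basis b"
begin

abbreviation "T \<equiv> op_sqrt \<zeta>"

lemma zeta_nonneg: "0 \<le> inner (\<zeta> x) x"
  using zeta(2) by (cases "x = 0") (auto simp: positive_definite_def intro: less_imp_le)

lemma T_T: "T (T x) = \<zeta> x" and T_selfadjoint: "bounded_selfadjoint T"
  using op_sqrt_properties[OF zeta(1) zeta_nonneg] by auto

lemma T_bounded_linear: "bounded_linear T" and T_sym: "inner (T x) y = inner x (T y)"
  using T_selfadjoint by (auto simp: bounded_selfadjoint_def)

interpretation T: bounded_linear T by (rule T_bounded_linear)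

lemma norm_T: "(norm (T x))\<^sup>2 = inner (\<zeta> x) x"
  by (simp add: power2_norm_eq_inner T_sym T_T inner_commute)

lemma T_eq_0: "T x = 0 \<Longrightarrow> x = 0"
  using zeta(2) norm_T[of x] by (auto simp: positive_definite_def)

lemma inj_T: "inj T"
proof (rule injI)
  fix x y assume "T x = T y"
  then have "T (x - y) = 0" by (simp add: T.diff)
  then have "x - y = 0" by (rule T_eq_0)
  then show "x = y" by simp
qed

lemma inv_T_T: "inv T (T x) = x"
  by (rule inv_f_f[OF inj_T])

lemma cm_norm_T: "cm_norm \<zeta> (T a) = norm a"
  by (simp add: cm_norm_def cm_inner_def inv_T_T norm_eq_sqrt_inner)

text \<open>If \<open>x\<close> is orthogonal to the image, symmetry moves \<open>T\<close> onto
  \<open>x\<close>; then \<open>T x\<close> is orthogonal to a dense subspace, and injectivity gives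
  \<open>x = 0\<close>.\<close>

lemma dense_T_span: "closure (T ` span (range b)) = UNIV"
proof (rule dense_subspaceI)
  show "subspace (T ` span (range b))"
    by (intro linear_subspace_image T.linear subspace_span)
next
  fix x assume *: "\<And>v. v \<in> T ` span (range b) \<Longrightarrow> inner x v = 0"
  have "span (range b) \<subseteq> {v. inner (T x) v = 0}" using * by (auto simp: T_sym)
  then have "closure (span (range b)) \<subseteq> {v. inner (T x) v = 0}"
    by (intro closure_minimal closed_Collect_eq continuous_intros)
  moreover have "closure (span (range b)) = UNIV" using b by (simp add: orthonormal_basis_def)
  ultimately have "inner (T x) (T x) = 0" by blast
  then show "x = 0" using T_eq_0 by simp
qed

text \<open>Such sequences are what \<open>cm_functional\<close> speaks about: the Cameron--Martin
  distance of \<open>\<zeta> (z j)\<close> from \<open>T a\<close> is the norm of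
  \<open>T (z j) - a\<close>.\<close>

lemma ex_span_approx: "\<exists>z. (\<forall>j. z j \<in> span (range b)) \<and> (\<lambda>j::nat. T (z j)) \<longlonglongrightarrow> a"
proof -
  have "a \<in> closure (T ` span (range b))" by (simp add: dense_T_span)
  then obtain f where f: "\<And>j. f j \<in> T ` span (range b)" "f \<longlonglongrightarrow> a"
    unfolding closure_sequential by blast
  then have "\<forall>j. \<exists>z. z \<in> span (range b) \<and> f j = T z" by blast
  then obtain z where z: "\<And>j. z j \<in> span (range b)" "\<And>j. f j = T (z j)" by metis
  then have "f = (\<lambda>j. T (z j))" by auto
  with z f(2) show ?thesis by blast
qed

lemma orthonormal: "inner (b i) (b j) = (if i = j then 1 else 0)"
  using b by (simp add: orthonormal_basis_def)

text \<open>The form with all large \<open>m\<close> lets several vectors share one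
  \<open>m\<close>.\<close>

lemma span_expansion:
  assumes "x \<in> span (range b)"
  shows "\<forall>\<^sub>F m in sequentially. x = (\<Sum>i<m. inner x (b i) *\<^sub>R b i)"
  using assms
proof (induction rule: span_induct_alt)
  case base
  show ?case by simp
next
  case (step c v y)
  then obtain i where i: "v = b i" by blast
  from step(2) show ?case
    using eventually_gt_at_top[of i]
  proof eventually_elim
    case (elim m)
    have "(\<Sum>j<m. inner (c *\<^sub>R v + y) (b j) *\<^sub>R b j)
        = (\<Sum>j<m. (c * inner v (b j)) *\<^sub>R b j) + (\<Sum>j<m. inner y (b j) *\<^sub>R b j)"
      by (simp add: inner_add_left scaleR_add_left sum.distrib)
    also have "(\<Sum>j<m. inner y (b j) *\<^sub>R b j) = y" using elim(1) by simp
    also have "(\<Sum>j<m. (c * inner v (b j)) *\<^sub>R b j) = (\<Sum>j<m. if j = i then c *\<^sub>R b i else 0)"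
      by (rule sum.cong) (auto simp: i orthonormal)
    also have "\<dots> = c *\<^sub>R v" using elim(2) by (simp add: i)
    finally show ?case by simp
  qed
qed

lemma coord_pairing_eq_sum:
  assumes "x \<in> span (range b)"
  shows "\<forall>\<^sub>F m in sequentially. \<forall>y. coord_pairing b y x = (\<Sum>i<m. inner x (b i) * y i)"
  using span_expansion[OF assms]
proof eventually_elim
  case (elim m)
  have "inner x (b i) = 0" if "i \<ge> m" for i
    by (subst elim) (use that in \<open>auto simp: inner_sum_left orthonormal intro!: sum.neutral\<close>)
  then have "{i. inner x (b i) \<noteq> 0} \<subseteq> {..<m}" by (auto simp: not_less[symmetric])
  then show ?case
    unfolding coord_pairing_def by (intro allI sum.mono_neutral_left) auto
qed

lemma coord_pairing_linear:
  assumes x: "x \<in> span (range b)" "x' \<in> span (range b)"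
  shows "coord_pairing b y (s *\<^sub>R x + t *\<^sub>R x') = s * coord_pairing b y x + t * coord_pairing b y x'"
proof -
  have "s *\<^sub>R x + t *\<^sub>R x' \<in> span (range b)" by (intro span_add span_scale x)
  from eventually_conj[OF coord_pairing_eq_sum[OF this] eventually_conj[OF coord_pairing_eq_sum[OF x(1)] coord_pairing_eq_sum[OF x(2)]]]
  obtain m where "\<forall>y. coord_pairing b y (s *\<^sub>R x + t *\<^sub>R x') = (\<Sum>i<m. inner (s *\<^sub>R x + t *\<^sub>R x') (b i) * y i)"
    "\<forall>y. coord_pairing b y x = (\<Sum>i<m. inner x (b i) * y i)"
    "\<forall>y. coord_pairing b y x' = (\<Sum>i<m. inner x' (b i) * y i)"
    unfolding eventually_sequentially by blast
  then show ?thesis by (simp add: inner_add_left sum_distrib_left sum.distrib algebra_simps)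
qed

lemma coord_pairing_measurable:
  assumes "x \<in> span (range b)"
  shows "(\<lambda>y. coord_pairing b y x) \<in> borel_measurable seq_space"
proof -
  obtain m where "\<forall>y. coord_pairing b y x = (\<Sum>i<m. inner x (b i) * y i)"
    using coord_pairing_eq_sum[OF assms] unfolding eventually_sequentially by blast
  then have "(\<lambda>y. coord_pairing b y x) = (\<lambda>y. \<Sum>i<m. inner x (b i) * y i)" by auto
  then show ?thesis by simp
qed

lemma coord_pairing_affine:
  assumes "x \<in> span (range b)"
  shows "coord_pairing b (\<lambda>i. inner v (b i) + w i / c) x = inner v x + coord_pairing b w x / c"
proof -
  from eventually_conj[OF coord_pairing_eq_sum[OF assms] span_expansion[OF assms]]
  obtain m where m: "\<forall>y. coord_pairing b y x = (\<Sum>i<m. inner x (b i) * y i)"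
    "x = (\<Sum>i<m. inner x (b i) *\<^sub>R b i)" unfolding eventually_sequentially by blast
  have "inner v x = (\<Sum>i<m. inner x (b i) * inner v (b i))"
    by (subst m(2)) (simp add: inner_sum_right)
  with m(1) show ?thesis by (simp add: sum.distrib sum_divide_distrib algebra_simps)
qed

lemma coord_pairing_basis_sum: "coord_pairing b y (\<Sum>j<m. t j *\<^sub>R b j) = (\<Sum>j<m. t j * y j)"
proof -
  let ?x = "\<Sum>j<m. t j *\<^sub>R b j"
  have x: "inner ?x (b i) = (if i < m then t i else 0)" for i
    by (simp add: inner_sum_left orthonormal if_distrib[of "(*) _"] cong: if_cong)
  have "coord_pairing b y ?x = (\<Sum>i<m. inner ?x (b i) * y i)"
    unfolding coord_pairing_def by (rule sum.mono_neutral_left) (auto simp: x split: if_splits)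
  then show ?thesis by (simp add: x)
qed

end

section \<open>The data laws as mean shifts of an isonormal process\<close>

locale regression_model = covariance \<zeta> b
  for \<zeta> :: "'b::{real_inner, complete_space} \<Rightarrow> 'b" and b +
  fixes G :: "'a::real_inner \<Rightarrow> 'b" and N :: "(nat \<Rightarrow> real) measure" and L :: "(nat \<Rightarrow> real) \<Rightarrow> 'b \<Rightarrow> real"
    and n :: nat
  assumes G: "bounded_linear G"
    and range_G: "range G \<subseteq> cm_space \<zeta>"
    and noise: "gaussian_noise b \<zeta> N"
    and functional: "cm_functional b \<zeta> (data_law b G N 0 n) L"
    and n: "n \<ge> 1"
begin

interpretation T: bounded_linear T by (rule T_bounded_linear)
interpretation G: bounded_linear G by (rule G)

abbreviation "Q \<equiv> data_law b G N 0 n"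
text \<open>\<open>Q\<close> is the law of the noise divided by sqrt n, so the pairing with
  \<open>T a\<close> has variance |a|^2 / n. The factor n raises this to n |a|^2 and makes
  \<open>tilt (A u)\<close> agree with the likelihood in the posterior.\<close>

definition "W a y = real n * L y (T a)"
definition "A u = inv T (G u)"

lemma T_A: "T (A u) = G u"
proof -
  have "G u \<in> range T" using range_G by (auto simp: cm_space_def)
  then show ?thesis unfolding A_def by (rule f_inv_into_f)
qed

lemma A_diff: "A (u - v) = A u - A v"
  using inj_T by (rule injD) (simp add: T_A T.diff G.diff)

lemma cm_norm_G: "cm_norm \<zeta> (G u) = norm (A u)"
  using cm_norm_T[of "A u"] by (simp add: T_A)

lemma prob_N: "prob_space N" and sets_N[measurable_cong]: "sets N = sets seq_space"
  using noise by (auto simp: gaussian_noise_def)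

interpretation N: prob_space N by (rule prob_N)

lemma data_map_measurable: "(\<lambda>w i. inner (G v) (b i) + w i / sqrt (real n)) \<in> measurable N seq_space"
  by (rule measurable_PiM_single') (auto simp: space_PiM)

lemma sets_data_law[measurable_cong]: "sets (data_law b G N v n) = sets seq_space"
  by (simp add: data_law_def)

lemma space_data_law: "space (data_law b G N v n) = UNIV"
  by (simp add: data_law_def space_PiM)

lemma prob_data_law: "prob_space (data_law b G N v n)"
  unfolding data_law_def by (rule N.prob_space_distr) (rule data_map_measurable)

interpretation Q: prob_space Q by (rule prob_data_law)

lemma integral_data_law_iexp:
  assumes x: "x \<in> span (range b)"
  shows "(CLINT y|data_law b G N v n. iexp (s * coord_pairing b y x))
    = iexp (s * inner (G v) x) * complex_of_real (exp (- (s\<^sup>2 * (norm (T x))\<^sup>2) / (2 * real n)))"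
proof -
  note [measurable] = coord_pairing_measurable[OF x] data_map_measurable
  have "(CLINT y|data_law b G N v n. iexp (s * coord_pairing b y x))
      = (CLINT w|N. iexp (s * inner (G v) x) * iexp ((s / sqrt (real n)) * coord_pairing b w x))"
    unfolding data_law_def
    by (subst integral_distr) (simp_all add: coord_pairing_affine[OF x] algebra_simps exp_add)
  also have "\<dots> = iexp (s * inner (G v) x) * (CLINT w|N. iexp ((s / sqrt (real n)) * coord_pairing b w x))"
    by (rule Bochner_Integration.integral_mult_right_zero)
  also have "(CLINT w|N. iexp ((s / sqrt (real n)) * coord_pairing b w x))
      = complex_of_real (exp (- (s\<^sup>2 * (norm (T x))\<^sup>2) / (2 * real n)))"
  proof (cases "x = 0")
    \<comment> \<open>\<open>gaussian_noise\<close> prescribes a density only for nonzero vectors;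
      at 0 the pairing vanishes identically.\<close>
    case True
    then show ?thesis by (simp add: coord_pairing_def T.zero N.prob_space)
  next
    case False
    have pos: "inner (\<zeta> x) x > 0" using zeta(2) False by (simp add: positive_definite_def)
    have "distributed N lborel (\<lambda>w. coord_pairing b w x) (normal_density 0 (sqrt (inner (\<zeta> x) x)))"
      using noise x False by (simp add: gaussian_noise_def)
    from integral_iexp_normal[OF this, of "s / sqrt (real n)"] pos show ?thesis
      by (simp add: norm_T power_divide mult_ac)
  qed
  finally show ?thesis .
qed

lemma L_measurable: "(\<lambda>y. L y (T a)) \<in> borel_measurable seq_space"
proof -
  have "(\<lambda>y. L y (T a)) \<in> borel_measurable Q"
    using functional by (auto simp: cm_functional_def cm_space_def)
  then show ?thesis by (simp add: measurable_cong_sets[OF sets_data_law refl])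
qed

lemma L_limit:
  assumes "\<And>j. z j \<in> span (range b)" "(\<lambda>j. T (z j)) \<longlonglongrightarrow> a"
  shows "(\<lambda>j. \<integral>\<^sup>+y. ennreal ((coord_pairing b y (z j) - L y (T a))\<^sup>2) \<partial>Q) \<longlonglongrightarrow> 0"
proof -
  have "cm_norm \<zeta> (\<zeta> (z j) - T a) = norm (T (z j) - a)" for j
    using cm_norm_T[of "T (z j) - a"] by (simp add: T.diff T_T)
  then have "(\<lambda>j. cm_norm \<zeta> (\<zeta> (z j) - T a)) \<longlonglongrightarrow> 0"
    using tendsto_norm_zero[OF LIM_zero[OF assms(2)]] by simp
  then show ?thesis
    using functional assms(1) by (auto simp: cm_functional_def cm_space_def)
qed

text \<open>For the constant approximating sequence the mean square error does not depend on the
  index, so its limit 0 is its value.\<close>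

lemma L_span_AE:
  assumes x: "x \<in> span (range b)"
  shows "AE y in Q. L y (\<zeta> x) = coord_pairing b y x"
proof -
  note [measurable] = coord_pairing_measurable[OF x] L_measurable
  have "(\<lambda>j::nat. \<integral>\<^sup>+y. ennreal ((coord_pairing b y x - L y (T (T x)))\<^sup>2) \<partial>Q) \<longlonglongrightarrow> 0"
    using x by (intro L_limit[of "\<lambda>_. x"]) auto
  then have "(\<integral>\<^sup>+y. ennreal ((coord_pairing b y x - L y (T (T x)))\<^sup>2) \<partial>Q) = 0"
    by (simp only: tendsto_const_iff sequentially_bot simp_thms)
  then have "AE y in Q. ennreal ((coord_pairing b y x - L y (T (T x)))\<^sup>2) = 0"
    by (subst (asm) nn_integral_0_iff_AE) measurable
  then show ?thesis by eventually_elim (simp add: T_T)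
qed

text \<open>Approximations of \<open>a\<close> and \<open>c\<close> combine to one of the linear
  combination, and finite pairings are exactly linear. The defect of linearity is therefore bounded
  in mean square by three approximation errors, all tending to 0.\<close>

lemma L_linear_AE: "AE y in Q. L y (T (s *\<^sub>R a + t *\<^sub>R c)) = s * L y (T a) + t * L y (T c)"
proof -
  note [measurable] = L_measurable
  obtain z where z: "\<And>j. z j \<in> span (range b)" "(\<lambda>j. T (z j)) \<longlonglongrightarrow> a" using ex_span_approx by blast
  obtain z' where z': "\<And>j. z' j \<in> span (range b)" "(\<lambda>j. T (z' j)) \<longlonglongrightarrow> c" using ex_span_approx by blast
  let ?x = "\<lambda>j. s *\<^sub>R z j + t *\<^sub>R z' j"
  have x: "?x j \<in> span (range b)" for j by (intro span_add span_scale z z')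
  have Tx: "(\<lambda>j. T (?x j)) \<longlonglongrightarrow> s *\<^sub>R a + t *\<^sub>R c"
    unfolding T.add T.scaleR by (intro tendsto_intros z z')
  note [measurable] = coord_pairing_measurable[OF z(1)] coord_pairing_measurable[OF z'(1)] coord_pairing_measurable[OF x]
  let ?E = "\<lambda>x a. \<integral>\<^sup>+y. ennreal ((coord_pairing b y x - L y (T a))\<^sup>2) \<partial>Q"
  let ?D = "\<lambda>y. L y (T (s *\<^sub>R a + t *\<^sub>R c)) - s * L y (T a) - t * L y (T c)"
  have "(\<integral>\<^sup>+y. ennreal ((?D y)\<^sup>2) \<partial>Q)
      \<le> ennreal 3 * ?E (?x j) (s *\<^sub>R a + t *\<^sub>R c) + ennreal (3 * s\<^sup>2) * ?E (z j) a + ennreal (3 * t\<^sup>2) * ?E (z' j) c" for j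
  proof -
    have sq: "(p + q + r)\<^sup>2 \<le> 3 * p\<^sup>2 + 3 * q\<^sup>2 + 3 * r\<^sup>2" for p q r :: real
      using sum_squares_bound[of p q] sum_squares_bound[of p r] sum_squares_bound[of q r]
      by (simp add: power2_sum algebra_simps power2_eq_square)
    have D: "(?D y)\<^sup>2 \<le> 3 * (coord_pairing b y (?x j) - L y (T (s *\<^sub>R a + t *\<^sub>R c)))\<^sup>2
        + 3 * s\<^sup>2 * (coord_pairing b y (z j) - L y (T a))\<^sup>2 + 3 * t\<^sup>2 * (coord_pairing b y (z' j) - L y (T c))\<^sup>2" for y
    proof -
      have "?D y = - (coord_pairing b y (?x j) - L y (T (s *\<^sub>R a + t *\<^sub>R c)))
          + s * (coord_pairing b y (z j) - L y (T a)) + t * (coord_pairing b y (z' j) - L y (T c))"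
        using coord_pairing_linear[OF z(1)[of j] z'(1)[of j]] by (simp add: algebra_simps)
      then show ?thesis
        using sq[of "- (coord_pairing b y (?x j) - L y (T (s *\<^sub>R a + t *\<^sub>R c)))"
            "s * (coord_pairing b y (z j) - L y (T a))" "t * (coord_pairing b y (z' j) - L y (T c))"]
        by (simp only: power_mult_distrib power2_minus mult.assoc)
    qed
    have "(\<integral>\<^sup>+y. ennreal ((?D y)\<^sup>2) \<partial>Q) \<le> (\<integral>\<^sup>+y. ennreal 3 * ennreal ((coord_pairing b y (?x j) - L y (T (s *\<^sub>R a + t *\<^sub>R c)))\<^sup>2)
        + ennreal (3 * s\<^sup>2) * ennreal ((coord_pairing b y (z j) - L y (T a))\<^sup>2)
        + ennreal (3 * t\<^sup>2) * ennreal ((coord_pairing b y (z' j) - L y (T c))\<^sup>2) \<partial>Q)"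
    proof (rule nn_integral_mono)
      fix y
      show "ennreal ((?D y)\<^sup>2) \<le> ennreal 3 * ennreal ((coord_pairing b y (?x j) - L y (T (s *\<^sub>R a + t *\<^sub>R c)))\<^sup>2)
        + ennreal (3 * s\<^sup>2) * ennreal ((coord_pairing b y (z j) - L y (T a))\<^sup>2)
        + ennreal (3 * t\<^sup>2) * ennreal ((coord_pairing b y (z' j) - L y (T c))\<^sup>2)"
        using ennreal_leI[OF D[of y]] by (simp only: ennreal_plus ennreal_mult zero_le_power2 zero_le_mult_iff
          zero_le_numeral simp_thms add_nonneg_nonneg mult_nonneg_nonneg)
    qed
    also have "\<dots> = ennreal 3 * ?E (?x j) (s *\<^sub>R a + t *\<^sub>R c) + ennreal (3 * s\<^sup>2) * ?E (z j) a + ennreal (3 * t\<^sup>2) * ?E (z' j) c"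
    proof -
      have add: "(\<integral>\<^sup>+y. c1 * f1 y + c2 * f2 y + c3 * f3 y \<partial>Q) = c1 * (\<integral>\<^sup>+y. f1 y \<partial>Q) + c2 * (\<integral>\<^sup>+y. f2 y \<partial>Q) + c3 * (\<integral>\<^sup>+y. f3 y \<partial>Q)"
        if [measurable]: "f1 \<in> borel_measurable Q" "f2 \<in> borel_measurable Q" "f3 \<in> borel_measurable Q" for c1 c2 c3 f1 f2 f3
        by (simp add: nn_integral_add nn_integral_cmult)
      show ?thesis by (rule add) measurable
    qed
    finally show ?thesis .
  qed
  moreover have "(\<lambda>j. ennreal 3 * ?E (?x j) (s *\<^sub>R a + t *\<^sub>R c) + ennreal (3 * s\<^sup>2) * ?E (z j) a + ennreal (3 * t\<^sup>2) * ?E (z' j) c)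
      \<longlonglongrightarrow> ennreal 3 * 0 + ennreal (3 * s\<^sup>2) * 0 + ennreal (3 * t\<^sup>2) * 0"
    by (intro tendsto_add ennreal_tendsto_cmult L_limit x Tx z z') auto
  ultimately have "(\<integral>\<^sup>+y. ennreal ((?D y)\<^sup>2) \<partial>Q) \<le> ennreal 3 * 0 + ennreal (3 * s\<^sup>2) * 0 + ennreal (3 * t\<^sup>2) * 0"
    by (intro LIMSEQ_le_const) auto
  then have "(\<integral>\<^sup>+y. ennreal ((?D y)\<^sup>2) \<partial>Q) = 0" by simp
  then have "AE y in Q. ennreal ((?D y)\<^sup>2) = 0"
    by (subst (asm) nn_integral_0_iff_AE) measurable
  then show ?thesis by eventually_elim simp
qed

lemma isonormal: "isonormal Q W (real n)"
proof
  note [measurable] = L_measurable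
  show "0 < real n" using n by simp
  show W_meas: "W a \<in> borel_measurable Q" for a unfolding W_def by measurable
  show "AE y in Q. W (s *\<^sub>R a + t *\<^sub>R c) y = s * W a y + t * W c y" for s a t c
    using L_linear_AE[of s a t c] by eventually_elim (simp add: W_def algebra_simps)
  fix a
  obtain z where z: "\<And>j. z j \<in> span (range b)" "(\<lambda>j. T (z j)) \<longlonglongrightarrow> a" using ex_span_approx by blast
  note [measurable] = coord_pairing_measurable[OF z(1)]
  have "(\<lambda>j. CLINT y|Q. iexp (real n * coord_pairing b y (z j))) \<longlonglongrightarrow> (CLINT y|Q. iexp (real n * L y (T a)))"
    by (rule Q.integral_iexp_tendsto[OF _ _ L_limit[OF z]]) measurable
  moreover have "(\<lambda>j. CLINT y|Q. iexp (real n * coord_pairing b y (z j)))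
      = (\<lambda>j. complex_of_real (exp (- real n * (norm (T (z j)))\<^sup>2 / 2)))"
  proof
    fix j
    show "(CLINT y|Q. iexp (real n * coord_pairing b y (z j))) = complex_of_real (exp (- real n * (norm (T (z j)))\<^sup>2 / 2))"
      using n integral_data_law_iexp[OF z(1)[of j], where s="real n" and v=0] by (simp add: G.zero power2_eq_square)
  qed
  moreover have "(\<lambda>j. complex_of_real (exp (- real n * (norm (T (z j)))\<^sup>2 / 2)))
      \<longlonglongrightarrow> complex_of_real (exp (- real n * (norm a)\<^sup>2 / 2))"
    by (intro tendsto_intros z) simp
  ultimately show "(CLINT y|Q. iexp (W a y)) = complex_of_real (exp (- real n * (norm a)\<^sup>2 / 2))"
    unfolding W_def by (metis LIMSEQ_unique)
qed

sublocale isonormal Q W "real n" by (rule isonormal)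

text \<open>A finite combination of coordinates is the pairing with some \<open>x\<close> in the
  span, and under \<open>Q\<close> it equals almost surely \<open>W\<close> at \<open>T x\<close>
  divided by n. The tilted characteristic function there has phase \<open>inner (A u) (T x)\<close>,
  which is \<open>inner (G u) x\<close> by symmetry of \<open>T\<close>: the shift in the data
  law.\<close>

lemma data_law_eq_density: "data_law b G N u n = density Q (\<lambda>y. ennreal (tilt (A u) y))"
proof (rule seq_space_measure_eqI)
  interpret P: prob_space "data_law b G N u n" by (rule prob_data_law)
  show "finite_measure (data_law b G N u n)" by unfold_locales
  show "finite_measure (density Q (\<lambda>y. ennreal (tilt (A u) y)))"
    by (rule finite_measureI) (simp add: emeasure_density nn_integral_tilt cong: nn_integral_cong)
  show "sets (data_law b G N u n) = sets seq_space" by (rule sets_data_law)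
  show "sets (density Q (\<lambda>y. ennreal (tilt (A u) y))) = sets seq_space" by (simp add: sets_data_law)
  fix t :: "nat \<Rightarrow> real" and m
  define x where "x = (\<Sum>j<m. t j *\<^sub>R b j)"
  have x: "x \<in> span (range b)" unfolding x_def by (intro span_sum span_scale span_base) auto
  note [measurable] = coord_pairing_measurable[OF x]
  have sum: "(\<Sum>j<m. t j * y j) = coord_pairing b y x" for y
    unfolding x_def by (rule coord_pairing_basis_sum[symmetric])
  let ?a = "(1 / real n) *\<^sub>R T x"
  have "AE y in Q. W ?a y = coord_pairing b y x"
    using L_span_AE[OF x] W_scale[of "1 / real n" "T x"]
    by eventually_elim (use n in \<open>simp add: W_def T_T\<close>)
  then have "(CLINT y|Q. tilt (A u) y *\<^sub>R iexp (coord_pairing b y x)) = (CLINT y|Q. tilt (A u) y *\<^sub>R iexp (W ?a y))"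
    by (intro integral_cong_AE) auto
  also have "\<dots> = iexp (real n * inner (A u) ?a) * complex_of_real (exp (- real n * (norm ?a)\<^sup>2 / 2))"
    by (rule integral_tilt_iexp)
  also have "\<dots> = iexp (1 * inner (G u) x) * complex_of_real (exp (- (1\<^sup>2 * (norm (T x))\<^sup>2) / (2 * real n)))"
    using n T_sym[of "A u" x] by (simp add: T_A power_mult_distrib power_divide power2_eq_square)
  also have "\<dots> = (CLINT y|data_law b G N u n. iexp (1 * coord_pairing b y x))"
    by (rule integral_data_law_iexp[OF x, symmetric])
  finally have "(CLINT y|Q. tilt (A u) y *\<^sub>R iexp (coord_pairing b y x)) = (CLINT y|data_law b G N u n. iexp (coord_pairing b y x))"
    by simp
  then show "(CLINT y|data_law b G N u n. iexp (\<Sum>j<m. t j * y j))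
      = (CLINT y|density Q (\<lambda>y. ennreal (tilt (A u) y)). iexp (\<Sum>j<m. t j * y j))"
    unfolding sum using tilt_pos[of "A u"] by (subst integral_density) (simp_all add: less_imp_le)
qed

end


section \<open>Testing and posterior contraction\<close>

context covariance
begin

interpretation T: bounded_linear T by (rule T_bounded_linear)

context
  fixes G :: "'a::real_inner \<Rightarrow> 'b" and e \<phi> :: "nat \<Rightarrow> 'a" and \<rho> :: "nat \<Rightarrow> real"
  assumes G: "bounded_linear G" "inj G"
    and e: "orthonormal_basis e" and rho: "\<And>i. \<rho> i > 0"
    and svd: "\<And>i v. inner (G (e i)) (G v) = (\<rho> i)\<^sup>2 * inner (e i) v"
    and phi: "orthonormal_basis \<phi>"
begin

lemma inv_adjoint_proj:
  "inv_adjoint G (proj_upto e r h) = (\<Sum>i<r. (inner h (e i) / (\<rho> i)\<^sup>2) *\<^sub>R G (e i))"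
  using proj_upto_orthonormal[of e r h] inv_adjoint_explicit[OF G rho svd] e
  by (simp add: orthonormal_basis_def)

text \<open>The factors \<open>(\<rho> i)\<^sup>2\<close> of the singular value relation cancel the
  divisions in the explicit adjoint. Coordinates of the projected parameter thus become linear
  functionals of \<open>G u\<close>, which the data can estimate.\<close>

lemma inner_inv_adjoint_proj: "inner (G u) (inv_adjoint G (proj_upto e r h)) = inner (proj_upto e r u) h"
proof -
  have pu: "proj_upto e r u = (\<Sum>i<r. inner u (e i) *\<^sub>R e i)"
    using e by (intro proj_upto_orthonormal) (simp add: orthonormal_basis_def)
  have "\<rho> i \<noteq> 0" for i using rho[of i] by simp
  moreover have "inner (G u) (G (e i)) = (\<rho> i)\<^sup>2 * inner u (e i)" for i
    using svd[of i u] by (simp add: inner_commute)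
  ultimately show ?thesis
    by (simp add: inv_adjoint_proj pu inner_sum_right inner_sum_left inner_commute mult_ac)
qed

lemma inv_adjoint_proj_sum:
  "inv_adjoint G (proj_upto e r (\<Sum>j<k. c j *\<^sub>R h j)) = (\<Sum>j<k. c j *\<^sub>R inv_adjoint G (proj_upto e r (h j)))"
  unfolding inv_adjoint_proj
  by (simp add: scaleR_sum_right inner_sum_left sum_divide_distrib scaleR_sum_left)
    (rule sum.swap)

text \<open>By linearity the combination is the image of h = sum of c j times \<phi> j, and
  orthonormality makes |h|^2 the sum of the squared coefficients. Scaling to the unit ball brings in
  \<open>g_const\<close>.\<close>

lemma norm_inv_adjoint_proj_le:
  assumes g: "sqrt (g_const G \<zeta> e \<phi> k r) \<le> s"
  shows "(norm (\<Sum>j<k. c j *\<^sub>R T (inv_adjoint G (proj_upto e r (\<phi> j)))))\<^sup>2 \<le> s\<^sup>2 * (\<Sum>j<k. (c j)\<^sup>2)"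
proof -
  let ?w = "\<lambda>h. T (inv_adjoint G (proj_upto e r h))"
  let ?S = "{(norm (?w h))\<^sup>2 | h. h \<in> span (\<phi> ` {..<k}) \<and> norm h \<le> 1}"
  define h where "h = (\<Sum>j<k. c j *\<^sub>R \<phi> j)"
  \<comment> \<open>A crude bound on the unit ball: the real \<open>Sup\<close> in
    \<open>g_const\<close> dominates its elements only when the set is bounded above.\<close>
  define K where "K = (\<Sum>i<r. norm (T (G (e i))) / (\<rho> i)\<^sup>2)"
  have norm_e: "norm (e i) = 1" for i using e by (simp add: orthonormal_basis_def norm_eq_sqrt_inner)
  have w_le: "norm (?w h) \<le> K" if "norm h \<le> 1" for h
  proof -
    have "norm (?w h) \<le> (\<Sum>i<r. norm ((inner h (e i) / (\<rho> i)\<^sup>2) *\<^sub>R T (G (e i))))"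
      unfolding inv_adjoint_proj T.sum T.scaleR by (rule norm_sum)
    also have "\<dots> \<le> K"
      unfolding K_def
    proof (rule sum_mono)
      fix i
      have "\<bar>inner h (e i)\<bar> \<le> norm h * norm (e i)" by (rule Cauchy_Schwarz_ineq2)
      then have "\<bar>inner h (e i)\<bar> \<le> 1" using that by (simp add: norm_e)
      then have "\<bar>inner h (e i)\<bar> * (norm (T (G (e i))) / (\<rho> i)\<^sup>2) \<le> 1 * (norm (T (G (e i))) / (\<rho> i)\<^sup>2)"
        by (rule mult_right_mono) simp
      then show "norm ((inner h (e i) / (\<rho> i)\<^sup>2) *\<^sub>R T (G (e i))) \<le> norm (T (G (e i))) / (\<rho> i)\<^sup>2"
        by simp
    qed
    finally show ?thesis .
  qed
  have bdd: "bdd_above ?S"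
    by (rule bdd_aboveI[of _ "K\<^sup>2"]) (auto intro!: power_mono w_le)
  have norm_h: "(norm h)\<^sup>2 = (\<Sum>j<k. (c j)\<^sup>2)"
    using phi unfolding power2_norm_eq_inner
    by (simp add: h_def orthonormal_basis_def inner_sum_left inner_sum_right power2_eq_square
        if_distrib[of "(*) _"] cong: if_cong)
  have sum_h: "(\<Sum>j<k. c j *\<^sub>R ?w (\<phi> j)) = ?w h"
    unfolding h_def inv_adjoint_proj_sum by (simp add: T.sum T.scaleR)
  show ?thesis
  proof (cases "h = 0")
    case True
    have "?w 0 = 0" by (simp add: inv_adjoint_proj T.zero)
    then show ?thesis using True unfolding sum_h by (simp add: sum_nonneg)
  next
    case False
    let ?h = "(1 / norm h) *\<^sub>R h"
    have "?h \<in> span (\<phi> ` {..<k})"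
      unfolding h_def by (intro span_scale span_sum span_base) auto
    then have "(norm (?w ?h))\<^sup>2 \<in> ?S" using False by force
    then have "(norm (?w ?h))\<^sup>2 \<le> g_const G \<zeta> e \<phi> k r"
      unfolding g_const_def using bdd by (rule cSup_upper)
    also have "\<dots> \<le> s\<^sup>2" using g by (rule sqrt_le_D)
    finally have "(norm (?w ?h))\<^sup>2 \<le> s\<^sup>2" .
    moreover have "?w ?h = (1 / norm h) *\<^sub>R ?w h"
    proof -
      have "inv_adjoint G (proj_upto e r ?h) = (1 / norm h) *\<^sub>R inv_adjoint G (proj_upto e r h)"
        using inv_adjoint_proj_sum[where k="Suc 0" and c="\<lambda>_. 1 / norm h" and h="\<lambda>_. h" and r=r]
        by (simp only: sum.lessThan_Suc lessThan_0 sum.empty add_0)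
      then show ?thesis by (simp only: T.scaleR)
    qed
    ultimately have "(norm (?w h))\<^sup>2 / (norm h)\<^sup>2 \<le> s\<^sup>2" by (simp add: power_mult_distrib power_divide)
    then show ?thesis using False unfolding sum_h norm_h[symmetric] by (simp add: divide_le_eq)
  qed
qed

text \<open>By orthonormality of \<phi> and the preceding duality, the means of the estimator under
  \<open>u\<close> and \<open>v\<close> are exactly as far apart as the projections of
  \<open>u\<close> and \<open>v\<close>.\<close>

lemma norm_proj_proj_diff:
  "norm (proj_upto \<phi> k (proj_upto e r u) - proj_upto \<phi> k (proj_upto e r v))
    = L2_set (\<lambda>j. inner (G u) (inv_adjoint G (proj_upto e r (\<phi> j))) - inner (G v) (inv_adjoint G (proj_upto e r (\<phi> j)))) {..<k}"
proof -
  have on: "inner (\<phi> i) (\<phi> j) = (if i = j then 1 else 0)" for i j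
    using phi by (simp add: orthonormal_basis_def)
  let ?d = "\<lambda>j. inner (proj_upto e r u) (\<phi> j) - inner (proj_upto e r v) (\<phi> j)"
  have "proj_upto \<phi> k (proj_upto e r u) - proj_upto \<phi> k (proj_upto e r v) = (\<Sum>j<k. ?d j *\<^sub>R \<phi> j)"
    by (simp add: proj_upto_orthonormal[OF on] sum_subtractf scaleR_diff_left)
  moreover have "(norm (\<Sum>j<k. ?d j *\<^sub>R \<phi> j))\<^sup>2 = (\<Sum>j<k. (?d j)\<^sup>2)"
    unfolding power2_norm_eq_inner
    by (simp add: inner_sum_left inner_sum_right on power2_eq_square if_distrib[of "(*) _"] cong: if_cong)
  ultimately show ?thesis
    by (simp add: L2_set_def inner_inv_adjoint_proj real_sqrt_unique flip: real_sqrt_abs)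
qed

end

end

section \<open>Evidence, numerator and tests for the posterior\<close>

locale bayes_model = regression_model \<zeta> b G N L n
  for \<zeta> :: "'b::{real_inner, complete_space} \<Rightarrow> 'b" and b
    and G :: "'a::{real_inner, second_countable_topology} \<Rightarrow> 'b" and N L n +
  fixes \<mu> :: "'a measure"
  assumes functional_meas: "(\<lambda>(y, u). L y (G u)) \<in> borel_measurable (seq_space \<Otimes>\<^sub>M borel)"
    and prob_prior: "prob_space \<mu>" and sets_prior[measurable_cong]: "sets \<mu> = sets borel"
begin

interpretation T: bounded_linear T by (rule T_bounded_linear)
interpretation G: bounded_linear G by (rule G)
interpretation prior: prob_space \<mu> by (rule prob_prior)

text \<open>Completing the square, the expression in \<open>z\<close> equals |A u|^2 - |A u - T
  z|^2, and the range of \<open>T\<close> is dense, so |A u|^2 is the supremum over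
  \<open>z\<close>. Each expression is continuous in \<open>u\<close>, hence the sublevel sets of |A
  u| are closed.\<close>

lemma norm_A_le_iff: "norm (A u) \<le> c \<longleftrightarrow> 0 \<le> c \<and> (\<forall>z. 2 * inner (G u) z - (norm (T z))\<^sup>2 \<le> c\<^sup>2)"
proof -
  have eq: "2 * inner (G u) z - (norm (T z))\<^sup>2 = (norm (A u))\<^sup>2 - (norm (A u - T z))\<^sup>2" for z
    using T_sym[of "A u" z] by (simp add: T_A power2_norm_eq_inner inner_diff inner_commute)
  show ?thesis
  proof (intro iffI conjI allI)
    assume le: "norm (A u) \<le> c"
    then show "0 \<le> c" using norm_ge_zero order_trans by blast
    fix z
    show "2 * inner (G u) z - (norm (T z))\<^sup>2 \<le> c\<^sup>2"
      unfolding eq using power_mono[OF le norm_ge_zero, of 2] zero_le_power2[of "norm (A u - T z)"] by linarith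
  next
    assume *: "0 \<le> c \<and> (\<forall>z. 2 * inner (G u) z - (norm (T z))\<^sup>2 \<le> c\<^sup>2)"
    obtain z where "(\<lambda>j. T (z j)) \<longlonglongrightarrow> A u" using ex_span_approx by blast
    then have "(\<lambda>j. (norm (A u))\<^sup>2 - (norm (A u - T (z j)))\<^sup>2) \<longlonglongrightarrow> (norm (A u))\<^sup>2 - (norm (A u - A u))\<^sup>2"
      by (intro tendsto_intros)
    moreover have "(norm (A u))\<^sup>2 - (norm (A u - T (z j)))\<^sup>2 \<le> c\<^sup>2" for j
      using * by (simp only: flip: eq)
    ultimately have "(norm (A u))\<^sup>2 - (norm (A u - A u))\<^sup>2 \<le> c\<^sup>2"
      by (intro LIMSEQ_le_const2) auto
    then have "(norm (A u))\<^sup>2 \<le> c\<^sup>2" by simp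
    then show "norm (A u) \<le> c" by (rule power2_le_imp_le) (use * in blast)
  qed
qed

lemma closed_norm_A_le: "closed {u. norm (A u - A v) \<le> c}"
proof (cases "0 \<le> c")
  case True
  have "{u. norm (A u - A v) \<le> c} = (\<Inter>z. {u. 2 * inner (G (u - v)) z - (norm (T z))\<^sup>2 \<le> c\<^sup>2})"
    using True by (auto simp: norm_A_le_iff simp flip: A_diff)
  also have "closed \<dots>"
    by (intro closed_INT ballI closed_Collect_le continuous_intros G.continuous_on)
  finally show ?thesis .
next
  case False
  then have "\<not> norm x \<le> c" for x :: 'b using norm_ge_zero[of x] by linarith
  then show ?thesis by simp
qed

lemma norm_A_measurable: "(\<lambda>u. norm (A u)) \<in> borel_measurable borel"
proof (subst borel_measurable_iff_le, intro allI)
  have "A 0 = 0" using A_diff[of 0 0] by simp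
  then show "{w \<in> space borel. norm (A w) \<le> a} \<in> sets borel" for a
    using closed_norm_A_le[of 0 a] by simp
qed

lemma tilt_A_eq: "exp (- neg_log_lik G \<zeta> L n y u) = tilt (A u) y"
  by (simp add: neg_log_lik_def tilt_def W_def T_A cm_norm_G)

lemma tilt_A_measurable: "(\<lambda>(y, u). tilt (A u) y) \<in> borel_measurable (Q \<Otimes>\<^sub>M \<mu>)"
proof -
  note [measurable] = norm_A_measurable functional_meas
  have "(\<lambda>(y, u). exp (real n * L y (G u) - real n * (norm (A u))\<^sup>2 / 2)) \<in> borel_measurable (seq_space \<Otimes>\<^sub>M borel)"
    by measurable
  moreover have "sets (Q \<Otimes>\<^sub>M \<mu>) = sets (seq_space \<Otimes>\<^sub>M borel)"
    by (intro sets_pair_measure_cong sets_data_law sets_prior)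
  ultimately show ?thesis
    unfolding tilt_def W_def T_A by (simp cong: measurable_cong_sets)
qed

lemma tilt_A_measurable_u: "(\<lambda>u. tilt (A u) y) \<in> borel_measurable \<mu>"
  using measurable_Pair2[OF tilt_A_measurable, of y] by (simp add: space_data_law)

interpretation QP: pair_sigma_finite Q \<mu> ..

text \<open>Let \<open>K\<close> be the integral over \<open>B\<close> of the ratio of the density
  at \<open>u0\<close> to that at \<open>u\<close>. On the bad event \<open>E\<close> it is at least
  \<open>\<beta>\<^sup>2 / c\<close>, while its mean under the data law at \<open>u0\<close> is at
  most \<open>\<beta> * exp (real n * \<epsilon>\<^sup>2)\<close>; Markov's inequality
  concludes.\<close>

lemma evidence_lower_bound:
  assumes c: "c > 0" and \<beta>: "measure \<mu> {u. norm (A u - A u0) \<le> \<epsilon>} = \<beta>" "\<beta> > 0"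
  defines "B \<equiv> {u. norm (A u - A u0) \<le> \<epsilon>}"
  defines "E \<equiv> {y. (\<integral>\<^sup>+u. indicator B u * ennreal (tilt (A u) y) \<partial>\<mu>) < ennreal (c * tilt (A u0) y)}"
  shows "E \<in> sets Q" "emeasure (data_law b G N u0 n) E \<le> ennreal (c / \<beta> * exp (real n * \<epsilon>\<^sup>2))"
proof -
  have B[measurable]: "B \<in> sets \<mu>" unfolding B_def sets_prior by (rule borel_closed[OF closed_norm_A_le])
  have [measurable]: "B \<in> sets borel" using B by (simp add: sets_prior)
  note [measurable] = tilt_A_measurable tilt_A_measurable_u
  have "{y \<in> space Q. (\<integral>\<^sup>+u. indicator B u * ennreal (tilt (A u) y) \<partial>\<mu>) < ennreal (c * tilt (A u0) y)} \<in> sets Q"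
    by measurable
  then show E[measurable]: "E \<in> sets Q" by (simp add: E_def space_data_law)
  define K where "K y = (\<integral>\<^sup>+u. indicator B u * ennreal (tilt (A u0) y / tilt (A u) y) \<partial>\<mu>)" for y
  have [measurable]: "K \<in> borel_measurable Q" unfolding K_def by measurable
  have emB: "emeasure \<mu> B = ennreal \<beta>" using \<beta>(1) by (simp add: prior.emeasure_eq_measure B_def)
  have KE: "ennreal \<beta> \<le> ennreal (c / \<beta>) * K y" if "y \<in> E" for y
  proof (rule ccontr)
    assume "\<not> ennreal \<beta> \<le> ennreal (c / \<beta>) * K y"
    then have K_less: "ennreal (c / \<beta>) * K y < ennreal \<beta>" by simp
    \<comment> \<open>This scaling turns the threshold of \<open>E\<close> into \<beta>, and it
      makes \<open>(c / \<beta>) * (tilt (A u0) y / f)\<close> the reciprocal of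
      \<open>q * f\<close>. Integrating x + 1 / x >= 2 over \<open>B\<close> then contradicts two
      terms both below \<beta>.\<close>
    define q where "q = \<beta> / (c * tilt (A u0) y)"
    have q: "q > 0" using c \<beta>(2) tilt_pos[of "A u0" y] by (simp add: q_def)
    have D_less: "ennreal q * (\<integral>\<^sup>+u. indicator B u * ennreal (tilt (A u) y) \<partial>\<mu>) < ennreal \<beta>"
    proof -
      have "ennreal q * (\<integral>\<^sup>+u. indicator B u * ennreal (tilt (A u) y) \<partial>\<mu>) < ennreal q * ennreal (c * tilt (A u0) y)"
        using that q by (intro ennreal_mult_strict_left_mono) (auto simp: E_def)
      also have "\<dots> = ennreal \<beta>"
        using c q tilt_pos[of "A u0" y] by (simp add: q_def flip: ennreal_mult)
      finally show ?thesis .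
    qed
    have amgm: "2 \<le> q * f + (c / \<beta>) * (tilt (A u0) y / f)" if f: "f > 0" for f
    proof -
      have qf: "q * f > 0" using q f by simp
      have "(c / \<beta>) * (tilt (A u0) y / f) = 1 / (q * f)" using c \<beta>(2) by (simp add: q_def)
      moreover have "2 \<le> x + 1 / x" if "x > 0" for x :: real
        using that zero_le_power2[of "x - 1"] by (simp add: power2_eq_square field_simps)
      ultimately show ?thesis using qf by metis
    qed
    have "2 * ennreal \<beta> = (\<integral>\<^sup>+u. indicator B u * 2 \<partial>\<mu>)"
      by (simp add: nn_integral_multc emB mult.commute)
    also have "\<dots> \<le> (\<integral>\<^sup>+u. ennreal q * (indicator B u * ennreal (tilt (A u) y))
        + ennreal (c / \<beta>) * (indicator B u * ennreal (tilt (A u0) y / tilt (A u) y)) \<partial>\<mu>)"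
    proof (rule nn_integral_mono)
      fix u
      have "ennreal 2 \<le> ennreal (q * tilt (A u) y + (c / \<beta>) * (tilt (A u0) y / tilt (A u) y))"
        by (intro ennreal_leI amgm tilt_pos)
      also have "\<dots> = ennreal q * ennreal (tilt (A u) y) + ennreal (c / \<beta>) * ennreal (tilt (A u0) y / tilt (A u) y)"
        using q c \<beta>(2) tilt_pos[of "A u" y] tilt_pos[of "A u0" y] by (simp flip: ennreal_mult ennreal_plus)
      finally show "indicator B u * 2 \<le> ennreal q * (indicator B u * ennreal (tilt (A u) y))
        + ennreal (c / \<beta>) * (indicator B u * ennreal (tilt (A u0) y / tilt (A u) y))"
        by (auto simp: indicator_def)
    qed
    also have "\<dots> = ennreal q * (\<integral>\<^sup>+u. indicator B u * ennreal (tilt (A u) y) \<partial>\<mu>) + ennreal (c / \<beta>) * K y"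
      unfolding K_def by (subst nn_integral_add) (simp_all add: nn_integral_cmult)
    also have "\<dots> < ennreal \<beta> + ennreal \<beta>" by (rule add_strict_mono[OF D_less K_less])
    finally show False by (simp add: mult_2)
  qed
  have "emeasure (data_law b G N u0 n) E = (\<integral>\<^sup>+y. ennreal (tilt (A u0) y) * indicator E y \<partial>Q)"
    unfolding data_law_eq_density[of u0] by (rule emeasure_density) measurable
  also have "\<dots> \<le> (\<integral>\<^sup>+y. ennreal (c / \<beta>\<^sup>2) * (ennreal (tilt (A u0) y) * K y) \<partial>Q)"
  proof (rule nn_integral_mono)
    fix y
    have "1 \<le> ennreal (c / \<beta>\<^sup>2) * K y" if "y \<in> E"
    proof -
      have "1 = ennreal (1 / \<beta>) * ennreal \<beta>" using \<beta>(2) by (simp flip: ennreal_mult)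
      also have "\<dots> \<le> ennreal (1 / \<beta>) * (ennreal (c / \<beta>) * K y)" by (intro mult_left_mono KE that) simp
      also have "\<dots> = ennreal (c / \<beta>\<^sup>2) * K y"
        using c \<beta>(2) by (simp add: power2_eq_square flip: mult.assoc ennreal_mult)
      finally show ?thesis .
    qed
    then have "ennreal (tilt (A u0) y) * indicator E y \<le> ennreal (tilt (A u0) y) * (ennreal (c / \<beta>\<^sup>2) * K y)"
      by (intro mult_left_mono) (auto simp: indicator_def)
    then show "ennreal (tilt (A u0) y) * indicator E y \<le> ennreal (c / \<beta>\<^sup>2) * (ennreal (tilt (A u0) y) * K y)"
      by (simp add: mult_ac)
  qed
  also have "\<dots> = ennreal (c / \<beta>\<^sup>2) * (\<integral>\<^sup>+y. ennreal (tilt (A u0) y) * K y \<partial>Q)"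
    by (rule nn_integral_cmult) measurable
  also have "(\<integral>\<^sup>+y. ennreal (tilt (A u0) y) * K y \<partial>Q)
      = (\<integral>\<^sup>+y. \<integral>\<^sup>+u. indicator B u * ennreal (tilt (A u0) y * (tilt (A u0) y / tilt (A u) y)) \<partial>\<mu> \<partial>Q)"
  proof (rule nn_integral_cong)
    fix y
    have "ennreal (tilt (A u0) y) * K y
        = (\<integral>\<^sup>+u. ennreal (tilt (A u0) y) * (indicator B u * ennreal (tilt (A u0) y / tilt (A u) y)) \<partial>\<mu>)"
      unfolding K_def by (rule nn_integral_cmult[symmetric]) measurable
    also have "\<dots> = (\<integral>\<^sup>+u. indicator B u * ennreal (tilt (A u0) y * (tilt (A u0) y / tilt (A u) y)) \<partial>\<mu>)"
      using tilt_pos[THEN less_imp_le]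
      by (intro nn_integral_cong, subst ennreal_mult) (simp_all only: divide_nonneg_nonneg mult_ac)
    finally show "ennreal (tilt (A u0) y) * K y
        = (\<integral>\<^sup>+u. indicator B u * ennreal (tilt (A u0) y * (tilt (A u0) y / tilt (A u) y)) \<partial>\<mu>)" .
  qed
  also have "\<dots> = (\<integral>\<^sup>+u. \<integral>\<^sup>+y. indicator B u * ennreal (tilt (A u0) y * (tilt (A u0) y / tilt (A u) y)) \<partial>Q \<partial>\<mu>)"
    by (rule QP.Fubini'[symmetric]) measurable
  also have "\<dots> = (\<integral>\<^sup>+u. indicator B u * ennreal (exp (real n * (norm (A u0 - A u))\<^sup>2)) \<partial>\<mu>)"
    by (intro nn_integral_cong, subst nn_integral_cmult) (measurable, simp only: nn_integral_tilt_ratio)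
  also have "\<dots> \<le> (\<integral>\<^sup>+u. indicator B u * ennreal (exp (real n * \<epsilon>\<^sup>2)) \<partial>\<mu>)"
  proof (rule nn_integral_mono)
    fix u
    have "(norm (A u0 - A u))\<^sup>2 \<le> \<epsilon>\<^sup>2" if "u \<in> B"
      using that by (intro power_mono) (simp_all add: B_def norm_minus_commute)
    then show "indicator B u * ennreal (exp (real n * (norm (A u0 - A u))\<^sup>2)) \<le> indicator B u * ennreal (exp (real n * \<epsilon>\<^sup>2))"
      by (auto simp: indicator_def intro!: ennreal_leI mult_left_mono)
  qed
  also have "\<dots> = ennreal \<beta> * ennreal (exp (real n * \<epsilon>\<^sup>2))"
    by (simp add: nn_integral_multc emB)
  finally have "emeasure (data_law b G N u0 n) E \<le> ennreal (c / \<beta>\<^sup>2) * (ennreal \<beta> * ennreal (exp (real n * \<epsilon>\<^sup>2)))"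
    by (simp add: mult_left_mono)
  also have "\<dots> = ennreal (c / \<beta> * exp (real n * \<epsilon>\<^sup>2))"
    using c \<beta>(2) by (simp add: power2_eq_square flip: ennreal_mult)
  finally show "emeasure (data_law b G N u0 n) E \<le> ennreal (c / \<beta> * exp (real n * \<epsilon>\<^sup>2))" .
qed

text \<open>On \<open>S\<close> the density at \<open>u0\<close> is less than the numerator divided
  by \<open>c\<close>, so the probability of \<open>S\<close> is at most 1 / c times the integral of
  the numerator off \<open>R\<close>. Fubini rewrites the latter as a prior average of acceptance
  probabilities, at most \<open>p\<close> on the sieve and at most 1 outside it.\<close>

lemma numerator_bound:
  fixes u0 :: 'a
  assumes c: "c > 0" and R: "R \<in> sets seq_space" and U: "U \<in> sets borel" and F: "F \<in> sets borel"
    and type2: "\<And>u. u \<in> U \<Longrightarrow> u \<in> F \<Longrightarrow> (\<integral>\<^sup>+y. ennreal (tilt (A u) y) * indicator (- R) y \<partial>Q) \<le> ennreal p"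
    and p: "p \<ge> 0" and sieve: "measure \<mu> (- F) \<le> q"
  defines "S \<equiv> {y. y \<notin> R \<and> ennreal (c * tilt (A u0) y) < (\<integral>\<^sup>+u. indicator U u * ennreal (tilt (A u) y) \<partial>\<mu>)}"
  shows "S \<in> sets Q" "emeasure (data_law b G N u0 n) S \<le> ennreal ((p + q) / c)"
proof -
  have q: "q \<ge> 0" using sieve measure_nonneg order_trans by blast
  note [measurable] = tilt_A_measurable tilt_A_measurable_u U F
  have R'[measurable]: "R \<in> sets Q" using R by (simp add: sets_data_law)
  have nR[measurable]: "- R \<in> sets Q" using sets.compl_sets[OF R'] by (simp add: space_data_law Compl_eq_Diff_UNIV)
  have [measurable]: "U \<in> sets \<mu>" "F \<in> sets \<mu>" using U F by (simp_all add: sets_prior)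
  have "{y \<in> space Q. y \<notin> R \<and> ennreal (c * tilt (A u0) y) < (\<integral>\<^sup>+u. indicator U u * ennreal (tilt (A u) y) \<partial>\<mu>)} \<in> sets Q"
    by measurable
  then show [measurable]: "S \<in> sets Q" by (simp add: S_def space_data_law)
  have "emeasure (data_law b G N u0 n) S = (\<integral>\<^sup>+y. ennreal (tilt (A u0) y) * indicator S y \<partial>Q)"
    unfolding data_law_eq_density[of u0] by (rule emeasure_density) measurable
  also have "\<dots> \<le> (\<integral>\<^sup>+y. ennreal (1 / c) * (\<integral>\<^sup>+u. indicator U u * (ennreal (tilt (A u) y) * indicator (- R) y) \<partial>\<mu>) \<partial>Q)"
  proof (rule nn_integral_mono)
    fix y
    have "ennreal (tilt (A u0) y) \<le> ennreal (1 / c) * (\<integral>\<^sup>+u. indicator U u * (ennreal (tilt (A u) y) * indicator (- R) y) \<partial>\<mu>)" if "y \<in> S"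
    proof -
      have "ennreal (tilt (A u0) y) = ennreal (1 / c) * ennreal (c * tilt (A u0) y)"
        using c tilt_pos[of "A u0" y] by (simp flip: ennreal_mult)
      also have "\<dots> \<le> ennreal (1 / c) * (\<integral>\<^sup>+u. indicator U u * ennreal (tilt (A u) y) \<partial>\<mu>)"
        using that by (intro mult_left_mono) (auto simp: S_def)
      finally show ?thesis using that by (simp add: S_def)
    qed
    then show "ennreal (tilt (A u0) y) * indicator S y
        \<le> ennreal (1 / c) * (\<integral>\<^sup>+u. indicator U u * (ennreal (tilt (A u) y) * indicator (- R) y) \<partial>\<mu>)"
      by (auto simp: indicator_def)
  qed
  also have "\<dots> = ennreal (1 / c) * (\<integral>\<^sup>+y. \<integral>\<^sup>+u. indicator U u * (ennreal (tilt (A u) y) * indicator (- R) y) \<partial>\<mu> \<partial>Q)"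
    by (rule nn_integral_cmult) measurable
  also have "(\<integral>\<^sup>+y. \<integral>\<^sup>+u. indicator U u * (ennreal (tilt (A u) y) * indicator (- R) y) \<partial>\<mu> \<partial>Q)
      = (\<integral>\<^sup>+u. \<integral>\<^sup>+y. indicator U u * (ennreal (tilt (A u) y) * indicator (- R) y) \<partial>Q \<partial>\<mu>)"
    by (rule QP.Fubini'[symmetric]) measurable
  also have "\<dots> = (\<integral>\<^sup>+u. indicator U u * (\<integral>\<^sup>+y. ennreal (tilt (A u) y) * indicator (- R) y \<partial>Q) \<partial>\<mu>)"
    by (intro nn_integral_cong nn_integral_cmult) measurable
  also have "\<dots> \<le> (\<integral>\<^sup>+u. ennreal p + indicator (- F) u \<partial>\<mu>)"
  proof (rule nn_integral_mono)
    fix u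
    have "(\<integral>\<^sup>+y. ennreal (tilt (A u) y) * indicator (- R) y \<partial>Q) \<le> (\<integral>\<^sup>+y. ennreal (tilt (A u) y) \<partial>Q)"
      by (intro nn_integral_mono) (auto simp: indicator_def)
    also have "\<dots> = 1" by (rule nn_integral_tilt)
    also have "1 \<le> ennreal p + 1" by simp
    finally show "indicator U u * (\<integral>\<^sup>+y. ennreal (tilt (A u) y) * indicator (- R) y \<partial>Q) \<le> ennreal p + indicator (- F) u"
      using type2[of u] by (auto simp: indicator_def)
  qed
  also have "\<dots> = ennreal p + emeasure \<mu> (- F)"
    using F by (subst nn_integral_add) (simp_all add: prior.emeasure_space_1 sets_prior)
  also have "\<dots> \<le> ennreal (p + q)"
    using p q sieve by (simp add: prior.emeasure_eq_measure ennreal_leI)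
  finally have "emeasure (data_law b G N u0 n) S \<le> ennreal (1 / c) * ennreal (p + q)"
    by (simp add: mult_left_mono)
  also have "ennreal (1 / c) * ennreal (p + q) = ennreal ((p + q) / c)"
    using c p q by (subst ennreal_mult[symmetric]) simp_all
  finally show "emeasure (data_law b G N u0 n) S \<le> ennreal ((p + q) / c)" .
qed

text \<open>If the evidence is at least c times the density at \<open>u0\<close> and the numerator
  at most \<delta> c times it, their quotient is at most \<delta>. The bad event is thus covered by
  rejection, small evidence and large numerator.\<close>

lemma posterior_tail_bound:
  assumes c: "c > 0" and \<beta>: "measure \<mu> {u. norm (A u - A u0) \<le> \<epsilon>} = \<beta>" "\<beta> > 0"
    and R: "R \<in> sets seq_space" and U: "U \<in> sets borel" and F: "F \<in> sets borel"
    and type1: "emeasure (data_law b G N u0 n) R \<le> ennreal p1" "p1 \<ge> 0"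
    and type2: "\<And>u. u \<in> U \<Longrightarrow> u \<in> F \<Longrightarrow> (\<integral>\<^sup>+y. ennreal (tilt (A u) y) * indicator (- R) y \<partial>Q) \<le> ennreal p2"
    and p2: "p2 \<ge> 0" and sieve: "measure \<mu> (- F) \<le> p3" and \<delta>: "\<delta> > 0"
  shows "measure (data_law b G N u0 n) {y. posterior G \<zeta> L \<mu> n y U > \<delta>}
    \<le> p1 + c / \<beta> * exp (real n * \<epsilon>\<^sup>2) + (p2 + p3) / (\<delta> * c)"
proof -
  interpret P: prob_space "data_law b G N u0 n" by (rule prob_data_law)
  have p3: "p3 \<ge> 0" using sieve measure_nonneg order_trans by blast
  note [measurable] = tilt_A_measurable_u
  let ?B = "{u. norm (A u - A u0) \<le> \<epsilon>}"
  let ?E = "{y. (\<integral>\<^sup>+u. indicator ?B u * ennreal (tilt (A u) y) \<partial>\<mu>) < ennreal (c * tilt (A u0) y)}"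
  let ?S = "{y. y \<notin> R \<and> ennreal ((\<delta> * c) * tilt (A u0) y) < (\<integral>\<^sup>+u. indicator U u * ennreal (tilt (A u) y) \<partial>\<mu>)}"
  have dc: "\<delta> * c > 0" using \<delta> c by simp
  note E = evidence_lower_bound[OF c \<beta>]
  note S = numerator_bound[OF dc R U F type2 p2 sieve, where ?u0.0 = u0]
  have [measurable]: "U \<in> sets \<mu>" using U by (simp add: sets_prior)
  have sub: "{y. posterior G \<zeta> L \<mu> n y U > \<delta>} \<subseteq> R \<union> (?E \<union> ?S)"
  proof (rule subsetI, rule ccontr)
    fix y assume y: "y \<in> {y. posterior G \<zeta> L \<mu> n y U > \<delta>}" and not: "y \<notin> R \<union> (?E \<union> ?S)"
    let ?f = "\<lambda>u. tilt (A u) y"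
    have post: "posterior G \<zeta> L \<mu> n y U = (\<integral>u. indicator U u * ?f u \<partial>\<mu>) / (\<integral>u. ?f u \<partial>\<mu>)"
      by (simp add: posterior_def tilt_A_eq set_lebesgue_integral_def)
    have f0: "0 \<le> ?f u" for u using tilt_pos[of "A u" y] by simp
    \<comment> \<open>A non-integrable likelihood has Bochner integral 0, and division by zero makes
      the posterior 0; a value above \<delta> therefore guarantees integrability.\<close>
    have D: "(\<integral>u. ?f u \<partial>\<mu>) \<noteq> 0" using y \<delta> by (auto simp: post)
    then have int: "integrable \<mu> ?f" using not_integrable_integral_eq by blast
    have D_pos: "(\<integral>u. ?f u \<partial>\<mu>) > 0"
      using D Bochner_Integration.integral_nonneg[of \<mu> ?f] f0 by (simp add: less_le)
    have intU: "integrable \<mu> (\<lambda>u. indicator U u * ?f u)"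
      using integrable_mult_indicator[OF _ int, of U] by simp
    have "ennreal (c * tilt (A u0) y) \<le> (\<integral>\<^sup>+u. indicator ?B u * ennreal (?f u) \<partial>\<mu>)"
      using not by auto
    also have "\<dots> \<le> (\<integral>\<^sup>+u. ennreal (?f u) \<partial>\<mu>)"
      by (intro nn_integral_mono) (auto simp: indicator_def)
    also have "\<dots> = ennreal (\<integral>u. ?f u \<partial>\<mu>)" using int f0 by (simp add: nn_integral_eq_integral)
    finally have "c * tilt (A u0) y \<le> (\<integral>u. ?f u \<partial>\<mu>)" using D_pos by (simp add: ennreal_le_iff)
    then have "\<delta> * c * tilt (A u0) y \<le> \<delta> * (\<integral>u. ?f u \<partial>\<mu>)" using \<delta> by (simp add: mult.assoc)
    also have "\<dots> < (\<integral>u. indicator U u * ?f u \<partial>\<mu>)" using y D_pos by (simp add: post less_divide_eq)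
    finally have "ennreal (\<delta> * c * tilt (A u0) y) < ennreal (\<integral>u. indicator U u * ?f u \<partial>\<mu>)"
      using dc f0[of u0] by (intro ennreal_lessI) (auto intro: le_less_trans[rotated])
    also have "\<dots> = (\<integral>\<^sup>+u. ennreal (indicator U u * ?f u) \<partial>\<mu>)"
      using intU f0 by (intro nn_integral_eq_integral[symmetric]) auto
    also have "\<dots> = (\<integral>\<^sup>+u. indicator U u * ennreal (?f u) \<partial>\<mu>)"
      by (intro nn_integral_cong) (auto simp: indicator_def)
    finally show False using not by auto
  qed
  have R': "R \<in> sets Q" using R by (simp add: sets_data_law)
  have sets_eq: "sets (data_law b G N u0 n) = sets Q" by (simp add: sets_data_law)
  \<comment> \<open>Monotonicity asks for measurability of the covering event only.\<close>
  have "emeasure (data_law b G N u0 n) {y. posterior G \<zeta> L \<mu> n y U > \<delta>}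
      \<le> emeasure (data_law b G N u0 n) (R \<union> (?E \<union> ?S))"
    using sub R' E(1) S(1) by (intro emeasure_mono) (auto simp: sets_eq intro!: sets.Un)
  also have "\<dots> \<le> emeasure (data_law b G N u0 n) R + emeasure (data_law b G N u0 n) (?E \<union> ?S)"
    using R' E(1) S(1) by (intro emeasure_subadditive) (auto simp: sets_eq intro!: sets.Un)
  also have "\<dots> \<le> emeasure (data_law b G N u0 n) R + (emeasure (data_law b G N u0 n) ?E + emeasure (data_law b G N u0 n) ?S)"
    using E(1) S(1) by (intro add_left_mono emeasure_subadditive) (simp_all add: sets_eq)
  also have "\<dots> \<le> ennreal p1 + (ennreal (c / \<beta> * exp (real n * \<epsilon>\<^sup>2)) + ennreal ((p2 + p3) / (\<delta> * c)))"
    by (intro add_mono type1(1) E(2) S(2))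
  also have "\<dots> = ennreal (p1 + c / \<beta> * exp (real n * \<epsilon>\<^sup>2) + (p2 + p3) / (\<delta> * c))"
    using type1(2) c \<beta>(2) p2 p3 dc by (simp add: add.assoc flip: ennreal_plus)
  finally have "ennreal (P.prob {y. posterior G \<zeta> L \<mu> n y U > \<delta>})
      \<le> ennreal (p1 + c / \<beta> * exp (real n * \<epsilon>\<^sup>2) + (p2 + p3) / (\<delta> * c))"
    unfolding P.emeasure_eq_measure .
  moreover have "0 \<le> p1 + c / \<beta> * exp (real n * \<epsilon>\<^sup>2) + (p2 + p3) / (\<delta> * c)"
    using type1(2) c \<beta>(2) p2 p3 \<delta> by simp
  ultimately show ?thesis by (simp only: ennreal_le_iff)
qed

text \<open>The test rejects \<open>u0\<close> when the spectral estimator, whose coordinates are the values of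
  \<open>W (x j)\<close>, lies far from its mean under \<open>u0\<close>.\<close>

lemma posterior_contraction_bound:
  fixes x :: "nat \<Rightarrow> 'b"
  assumes \<gamma>: "\<gamma> > 0" and x: "\<And>c. (norm (\<Sum>j<k. c j *\<^sub>R x j))\<^sup>2 \<le> \<gamma> * (\<Sum>j<k. (c j)\<^sup>2)"
    and t: "t > 0"
    and U: "U \<in> sets borel" and F: "F \<in> sets borel"
    and sep: "\<And>u. u \<in> U \<Longrightarrow> u \<in> F \<Longrightarrow> 2 * t \<le> L2_set (\<lambda>j. inner (A u) (x j) - inner (A u0) (x j)) {..<k}"
    and c: "c > 0" and \<beta>: "measure \<mu> {u. norm (A u - A u0) \<le> \<epsilon>} = \<beta>" "\<beta> > 0"
    and sieve: "measure \<mu> (- F) \<le> q" and \<delta>: "\<delta> > 0"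
  defines "p \<equiv> exp (- (real n * t\<^sup>2) / (4 * \<gamma>)) * sqrt 2 ^ k"
  shows "measure (data_law b G N u0 n) {y. posterior G \<zeta> L \<mu> n y U > \<delta>}
    \<le> p + c / \<beta> * exp (real n * \<epsilon>\<^sup>2) + (p + q) / (\<delta> * c)"
proof (rule posterior_tail_bound[OF c \<beta> _ U F])
  let ?S = "\<lambda>u y. \<Sum>j<k. (W (x j) y - real n * inner (A u) (x j))\<^sup>2"
  let ?R = "{y. (real n * t)\<^sup>2 \<le> ?S u0 y}"
  \<comment> \<open>Under the data law at \<open>u\<close> the mean of \<open>W (x j)\<close> is n
    times the inner product, so a distance \<open>t\<close> of the estimator corresponds to n t
    here, and (n t)^2 / (4 n \<gamma>) = n t^2 / (4 \<gamma>).\<close>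
  have p_eq: "p = exp (- (real n * t)\<^sup>2 / (4 * real n * \<gamma>)) * sqrt 2 ^ k"
    using n by (simp add: p_def power2_eq_square)
  have tail: "(\<integral>\<^sup>+y. ennreal (tilt (A u) y) * indicator {y. (real n * t)\<^sup>2 \<le> ?S u y} y \<partial>Q) \<le> ennreal p" for u
    unfolding p_eq by (rule tilt_squares_tail[OF \<gamma> x])
  have "{y \<in> space Q. (real n * t)\<^sup>2 \<le> ?S u0 y} \<in> sets Q" by measurable
  then have RQ[measurable]: "?R \<in> sets Q" by (simp add: space_data_law)
  then show "?R \<in> sets seq_space" by (simp add: sets_data_law)
  have "emeasure (data_law b G N u0 n) ?R = (\<integral>\<^sup>+y. ennreal (tilt (A u0) y) * indicator ?R y \<partial>Q)"
    unfolding data_law_eq_density[of u0] by (rule emeasure_density) measurable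
  also note tail
  finally show "emeasure (data_law b G N u0 n) ?R \<le> ennreal p" .
  fix u assume u: "u \<in> U" "u \<in> F"
  \<comment> \<open>The means under \<open>u\<close> and \<open>u0\<close> are at least 2 n t apart,
    so an observation within n t of one is at least n t away from the other. Both error types reduce
    to the same tail bound.\<close>
  have "- ?R \<subseteq> {y. (real n * t)\<^sup>2 \<le> ?S u y}"
  proof
    fix y assume "y \<in> - ?R"
    then have "L2_set (\<lambda>j. W (x j) y - real n * inner (A u0) (x j)) {..<k} < sqrt ((real n * t)\<^sup>2)"
      unfolding L2_set_def by (intro real_sqrt_less_mono) simp
    then have near: "L2_set (\<lambda>j. W (x j) y - real n * inner (A u0) (x j)) {..<k} < real n * t" using t by simp
    have "real n * (2 * t) \<le> real n * L2_set (\<lambda>j. inner (A u) (x j) - inner (A u0) (x j)) {..<k}"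
      by (intro mult_left_mono sep u) simp
    also have "\<dots> = L2_set (\<lambda>j. real n * (inner (A u) (x j) - inner (A u0) (x j))) {..<k}"
      by (rule L2_set_right_distrib) simp
    also have "\<dots> = L2_set (\<lambda>j. (W (x j) y - real n * inner (A u0) (x j)) + (real n * inner (A u) (x j) - W (x j) y)) {..<k}"
      by (simp add: algebra_simps)
    also have "\<dots> \<le> L2_set (\<lambda>j. W (x j) y - real n * inner (A u0) (x j)) {..<k}
        + L2_set (\<lambda>j. real n * inner (A u) (x j) - W (x j) y) {..<k}"
      by (rule L2_set_triangle_ineq)
    also have "L2_set (\<lambda>j. real n * inner (A u) (x j) - W (x j) y) {..<k} = sqrt (?S u y)"
      unfolding L2_set_def by (simp add: power2_commute)
    finally have "real n * t \<le> sqrt (?S u y)" using near by simp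
    then have "(real n * t)\<^sup>2 \<le> (sqrt (?S u y))\<^sup>2" using t by (intro power_mono) auto
    then show "y \<in> {y. (real n * t)\<^sup>2 \<le> ?S u y}" by (simp add: sum_nonneg)
  qed
  then have "(\<integral>\<^sup>+y. ennreal (tilt (A u) y) * indicator (- ?R) y \<partial>Q)
      \<le> (\<integral>\<^sup>+y. ennreal (tilt (A u) y) * indicator {y. (real n * t)\<^sup>2 \<le> ?S u y} y \<partial>Q)"
    by (intro nn_integral_mono mult_left_mono) (auto simp: indicator_def)
  also note tail
  finally show "(\<integral>\<^sup>+y. ennreal (tilt (A u) y) * indicator (- ?R) y \<partial>Q) \<le> ennreal p" .
qed (simp_all add: p_def sieve \<delta>)

end

section \<open>Choice of the constants and passage to the limit\<close>

theorem lemma3p9: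
  fixes G :: "'a::{real_inner, polish_space} \<Rightarrow> 'b::{real_inner, polish_space}"
    and \<zeta> :: "'b \<Rightarrow> 'b"
    and b :: "nat \<Rightarrow> 'b"
    and N :: "(nat \<Rightarrow> real) measure"
    and L :: "nat \<Rightarrow> (nat \<Rightarrow> real) \<Rightarrow> 'b \<Rightarrow> real"
    and \<mu> :: "nat \<Rightarrow> 'a measure"
    and u0 :: 'a
    and e \<phi> :: "nat \<Rightarrow> 'a"
    and \<rho> :: "nat \<Rightarrow> real"
    and \<epsilon> \<xi> :: "nat \<Rightarrow> real"
    and k r :: "nat \<Rightarrow> nat"
    and C C1 C2 R :: real
  assumes G: "bounded_linear G" "inj G"
    and zeta: "bounded_selfadjoint \<zeta>" "positive_definite \<zeta>"
    and range_G: "range G \<subseteq> cm_space \<zeta>"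
    and b: "orthonormal_basis b"
    and noise: "gaussian_noise b \<zeta> N"
    and functional: "\<And>n. n \<ge> 1 \<Longrightarrow> cm_functional b \<zeta> (data_law b G N 0 n) (L n)"
    and functional_meas: "\<And>n. n \<ge> 1 \<Longrightarrow>
      (\<lambda>(y, u). L n y (G u)) \<in> borel_measurable (seq_space \<Otimes>\<^sub>M borel)"
    and prior: "\<And>n. n \<ge> 1 \<Longrightarrow> prob_space (\<mu> n)" "\<And>n. n \<ge> 1 \<Longrightarrow> sets (\<mu> n) = sets borel"
    and e: "orthonormal_basis e"
    and svd: "\<And>i. adjoint G (G (e i)) = (\<rho> i)\<^sup>2 *\<^sub>R e i" "\<And>i. \<rho> i > 0"
    and phi: "orthonormal_basis \<phi>"
    and pos_seqs: "\<And>n. n \<ge> 1 \<Longrightarrow> \<epsilon> n > 0" "\<And>n. n \<ge> 1 \<Longrightarrow> \<xi> n > 0"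
      "\<And>n. n \<ge> 1 \<Longrightarrow> k n \<ge> 1" "\<And>n. n \<ge> 1 \<Longrightarrow> r n \<ge> 1"
    and pos_consts: "C > 0" "C1 > 0" "C2 > 0" "R > 0"
    and cond1: "\<epsilon> \<longlonglongrightarrow> 0" "filterlim (\<lambda>n. real n * (\<epsilon> n)\<^sup>2) at_top sequentially"
      "\<And>n. n \<ge> 1 \<Longrightarrow>
        measure (\<mu> n) {u. cm_norm \<zeta> (G u - G u0) \<le> \<epsilon> n} \<ge> exp (- C * real n * (\<epsilon> n)\<^sup>2)"
    and cond2: "filterlim r at_top sequentially"
      "\<And>n. n \<ge> 1 \<Longrightarrow> real (k n) < R * real n * (\<epsilon> n)\<^sup>2"
      "(\<lambda>n. max (\<xi> n) (1 / real (k n))) \<longlonglongrightarrow> 0"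
      "\<And>n. n \<ge> 1 \<Longrightarrow>
        measure (\<mu> n) {u. norm (proj_upto \<phi> (k n) (proj_upto e (r n) u) - u) > C2 * \<xi> n}
          \<le> exp (- (C + 4) * real n * (\<epsilon> n)\<^sup>2)"
    and cond3: "\<And>n. n \<ge> 1 \<Longrightarrow> sqrt (g_const G \<zeta> e \<phi> (k n) (r n)) \<le> C1 * \<xi> n / \<epsilon> n"
    and cond4: "(\<lambda>n. norm (proj_upto \<phi> (k n) (proj_upto e (r n) u0) - u0)) \<in> O(\<xi>)"
  shows "\<exists>M>0. \<forall>\<delta>>0.
    (\<lambda>n. measure (data_law b G N u0 n)
       {y. posterior G \<zeta> (L n) (\<mu> n) n y {u. norm (u - u0) > M * \<xi> n} > \<delta>}) \<longlonglongrightarrow> 0"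
proof -
  interpret G: bounded_linear G by fact
  obtain C4 where C4: "C4 > 0"
    and near: "\<forall>\<^sub>F n in sequentially. norm (norm (proj_upto \<phi> (k n) (proj_upto e (r n) u0) - u0)) \<le> C4 * norm (\<xi> n)"
    using cond4 by (elim landau_o.bigE)
  \<comment> \<open>Chosen so that the tail exponent n (m \<xi>)^2 / (4 \<gamma>), with \<gamma> =
    (C1 \<xi> / \<epsilon>)^2, becomes (C + 4 + R) n \<epsilon>^2.\<close>
  define m where "m = 2 * C1 * sqrt (C + 4 + R)"
  \<comment> \<open>2 m for the separation of the estimator means, C2 for the projection error of
    \<open>u\<close> on the sieve, C4 for that of \<open>u0\<close>.\<close>
  define M where "M = 2 * m + C2 + C4"
  have m: "m > 0" "m\<^sup>2 = 4 * C1\<^sup>2 * (C + 4 + R)" and M: "M > 0"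
    using pos_consts C4 by (auto simp: m_def M_def power_mult_distrib intro!: add_pos_pos mult_pos_pos)
  have svd': "inner (G (e i)) (G v) = (\<rho> i)\<^sup>2 * inner (e i) v" for i v
    using adjoint_inner[OF G(1), of v "G (e i)"] svd(1)[of i] by (simp add: inner_commute)
  note model = G e svd(2) svd' phi
  define x where "x n = real n * (\<epsilon> n)\<^sup>2" for n
  have bound: "measure (data_law b G N u0 n) {y. posterior G \<zeta> (L n) (\<mu> n) n y {u. norm (u - u0) > M * \<xi> n} > \<delta>}
      \<le> (2 + 2 / \<delta>) * exp (- x n)"
    if n: "n \<ge> 1" and \<delta>: "\<delta> > 0"
      and near_n: "norm (norm (proj_upto \<phi> (k n) (proj_upto e (r n) u0) - u0)) \<le> C4 * norm (\<xi> n)" for n \<delta>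
  proof -
    interpret bayes_model \<zeta> b G N "L n" n "\<mu> n"
      by (intro bayes_model.intro regression_model.intro covariance.intro regression_model_axioms.intro
        bayes_model_axioms.intro zeta b G(1) range_G noise functional[OF n] functional_meas[OF n]
        prior(1)[OF n] prior(2)[OF n] n)
    note pos = pos_seqs(1,2)[OF n]
    have x0: "x n \<ge> 0" by (simp add: x_def)
    let ?PP = "\<lambda>u. proj_upto \<phi> (k n) (proj_upto e (r n) u)"
    let ?w = "\<lambda>j. inv_adjoint G (proj_upto e (r n) (\<phi> j))"
    let ?U = "{u. norm (u - u0) > M * \<xi> n}"
    let ?F = "{u. norm (?PP u - u) \<le> C2 * \<xi> n}"
    define \<gamma> where "\<gamma> = (C1 * \<xi> n / \<epsilon> n)\<^sup>2"
    have \<gamma>: "\<gamma> > 0" using pos pos_consts by (simp add: \<gamma>_def)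
    have directions: "(norm (\<Sum>j<k n. c j *\<^sub>R T (?w j)))\<^sup>2 \<le> \<gamma> * (\<Sum>j<k n. (c j)\<^sup>2)" for c
      unfolding \<gamma>_def by (rule norm_inv_adjoint_proj_le[OF model cond3[OF n]])
    have PP_diff: "L2_set (\<lambda>j. inner (A u) (T (?w j)) - inner (A v) (T (?w j))) {..<k n} = norm (?PP u - ?PP v)" for u v
      unfolding norm_proj_proj_diff[OF model] by (simp add: T_A flip: T_sym)
    have sep: "2 * (m * \<xi> n) \<le> L2_set (\<lambda>j. inner (A u) (T (?w j)) - inner (A u0) (T (?w j))) {..<k n}"
      if u: "u \<in> ?U" "u \<in> ?F" for u
    proof -
      have "u - u0 = (?PP u - ?PP u0) - (?PP u - u) + (?PP u0 - u0)" by simp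
      then have "norm (u - u0) \<le> norm ((?PP u - ?PP u0) - (?PP u - u)) + norm (?PP u0 - u0)"
        using norm_triangle_ineq by metis
      also have "norm ((?PP u - ?PP u0) - (?PP u - u)) \<le> norm (?PP u - ?PP u0) + norm (?PP u - u)"
        by (rule norm_triangle_ineq4)
      finally have "M * \<xi> n < norm (?PP u - ?PP u0) + C2 * \<xi> n + C4 * \<xi> n"
        using u near_n pos by simp
      then show ?thesis unfolding PP_diff by (simp add: M_def algebra_simps)
    qed
    have cont_PP: "continuous_on UNIV ?PP"
      using continuous_on_compose2[OF continuous_on_proj_upto[OF phi] continuous_on_proj_upto[OF e]] by simp
    have U: "?U \<in> sets borel"
      by (intro borel_open open_Collect_less continuous_intros)
    have F: "?F \<in> sets borel"
      by (intro borel_closed closed_Collect_le continuous_intros cont_PP)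
    have neg_F: "- ?F = {u. norm (?PP u - u) > C2 * \<xi> n}" by auto
    define \<beta> where "\<beta> = measure (\<mu> n) {u. norm (A u - A u0) \<le> \<epsilon> n}"
    have "cm_norm \<zeta> (G u - G u0) = norm (A u - A u0)" for u
      using cm_norm_G[of "u - u0"] by (simp add: G.diff A_diff)
    then have \<beta>: "exp (- C * x n) \<le> \<beta>"
      using cond1(3)[OF n] by (simp add: \<beta>_def x_def mult.assoc)
    have \<beta>0: "\<beta> > 0" using \<beta> exp_gt_zero[of "- C * x n"] by linarith
    define c where "c = exp (- (C + 2) * x n)"
    have c: "c > 0" by (simp add: c_def)
    define p where "p = exp (- (real n * (m * \<xi> n)\<^sup>2) / (4 * \<gamma>)) * sqrt 2 ^ k n"
    define q where "q = exp (- (C + 4) * x n)"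
    have p: "p \<le> q"
    proof -
      have "real n * (m * \<xi> n)\<^sup>2 / (4 * \<gamma>) = (C + 4 + R) * x n"
        using pos pos_consts by (simp add: \<gamma>_def x_def m(2) power_mult_distrib power_divide field_simps)
      \<comment> \<open>The dimension costs at most exp (R x) because k < R x; the summand R in
        \<open>m\<close> compensates for exactly this factor.\<close>
      moreover have "sqrt 2 ^ k n \<le> exp (R * x n)"
      proof -
        have "sqrt 2 \<le> exp 1" using exp_ge_add_one_self[of 1] sqrt_le_D[of 2 2] real_sqrt_le_iff[of 2 4] by simp
        then have "sqrt 2 ^ k n \<le> exp 1 ^ k n" by (intro power_mono) auto
        also have "\<dots> = exp (real (k n))" by (simp flip: exp_of_nat_mult)
        also have "\<dots> \<le> exp (R * x n)" using cond2(2)[OF n] by (simp add: x_def mult.assoc)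
        finally show ?thesis .
      qed
      ultimately have "p \<le> exp (- ((C + 4 + R) * x n)) * exp (R * x n)"
        unfolding p_def by (simp add: mult_left_mono)
      also have "\<dots> = q" by (simp add: q_def algebra_simps flip: exp_add)
      finally show ?thesis .
    qed
    have "measure (data_law b G N u0 n) {y. posterior G \<zeta> (L n) (\<mu> n) n y ?U > \<delta>}
        \<le> p + c / \<beta> * exp (real n * (\<epsilon> n)\<^sup>2) + (p + q) / (\<delta> * c)"
      unfolding p_def
    proof (rule posterior_contraction_bound[OF \<gamma> directions _ U F sep c _ \<beta>0])
      show "m * \<xi> n > 0" using m pos by simp
      show "measure (\<mu> n) {u. norm (A u - A u0) \<le> \<epsilon> n} = \<beta>" by (simp add: \<beta>_def)
      show "measure (\<mu> n) (- ?F) \<le> q"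
        unfolding neg_F using cond2(4)[OF n] by (simp add: q_def x_def mult.assoc)
    qed (use \<delta> in auto)
    also have "\<dots> \<le> exp (- x n) + exp (- x n) + 2 * exp (- x n) / \<delta>"
    proof (intro add_mono)
      have "(C + 4) * x n \<ge> 1 * x n" using x0 pos_consts by (intro mult_right_mono) auto
      then have "- (C + 4) * x n \<le> - x n" by (simp only: mult_minus_left neg_le_iff_le mult_1)
      then have "q \<le> exp (- x n)" unfolding q_def exp_le_cancel_iff .
      then show "p \<le> exp (- x n)" using p by linarith
      \<comment> \<open>The small-ball mass is at least exp (- C x), so the quotient is at most exp
        (- 2 x); one x is then spent on the second moment factor exp x.\<close>
      have "c / \<beta> \<le> c / exp (- C * x n)" using \<beta> c by (intro divide_left_mono) (auto intro!: mult_pos_pos \<beta>0)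
      also have "\<dots> = exp (- 2 * x n)" by (simp add: c_def algebra_simps flip: exp_diff)
      finally have "c / \<beta> * exp (x n) \<le> exp (- 2 * x n) * exp (x n)" by (rule mult_right_mono) simp
      then show "c / \<beta> * exp (real n * (\<epsilon> n)\<^sup>2) \<le> exp (- x n)"
        by (simp flip: x_def exp_add)
      have "(p + q) / (\<delta> * c) \<le> 2 * q / (\<delta> * c)" using p \<delta> c by (intro divide_right_mono) auto
      also have "\<dots> = 2 * (q / c) / \<delta>" by simp
      also have "q / c = exp (- 2 * x n)" by (simp add: q_def c_def algebra_simps flip: exp_diff)
      also have "2 * exp (- 2 * x n) / \<delta> \<le> 2 * exp (- x n) / \<delta>" using x0 \<delta> by (intro divide_right_mono) auto
      finally show "(p + q) / (\<delta> * c) \<le> 2 * exp (- x n) / \<delta>" .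
    qed
    also have "\<dots> = (2 + 2 / \<delta>) * exp (- x n)" by (simp add: algebra_simps)
    finally show ?thesis .
  qed
  have "(\<lambda>n. measure (data_law b G N u0 n)
      {y. posterior G \<zeta> (L n) (\<mu> n) n y {u. norm (u - u0) > M * \<xi> n} > \<delta>}) \<longlonglongrightarrow> 0" if \<delta>: "\<delta> > 0" for \<delta>
  proof (rule tendsto_sandwich[where f="\<lambda>_. 0" and h="\<lambda>n. (2 + 2 / \<delta>) * exp (- x n)"])
    show "\<forall>\<^sub>F n in sequentially. measure (data_law b G N u0 n)
        {y. posterior G \<zeta> (L n) (\<mu> n) n y {u. norm (u - u0) > M * \<xi> n} > \<delta>} \<le> (2 + 2 / \<delta>) * exp (- x n)"
      using near eventually_ge_at_top[of 1] by eventually_elim (intro bound \<delta>)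
    have "filterlim x at_top sequentially" using cond1(2) unfolding x_def .
    then have "(\<lambda>n. exp (- x n)) \<longlonglongrightarrow> 0"
      by (intro filterlim_compose[OF exp_at_bot] filterlim_compose[OF filterlim_uminus_at_bot_at_top])
    from tendsto_mult_right_zero[OF this] show "(\<lambda>n. (2 + 2 / \<delta>) * exp (- x n)) \<longlonglongrightarrow> 0" .
  qed simp_all
  with M show ?thesis by blast
qed

end
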